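(* 1. Let $f$ be an almost-convex function on $\mathbb{R}^n$. Then $s(f_{\mathbf{T}})=f^*$ and $s(f_{\mathbf{T}\mathbf{T}})=f$. 2. Let $f_1$ and $f_2$ be two almost-convex functions on $\mathbb{R}^n$. Then $s(f_{1\underline{\square}2})=f_1\square f_2$.
   Context: All functions are smooth and finite-valued unless indicated. A function $g$ on $\mathbb{R}^k$ is simple if $\nabla g$ is a diffeomorphism of $\mathbb{R}^k$; its Morse index is the Morse index of its unique critical point. A function $f$ on $\mathbb{R}^k$ is almost-simple if $f=g+h$ with $g$ simple and $\|\nabla h\|$ bounded; the Morse index of $g$ does not depend on the decomposition and is called the Morse index of $f$. $f$ is almost-convex if it is almost-simple of Morse index $0$. Legendre--Fenchel transform: $f^*(q)=\sup_{v\in\mathbb{R}^n}\{qv-f(v)\}$. Infimal-convolution: $(f_1\square f_2)(q)=\inf_{v\in\mathbb{R}^n}\{f_1(v)+f_2(q-v)\}$. Here $qv$ is the Euclidean scalar product. Generating functions: for $F$ on $\mathbb{R}^n\times\mathbb{R}^k$ with base variable $q\in\mathbb{R}^n$ and fibre variable $w\in\mathbb{R}^k$ ($k=0$ allowed), $F_{\mathbf{T}}(q,v,w)=qv-F(v,w)$, with base variable $q\in\mathbb{R}^n$ and fibre variables $(v,w)\in\mathbb{R}^n\times\mathbb{R}^k$. Thus $f_{\mathbf{T}}(q,v)=qv-f(v)$ and $f_{\mathbf{T}\mathbf{T}}(q,v,w)=qv-f_{\mathbf T}(v,w)=qv-vw+f(w)$, with base variable $q\in\mathbb{R}^n$ and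 fibre variables $v\in\mathbb{R}^n$, respectively $(v,w)\in\mathbb{R}^n\times\mathbb{R}^n$. Also $f_{1\underline{\square}2}(q,v)=f_1(v)+f_2(q-v)$ with base variable $q\in\mathbb{R}^n$ and fibre variable $v\in\mathbb{R}^n$. Min-max: let $f$ be a function on $\mathbb{R}^k$ with proper gradient map. Its critical values lie in some $]-C,C[$; put $f^\lambda=f^{-1}(]-\infty,\lambda])$, and denote by $f^{+\infty}$ (resp. $f^{-\infty}$) the sublevel set $f^{\lambda}$ (resp. $f^{-\lambda}$) for any $\lambda>C$. If there is $\iota\in\{0,\dots,k\}$ such that $H_*(f^{+\infty},f^{-\infty};\mathbb{Q})$ is $\mathbb{Q}$ in degree $\iota$ and $0$ in all other degrees, then $s(f)=\inf\{\lambda\mid H_\iota(f^\lambda,f^{-\infty};\mathbb{Q})\to H_\iota(f^{+\infty},f^{-\infty};\mathbb{Q})\text{ is surjective}\}$, the map being induced by inclusion. Every almost-simple function has a min-max. Selector: a generating function $F$ on $\mathbb{R}^n\times\mathbb{R}^k$ is almost-simple if $F=G+H$ where for every $q$ the function $G(q,\cdot)$ is simple and $\|\nabla_wH(q,w)\|\le B(q)$ for all $w$, with $B$ a continuous bounded function on $\mathbb{R}^n$. Its selector is $s(F):\mathbb{R}^n\to\mathbb{R}$, $s(F)(q)=s(F(q,\cdot))$. The claim includes that the selectors appearing in it exist. *)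

theory Defs
  imports "HOL-Analysis.Analysis" "HOL-Homology.Homology"
begin

subsection \<open>Smooth functions, gradients, Morse index\<close>

text \<open>Iterated directional derivatives are again maps between the same two spaces, so
  differentiability of every order is a plain recursion. On a Euclidean domain this is the
  usual class of $k$ times continuously differentiable maps.\<close>

primrec C_k :: "nat \<Rightarrow> ('a::euclidean_space \<Rightarrow> 'b::real_normed_vector) \<Rightarrow> bool" where
  "C_k 0 f \<longleftrightarrow> continuous_on UNIV f"
| "C_k (Suc k) f \<longleftrightarrow>
     (\<forall>x. f differentiable (at x)) \<and> (\<forall>v. C_k k (\<lambda>x. frechet_derivative f (at x) v))"

definition smooth :: "('a::euclidean_space \<Rightarrow> 'b::real_normed_vector) \<Rightarrow> bool" where
  "smooth f \<longleftrightarrow> (\<forall>k. C_k k f)"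

definition diffeomorphism :: "('a::euclidean_space \<Rightarrow> 'a) \<Rightarrow> bool" where
  "diffeomorphism \<phi> \<longleftrightarrow> bij \<phi> \<and> smooth \<phi> \<and> smooth (inv_into UNIV \<phi>)"

definition grad :: "('a::euclidean_space \<Rightarrow> real) \<Rightarrow> 'a \<Rightarrow> 'a" where
  "grad f x = (THE D. GDERIV f x :> D)"

definition hessian :: "('a::euclidean_space \<Rightarrow> real) \<Rightarrow> 'a \<Rightarrow> 'a \<Rightarrow> 'a \<Rightarrow> real" where
  "hessian f x u v = frechet_derivative (\<lambda>y. frechet_derivative f (at y) u) (at x) v"

definition morse_index_at :: "('a::euclidean_space \<Rightarrow> real) \<Rightarrow> 'a \<Rightarrow> nat" where
  "morse_index_at f x =
     Max {dim S | S. subspace S \<and> (\<forall>v\<in>S - {0}. hessian f x v v < 0)}"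

definition simple :: "('a::euclidean_space \<Rightarrow> real) \<Rightarrow> bool" where
  "simple g \<longleftrightarrow> smooth g \<and> diffeomorphism (grad g)"

definition simple_index :: "('a::euclidean_space \<Rightarrow> real) \<Rightarrow> nat" where
  "simple_index g = morse_index_at g (THE x. grad g x = 0)"

definition almost_simple_of_index :: "('a::euclidean_space \<Rightarrow> real) \<Rightarrow> nat \<Rightarrow> bool" where
  "almost_simple_of_index f i \<longleftrightarrow>
     (\<exists>g h. f = (\<lambda>x. g x + h x) \<and> simple g \<and> smooth h \<and>
            bounded (range (grad h)) \<and> simple_index g = i)"

definition almost_convex :: "('a::euclidean_space \<Rightarrow> real) \<Rightarrow> bool" where
  "almost_convex f \<longleftrightarrow> almost_simple_of_index f 0"


subsection \<open>Legendre--Fenchel transform and infimal-convolution\<close>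

text \<open>Both are taken in the extended reals, so that equality with a real-valued function
  includes finiteness of the supremum or infimum.\<close>

definition fenchel :: "('a::euclidean_space \<Rightarrow> real) \<Rightarrow> 'a \<Rightarrow> ereal" where
  "fenchel f q = (SUP v. ereal (q \<bullet> v - f v))"

definition inf_convolution ::
    "('a::euclidean_space \<Rightarrow> real) \<Rightarrow> ('a \<Rightarrow> real) \<Rightarrow> 'a \<Rightarrow> ereal" where
  "inf_convolution f1 f2 q = (INF v. ereal (f1 v + f2 (q - v)))"


subsection \<open>Generating functions, in the form base variable, then fibre variable\<close>

text \<open>There is no zero-dimensional Euclidean space type, so the transform of a function
  without fibre variable is a separate constant.\<close>

definition gf_T0 :: "('a::euclidean_space \<Rightarrow> real) \<Rightarrow> 'a \<Rightarrow> 'a \<Rightarrow> real" where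
  "gf_T0 f q v = q \<bullet> v - f v"

definition gf_T ::
    "('a::euclidean_space \<Rightarrow> 'w::euclidean_space \<Rightarrow> real) \<Rightarrow> 'a \<Rightarrow> 'a \<times> 'w \<Rightarrow> real" where
  "gf_T F q = (\<lambda>(v, w). q \<bullet> v - F v w)"

definition gf_box ::
    "('a::euclidean_space \<Rightarrow> real) \<Rightarrow> ('a \<Rightarrow> real) \<Rightarrow> 'a \<Rightarrow> 'a \<Rightarrow> real" where
  "gf_box f1 f2 q v = f1 v + f2 (q - v)"


subsection \<open>Relative singular homology with rational coefficients\<close>

text \<open>This follows the integral construction in HOL-Homology, with the same singular
  simplices and faces, but with coefficients in the rationals.\<close>

type_synonym 'a rat_chain = "((nat \<Rightarrow> real) \<Rightarrow> 'a) \<Rightarrow>\<^sub>0 rat"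

definition rat_singular_chain :: "nat \<Rightarrow> 'a topology \<Rightarrow> 'a rat_chain \<Rightarrow> bool" where
  "rat_singular_chain p X c \<longleftrightarrow> Poly_Mapping.keys c \<subseteq> singular_simplex_set p X"

definition rat_chain_boundary :: "nat \<Rightarrow> 'a rat_chain \<Rightarrow> 'a rat_chain" where
  "rat_chain_boundary p c =
     (if p = 0 then 0
      else \<Sum>\<sigma>\<in>Poly_Mapping.keys c. \<Sum>k\<le>p.
             Poly_Mapping.single (singular_face p k \<sigma>) ((-1) ^ k * Poly_Mapping.lookup c \<sigma>))"

definition rat_relcycles :: "nat \<Rightarrow> 'a topology \<Rightarrow> 'a set \<Rightarrow> 'a rat_chain set" where
  "rat_relcycles p X S =
     {c. rat_singular_chain p X c \<and>
         rat_singular_chain (p - 1) (subtopology X S) (rat_chain_boundary p c)}"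

definition rat_relboundaries :: "nat \<Rightarrow> 'a topology \<Rightarrow> 'a set \<Rightarrow> 'a rat_chain set" where
  "rat_relboundaries p X S =
     {c. \<exists>d. rat_singular_chain (Suc p) X d \<and>
             rat_singular_chain p (subtopology X S) (c - rat_chain_boundary (Suc p) d)}"

definition rat_relcycle_group :: "nat \<Rightarrow> 'a topology \<Rightarrow> 'a set \<Rightarrow> 'a rat_chain monoid" where
  "rat_relcycle_group p X S = \<lparr>carrier = rat_relcycles p X S, mult = (+), one = 0\<rparr>"

definition rat_homology_group ::
    "nat \<Rightarrow> 'a topology \<Rightarrow> 'a set \<Rightarrow> 'a rat_chain set monoid" where
  "rat_homology_group p X S = rat_relcycle_group p X S Mod rat_relboundaries p X S"

text \<open>The map induced by an inclusion of pairs $(X,S) \subseteq (Y,T)$. An inclusion acts as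
  the identity on singular chains, so the class of $c$ modulo the boundaries of $(X,S)$ is sent
  to the class of $c$ modulo the boundaries of $(Y,T)$.\<close>

definition rat_hom_inclusion ::
    "nat \<Rightarrow> 'a topology \<Rightarrow> 'a set \<Rightarrow> 'a rat_chain set \<Rightarrow> 'a rat_chain set" where
  "rat_hom_inclusion p Y T \<C> = rat_relboundaries p Y T <#>\<^bsub>rat_relcycle_group p Y T\<^esub> \<C>"

text \<open>Additive maps between rational vector spaces are linear, so being isomorphic to this
  group means being a one-dimensional rational vector space.\<close>

definition rat_group :: "rat monoid" where
  "rat_group = \<lparr>carrier = UNIV, mult = (+), one = 0\<rparr>"


subsection \<open>Min-max and selector\<close>

definition sublevel :: "('a::euclidean_space \<Rightarrow> real) \<Rightarrow> real \<Rightarrow> 'a set" where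
  "sublevel f t = {x. f x \<le> t}"

text \<open>The sublevel sets at heights $c$ and $-c$ then serve as those at heights $+\infty$ and
  $-\infty$.\<close>

definition minmax_level :: "('a::euclidean_space \<Rightarrow> real) \<Rightarrow> real \<Rightarrow> bool" where
  "minmax_level f c \<longleftrightarrow>
     (\<exists>C. 0 < C \<and> C < c \<and> (\<forall>x. grad f x = 0 \<longrightarrow> f x \<in> {-C<..<C}))"

definition sublevel_homology ::
    "('a::euclidean_space \<Rightarrow> real) \<Rightarrow> real \<Rightarrow> real \<Rightarrow> nat \<Rightarrow> 'a rat_chain set monoid" where
  "sublevel_homology f c t p =
     rat_homology_group p (top_of_set (sublevel f t)) (sublevel f (-c))"

text \<open>The range of $t$ in the infimum is the one where the inclusions
  $f^{-\infty} \subseteq f^t \subseteq f^{+\infty}$ make sense.\<close>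

definition is_minmax :: "('a::euclidean_space \<Rightarrow> real) \<Rightarrow> real \<Rightarrow> bool" where
  "is_minmax f s \<longleftrightarrow>
     smooth f \<and> proper_map euclidean euclidean (grad f) \<and>
     (\<exists>\<iota>\<in>{0..DIM('a)}. \<forall>c. minmax_level f c \<longrightarrow>
        sublevel_homology f c c \<iota> \<cong> rat_group \<and>
        (\<forall>p. p \<noteq> \<iota> \<longrightarrow> trivial_group (sublevel_homology f c c p)) \<and>
        s = Inf {t. - c \<le> t \<and> t \<le> c \<and>
                   rat_hom_inclusion \<iota> (top_of_set (sublevel f c)) (sublevel f (-c))
                     ` carrier (sublevel_homology f c t \<iota>)
                   = carrier (sublevel_homology f c c \<iota>)})"

definition has_minmax :: "('a::euclidean_space \<Rightarrow> real) \<Rightarrow> bool" where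
  "has_minmax f \<longleftrightarrow> (\<exists>s. is_minmax f s)"

definition minmax :: "('a::euclidean_space \<Rightarrow> real) \<Rightarrow> real" where
  "minmax f = (THE s. is_minmax f s)"

definition almost_simple_gf ::
    "('q::euclidean_space \<Rightarrow> 'w::euclidean_space \<Rightarrow> real) \<Rightarrow> bool" where
  "almost_simple_gf F \<longleftrightarrow>
     (\<exists>G H B. F = (\<lambda>q w. G q w + H q w) \<and>
        smooth (\<lambda>(q, w). G q w) \<and> smooth (\<lambda>(q, w). H q w) \<and>
        (\<forall>q. simple (G q)) \<and>
        continuous_on UNIV B \<and> bounded (range B) \<and>
        (\<forall>q w. norm (grad (H q) w) \<le> B q))"

definition has_selector ::
    "('q::euclidean_space \<Rightarrow> 'w::euclidean_space \<Rightarrow> real) \<Rightarrow> bool" where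
  "has_selector F \<longleftrightarrow> almost_simple_gf F \<and> (\<forall>q. has_minmax (F q))"

definition selector ::
    "('q::euclidean_space \<Rightarrow> 'w::euclidean_space \<Rightarrow> real) \<Rightarrow> 'q \<Rightarrow> real" where
  "selector F q = minmax (F q)"

end

theory Submission
  imports Defs
begin

text \<open>
  An almost-convex \<open>f = g + h\<close> has a convex main part. The Hessian of \<open>g\<close> is invertible everywhere
  because \<open>grad g\<close> is a diffeomorphism, it is positive definite at the critical point because the
  index is zero, and so by connectedness it is positive definite everywhere
  (\<open>pos_hess_of_simple\<close>). As \<open>grad g\<close> is onto, \<open>g\<close> grows faster than any linear
  function, and the bounded perturbation \<open>grad h\<close> cannot spoil this: outside a large ball around any
  centre \<open>f\<close> increases along rays (\<open>steep_elliptic_plus_bounded\<close>).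

  With \<open>q\<close> fixed, the three generating functions then have simple shapes. The function
  \<open>v \<mapsto> f1 v + f2 (q - v)\<close> is of the same almost-convex kind, and the claim is that its min-max is its
  minimum. The function \<open>v \<mapsto> q \<bullet> v - f v\<close> is the negative of such a function, and the claim is that
  its min-max is its maximum. The function \<open>(v, w) \<mapsto> q \<bullet> v - v \<bullet> w + f w\<close> has the single critical value
  \<open>f q\<close>, and a homeomorphism turns it into \<open>f q + \<bar>a\<bar>\<^sup>2 - \<bar>b\<bar>\<^sup>2\<close>, whatever the smooth function \<open>f\<close> is.

  In each case the homology of the sublevel sets is found by deforming them. For a function \<open>F\<close> that
  is eventually increasing along rays, sublevel sets at high levels are star-shaped about the
  minimum point and their complements are complements of balls up to deformation; gradient steps
  (\<open>uphill_homotopy_exists\<close>) carry this down to every level above the critical values. For the minimum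
  the relevant class is that of a point, which lives in a sublevel set as soon as that set is nonempty
  (\<open>is_minmax_minimum\<close>). For the maximum it is the class of the whole space modulo the complement of
  a ball, which a set missing the maximum point cannot carry (\<open>is_minmax_maximum\<close>). For the
  quadratic form it is the class of the negative directions (\<open>is_minmax_saddle\<close>).

  Everything is first done for integral homology and then transferred. Since a rational chain has
  a common denominator, an infinite cyclic integral group gives a one-dimensional rational
  one, a trivial group gives a trivial one, and surjective or vanishing maps induced by inclusions
  stay so.
\<close>

section \<open>The calculus of smooth maps\<close>

lemma C_k_SucI:
  assumes "\<And>x. (f has_derivative f' x) (at x)" "\<And>v. C_k k (\<lambda>x. f' x v)"
  shows "C_k (Suc k) f"
proof -
  have "frechet_derivative f (at x) = f' x" for x
    using frechet_derivative_at[OF assms(1)] by simp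
  then show ?thesis
    using assms by (auto simp: differentiable_def)
qed

lemma C_k_SucD:
  assumes "C_k (Suc k) f"
  shows "(f has_derivative frechet_derivative f (at x)) (at x)"
    and "C_k k (\<lambda>x. frechet_derivative f (at x) v)"
  using assms by (auto simp: frechet_derivative_works)

lemma C_k_Suc_continuous: "C_k (Suc k) f \<Longrightarrow> continuous_on UNIV f"
  by (meson C_k_SucD(1) continuous_at_imp_continuous_on has_derivative_continuous)

lemma C_k_Suc_imp_C_k: "C_k (Suc k) f \<Longrightarrow> C_k k f"
proof (induction k arbitrary: f)
  case 0
  then show ?case using C_k_Suc_continuous[of 0 f] by (simp only: C_k.simps(1))
next
  case (Suc k)
  then show ?case by (metis C_k.simps(2))
qed

lemma C_k_const: "C_k k (\<lambda>x. c)"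
proof (induction k arbitrary: c)
  case (Suc k)
  show ?case by (rule C_k_SucI[where f'="\<lambda>x v. 0"]) (use Suc in auto)
qed auto

lemma C_k_bounded_linear: "bounded_linear L \<Longrightarrow> C_k k L"
proof (cases k)
  case (Suc n)
  assume "bounded_linear L"
  then show ?thesis unfolding Suc
    by (intro C_k_SucI[where f'="\<lambda>x. L"]) (auto intro: bounded_linear_imp_has_derivative C_k_const)
qed (simp add: linear_continuous_on)

lemma C_k_add: "C_k k f \<Longrightarrow> C_k k g \<Longrightarrow> C_k k (\<lambda>x. f x + g x)"
proof (induction k arbitrary: f g)
  case (Suc k)
  show ?case
    by (rule C_k_SucI[where f'="\<lambda>x v. frechet_derivative f (at x) v + frechet_derivative g (at x) v"])
      (use Suc in \<open>auto intro!: has_derivative_add Suc.IH simp del: C_k.simps dest: C_k_SucD\<close>)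
qed (simp add: continuous_on_add)

lemma C_k_sum: "(\<And>i. i \<in> I \<Longrightarrow> C_k k (f i)) \<Longrightarrow> C_k k (\<lambda>x. \<Sum>i\<in>I. f i x)"
  by (induction I rule: infinite_finite_induct) (auto intro: C_k_const C_k_add)

lemma C_k_bilinear:
  assumes "bounded_bilinear B"
  shows "C_k k f \<Longrightarrow> C_k k g \<Longrightarrow> C_k k (\<lambda>x. B (f x) (g x))"
proof (induction k arbitrary: f g)
  case 0
  then show ?case by (simp add: bounded_bilinear.continuous_on[OF assms])
next
  case (Suc k)
  show ?case
    by (rule C_k_SucI[OF bounded_bilinear.FDERIV[OF assms C_k_SucD(1)[OF Suc.prems(1)]
            C_k_SucD(1)[OF Suc.prems(2)]]])
      (intro C_k_add Suc.IH C_k_SucD(2)[OF Suc.prems(1)]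
        C_k_SucD(2)[OF Suc.prems(2)] Suc.prems[THEN C_k_Suc_imp_C_k])
qed

lemmas C_k_scaleR = C_k_bilinear[OF bounded_bilinear_scaleR]
lemmas C_k_inner = C_k_bilinear[OF bounded_bilinear_inner]
lemmas C_k_mult = C_k_bilinear[OF bounded_bilinear_mult]

lemma C_k_prod:
  fixes f :: "'i \<Rightarrow> 'a::euclidean_space \<Rightarrow> real"
  shows "(\<And>i. i \<in> I \<Longrightarrow> C_k k (f i)) \<Longrightarrow> C_k k (\<lambda>x. \<Prod>i\<in>I. f i x)"
  by (induction I rule: infinite_finite_induct) (auto intro: C_k_const C_k_mult)

text \<open>Expanding the inner derivative in an orthonormal basis turns the chain rule into a finite sum
  of products of functions that are one order less smooth, which closes the induction.\<close>

lemma C_k_compose: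
  fixes f :: "'a::euclidean_space \<Rightarrow> 'b::euclidean_space" and g :: "'b \<Rightarrow> 'c::real_normed_vector"
  shows "C_k k g \<Longrightarrow> C_k k f \<Longrightarrow> C_k k (\<lambda>x. g (f x))"
proof (induction k arbitrary: g f)
  case 0
  then show ?case by (auto intro: continuous_on_compose2)
next
  case (Suc k)
  let ?f' = "\<lambda>x. frechet_derivative f (at x)" and ?g' = "\<lambda>y. frechet_derivative g (at y)"
  have eq: "?g' (f x) (?f' x v) = (\<Sum>b\<in>Basis. (?f' x v \<bullet> b) *\<^sub>R ?g' (f x) b)" for x v
  proof -
    interpret linear "?g' (f x)"
      using C_k_SucD(1)[OF Suc.prems(1)] has_derivative_linear by blast
    have "?g' (f x) (?f' x v) = ?g' (f x) (\<Sum>b\<in>Basis. (?f' x v \<bullet> b) *\<^sub>R b)"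
      by (simp add: euclidean_representation)
    then show ?thesis by (simp add: sum scale)
  qed
  show ?case
  proof (rule C_k_SucI[where f'="\<lambda>x v. ?g' (f x) (?f' x v)"])
    show "((\<lambda>x. g (f x)) has_derivative (\<lambda>v. ?g' (f x) (?f' x v))) (at x)" for x
      using diff_chain_at[OF C_k_SucD(1)[OF Suc.prems(2)] C_k_SucD(1)[OF Suc.prems(1)]]
      by (simp add: o_def)
    show "C_k k (\<lambda>x. ?g' (f x) (?f' x v))" for v
      unfolding eq
      by (intro C_k_sum C_k_scaleR C_k_inner C_k_SucD(2)[OF Suc.prems(2)] C_k_const
          Suc.IH[OF C_k_SucD(2)[OF Suc.prems(1)]] C_k_Suc_imp_C_k[OF Suc.prems(2)])
  qed
qed

lemma C_k_inverse:
  fixes f :: "'a::euclidean_space \<Rightarrow> real"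
  assumes "\<And>x. f x \<noteq> 0"
  shows "C_k k f \<Longrightarrow> C_k k (\<lambda>x. inverse (f x))"
proof (induction k)
  case 0
  then show ?case using assms by (auto intro: continuous_on_inverse)
next
  case (Suc k)
  show ?case
  proof (rule C_k_SucI[OF Deriv.has_derivative_inverse[OF assms C_k_SucD(1)[OF Suc.prems]]])
    fix v
    have "C_k k (\<lambda>x. (- 1) * (inverse (f x) * frechet_derivative f (at x) v * inverse (f x)))"
      by (intro C_k_mult C_k_const Suc.IH C_k_Suc_imp_C_k[OF Suc.prems] C_k_SucD(2)[OF Suc.prems])
    then show "C_k k (\<lambda>x. - (inverse (f x) * frechet_derivative f (at x) v * inverse (f x)))"
      by simp
  qed
qed

lemma C_k_componentwise:
  fixes f :: "'a::euclidean_space \<Rightarrow> 'b::euclidean_space"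
  assumes "\<And>b. b \<in> Basis \<Longrightarrow> C_k k (\<lambda>x. f x \<bullet> b)"
  shows "C_k k f"
proof -
  have "C_k k (\<lambda>x. \<Sum>b\<in>Basis. (f x \<bullet> b) *\<^sub>R b)"
    by (intro C_k_sum C_k_scaleR C_k_const assms)
  then show ?thesis by (simp add: euclidean_representation)
qed

lemma C_k_Pair:
  fixes f :: "'a::euclidean_space \<Rightarrow> 'b::euclidean_space" and g :: "'a \<Rightarrow> 'c::euclidean_space"
  assumes "C_k k f" "C_k k g"
  shows "C_k k (\<lambda>x. (f x, g x))"
proof (rule C_k_componentwise)
  fix b :: "'b \<times> 'c"
  have "C_k k (\<lambda>x. f x \<bullet> fst b + g x \<bullet> snd b)"
    by (intro C_k_add C_k_inner C_k_const assms)
  then show "C_k k (\<lambda>x. (f x, g x) \<bullet> b)"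
    by (simp add: inner_prod_def)
qed


lemma smooth_const: "smooth (\<lambda>x. c)"
  by (simp add: smooth_def C_k_const)

lemma smooth_bounded_linear: "bounded_linear L \<Longrightarrow> smooth L"
  by (simp add: smooth_def C_k_bounded_linear)

lemma smooth_add: "smooth f \<Longrightarrow> smooth g \<Longrightarrow> smooth (\<lambda>x. f x + g x)"
  by (simp add: smooth_def C_k_add)

lemma smooth_inner: "smooth f \<Longrightarrow> smooth g \<Longrightarrow> smooth (\<lambda>x. f x \<bullet> g x)"
  by (simp add: smooth_def C_k_inner)

lemma smooth_compose:
  fixes f :: "'a::euclidean_space \<Rightarrow> 'b::euclidean_space"
  shows "smooth g \<Longrightarrow> smooth f \<Longrightarrow> smooth (\<lambda>x. g (f x))"
  by (simp add: smooth_def C_k_compose)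

lemma smooth_minus:
  fixes f :: "'a::euclidean_space \<Rightarrow> 'b::euclidean_space"
  shows "smooth f \<Longrightarrow> smooth (\<lambda>x. - f x)"
  by (rule smooth_compose[OF smooth_bounded_linear[OF bounded_linear_minus[OF bounded_linear_ident]]])

lemma smooth_diff:
  fixes f :: "'a::euclidean_space \<Rightarrow> 'b::euclidean_space"
  shows "smooth f \<Longrightarrow> smooth g \<Longrightarrow> smooth (\<lambda>x. f x - g x)"
  using smooth_add[OF _ smooth_minus] by fastforce

lemma smooth_Pair:
  fixes f :: "'a::euclidean_space \<Rightarrow> 'b::euclidean_space" and g :: "'a \<Rightarrow> 'c::euclidean_space"
  shows "smooth f \<Longrightarrow> smooth g \<Longrightarrow> smooth (\<lambda>x. (f x, g x))"
  by (simp add: smooth_def C_k_Pair)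

lemma smooth_ident: "smooth (\<lambda>x. x)"
  by (rule smooth_bounded_linear) (rule bounded_linear_ident)

lemma smooth_fst: "smooth fst" and smooth_snd: "smooth snd"
  by (rule smooth_bounded_linear, rule bounded_linear_fst bounded_linear_snd)+

lemma smooth_componentwise:
  fixes f :: "'a::euclidean_space \<Rightarrow> 'b::euclidean_space"
  assumes "\<And>b. b \<in> Basis \<Longrightarrow> smooth (\<lambda>x. f x \<bullet> b)"
  shows "smooth f"
  using assms by (simp add: smooth_def C_k_componentwise)

lemma smooth_has_derivative:
  assumes "smooth f"
  shows "(f has_derivative frechet_derivative f (at x)) (at x)"
    and "smooth (\<lambda>x. frechet_derivative f (at x) v)"
  using assms by (auto simp only: smooth_def intro: C_k_SucD)

lemma smooth_continuous_on: "smooth f \<Longrightarrow> continuous_on S f"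
  by (meson C_k.simps(1) continuous_on_subset smooth_def subset_UNIV)

section \<open>Gradients and Hessians\<close>

lemma grad_eqI:
  assumes "(f has_derivative (\<lambda>h. D \<bullet> h)) (at x)"
  shows "grad f x = D"
  unfolding grad_def
proof (rule the_equality)
  show "GDERIV f x :> D" using assms by (simp add: gderiv_def inner_commute)
next
  fix D' assume "GDERIV f x :> D'"
  then have "(f has_derivative (\<lambda>h. D' \<bullet> h)) (at x)" by (simp add: gderiv_def inner_commute)
  then have "(\<lambda>h. D' \<bullet> h) = (\<lambda>h. D \<bullet> h)"
    using assms has_derivative_unique by blast
  then show "D' = D" by (metis vector_eq_rdot inner_commute)
qed

lemma has_derivative_grad:
  assumes "f differentiable at x"
  shows "(f has_derivative (\<lambda>h. grad f x \<bullet> h)) (at x)"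
proof -
  obtain f' where f': "(f has_derivative f') (at x)" using assms by (auto simp: differentiable_def)
  interpret linear f' using f' has_derivative_linear by blast
  have "f' = (\<lambda>h. (\<Sum>b\<in>Basis. f' b *\<^sub>R b) \<bullet> h)"
  proof
    fix h
    have "f' h = f' (\<Sum>b\<in>Basis. (h \<bullet> b) *\<^sub>R b)" by (simp add: euclidean_representation)
    also have "\<dots> = (\<Sum>b\<in>Basis. f' b *\<^sub>R b) \<bullet> h"
      by (simp add: sum scale inner_sum_left inner_commute[of h] mult.commute)
    finally show "f' h = (\<Sum>b\<in>Basis. f' b *\<^sub>R b) \<bullet> h" .
  qed
  then show ?thesis using f' grad_eqI by metis
qed

lemma smooth_has_derivative_grad: "smooth f \<Longrightarrow> (f has_derivative (\<lambda>h. grad f x \<bullet> h)) (at x)"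
  by (meson differentiable_def has_derivative_grad smooth_has_derivative(1))

lemma frechet_derivative_eq_grad: "smooth f \<Longrightarrow> frechet_derivative f (at x) v = grad f x \<bullet> v"
  by (metis frechet_derivative_at smooth_has_derivative_grad)

lemma smooth_grad: "smooth f \<Longrightarrow> smooth (grad f)"
  by (rule smooth_componentwise) (simp flip: frechet_derivative_eq_grad add: smooth_has_derivative(2))

lemma grad_add: "smooth f \<Longrightarrow> smooth g \<Longrightarrow> grad (\<lambda>x. f x + g x) = (\<lambda>x. grad f x + grad g x)"
  by (rule ext, rule grad_eqI, simp add: inner_add_left)
    (intro has_derivative_add smooth_has_derivative_grad)

lemma grad_minus: "smooth f \<Longrightarrow> grad (\<lambda>x. - f x) = (\<lambda>x. - grad f x)"
  by (rule ext, rule grad_eqI, simp) (intro has_derivative_minus smooth_has_derivative_grad)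

lemma grad_inner_left: "grad (\<lambda>x. q \<bullet> x) = (\<lambda>x. q)"
  by (rule ext, rule grad_eqI) (auto intro!: derivative_eq_intros)

lemma grad_reflect: "smooth f \<Longrightarrow> grad (\<lambda>x. f (q - x)) = (\<lambda>x. - grad f (q - x))"
proof (rule ext, rule grad_eqI)
  fix x assume f: "smooth f"
  have "((\<lambda>x. q - x) has_derivative (\<lambda>h. - h)) (at x)" by (auto intro!: derivative_eq_intros)
  from diff_chain_at[OF this smooth_has_derivative_grad[OF f]]
  show "((\<lambda>x. f (q - x)) has_derivative (\<bullet>) (- grad f (q - x))) (at x)"
    by (simp add: o_def inner_minus_left[abs_def])
qed

abbreviation hess :: "('a::euclidean_space \<Rightarrow> real) \<Rightarrow> 'a \<Rightarrow> 'a \<Rightarrow> 'a" where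
  "hess f x \<equiv> frechet_derivative (grad f) (at x)"

lemma has_derivative_hess: "smooth f \<Longrightarrow> (grad f has_derivative hess f x) (at x)"
  by (simp add: smooth_grad smooth_has_derivative(1))

lemma linear_hess: "smooth f \<Longrightarrow> linear (hess f x)"
  using has_derivative_hess has_derivative_linear by blast

lemma hessian_eq_hess:
  assumes "smooth f" shows "hessian f x u v = hess f x v \<bullet> u"
proof -
  have "((\<lambda>y. grad f y \<bullet> u) has_derivative (\<lambda>v. hess f x v \<bullet> u)) (at x)"
    by (intro has_derivative_inner_left has_derivative_hess assms)
  then show ?thesis
    unfolding hessian_def frechet_derivative_eq_grad[OF assms] by (metis frechet_derivative_at)
qed

lemma DERIV_along_line:
  assumes "(f has_derivative f') (at (p + s *\<^sub>R u))"
  shows "((\<lambda>s. f (p + s *\<^sub>R u)) has_real_derivative f' u) (at s)"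
proof -
  interpret linear f' using assms has_derivative_linear by blast
  have "((\<lambda>s. p + s *\<^sub>R u) has_derivative (\<lambda>h. h *\<^sub>R u)) (at s)"
    by (auto intro!: derivative_eq_intros)
  from diff_chain_at[OF this assms] show ?thesis
    by (simp add: o_def has_field_derivative_def scale mult_commute_abs)
qed

text \<open>Two applications of the mean value theorem to the second difference of a function. The
  difference is symmetric in the two directions, and letting the step tend to zero gives the
  symmetry of the Hessian.\<close>

lemma second_difference_eq_hess:
  assumes f: "smooth f" and t: "t > 0"
  obtains \<xi> \<eta> where "0 < \<xi>" "\<xi> < t" "0 < \<eta>" "\<eta> < t"
    "f (x + t *\<^sub>R u + t *\<^sub>R v) - f (x + t *\<^sub>R u) - f (x + t *\<^sub>R v) + f x
      = t\<^sup>2 * (hess f (x + \<xi> *\<^sub>R u + \<eta> *\<^sub>R v) v \<bullet> u)"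
proof -
  have "DERIV (\<lambda>s. f ((x + t *\<^sub>R v) + s *\<^sub>R u) - f (x + s *\<^sub>R u)) s :>
      grad f ((x + t *\<^sub>R v) + s *\<^sub>R u) \<bullet> u - grad f (x + s *\<^sub>R u) \<bullet> u" for s
    by (intro DERIV_diff DERIV_along_line smooth_has_derivative_grad f)
  from MVT2[OF t this] obtain \<xi> where \<xi>: "0 < \<xi>" "\<xi> < t"
    "f ((x + t *\<^sub>R v) + t *\<^sub>R u) - f (x + t *\<^sub>R u) - (f (x + t *\<^sub>R v) - f x)
      = t * (grad f ((x + t *\<^sub>R v) + \<xi> *\<^sub>R u) \<bullet> u - grad f (x + \<xi> *\<^sub>R u) \<bullet> u)"
    by auto
  have "DERIV (\<lambda>s. grad f ((x + \<xi> *\<^sub>R u) + s *\<^sub>R v) \<bullet> u) s :> hess f ((x + \<xi> *\<^sub>R u) + s *\<^sub>R v) v \<bullet> u" for s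
    by (rule DERIV_along_line, intro has_derivative_inner_left has_derivative_hess f)
  from MVT2[OF t this] obtain \<eta> where \<eta>: "0 < \<eta>" "\<eta> < t"
    "grad f ((x + \<xi> *\<^sub>R u) + t *\<^sub>R v) \<bullet> u - grad f (x + \<xi> *\<^sub>R u) \<bullet> u
      = t * (hess f ((x + \<xi> *\<^sub>R u) + \<eta> *\<^sub>R v) v \<bullet> u)"
    by auto
  have "(x + t *\<^sub>R v) + \<xi> *\<^sub>R u = (x + \<xi> *\<^sub>R u) + t *\<^sub>R v" by simp
  then show thesis
    using that[OF \<xi>(1,2) \<eta>(1,2)] \<xi>(3) \<eta>(3)
    by (simp add: power2_eq_square add.commute add.left_commute diff_diff_eq2)
qed

lemma continuous_hess: "smooth f \<Longrightarrow> continuous_on UNIV (\<lambda>x. hess f x v)"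
  by (simp add: smooth_continuous_on smooth_grad smooth_has_derivative(2))

lemma hess_symmetric:
  assumes f: "smooth f"
  shows "hess f x u \<bullet> v = hess f x v \<bullet> u"
proof -
  define t where "t n = inverse (real (Suc n))" for n
  have t: "t n > 0" for n by (simp add: t_def)
  have t0: "t \<longlonglongrightarrow> 0" unfolding t_def by (rule LIMSEQ_inverse_real_of_nat)
  have "\<forall>n. \<exists>y. norm (y - x) \<le> t n * (norm u + norm v) \<and>
      f (x + t n *\<^sub>R u + t n *\<^sub>R v) - f (x + t n *\<^sub>R u) - f (x + t n *\<^sub>R v) + f x = (t n)\<^sup>2 * (hess f y v \<bullet> u)"
    (is "\<forall>n. \<exists>y. ?P u v n y") for u v
  proof
    fix n
    obtain \<xi> \<eta> where *: "0 < \<xi>" "\<xi> < t n" "0 < \<eta>" "\<eta> < t n"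
      "f (x + t n *\<^sub>R u + t n *\<^sub>R v) - f (x + t n *\<^sub>R u) - f (x + t n *\<^sub>R v) + f x
        = (t n)\<^sup>2 * (hess f (x + \<xi> *\<^sub>R u + \<eta> *\<^sub>R v) v \<bullet> u)"
      using second_difference_eq_hess[OF f t] by blast
    have "norm (\<xi> *\<^sub>R u + \<eta> *\<^sub>R v) \<le> t n * norm u + t n * norm v"
      using *(1-4) by (intro norm_triangle_mono) (auto intro!: mult_right_mono)
    then show "\<exists>y. ?P u v n y"
      using * by (intro exI[of _ "x + \<xi> *\<^sub>R u + \<eta> *\<^sub>R v"]) (auto simp: algebra_simps)
  qed
  then obtain y where y: "\<And>u v n. norm (y u v n - x) \<le> t n * (norm u + norm v)"
    "\<And>u v n. f (x + t n *\<^sub>R u + t n *\<^sub>R v) - f (x + t n *\<^sub>R u) - f (x + t n *\<^sub>R v) + f x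
      = (t n)\<^sup>2 * (hess f (y u v n) v \<bullet> u)"
    by metis
  have ylim: "y u v \<longlonglongrightarrow> x" for u v
  proof (rule LIM_zero_cancel, rule Lim_null_comparison)
    show "\<forall>\<^sub>F n in sequentially. norm (y u v n - x) \<le> t n * (norm u + norm v)" using y(1) by simp
    show "(\<lambda>n. t n * (norm u + norm v)) \<longlonglongrightarrow> 0" by (rule tendsto_mult_left_zero[OF t0])
  qed
  have lim: "(\<lambda>n. hess f (y u v n) v \<bullet> u) \<longlonglongrightarrow> hess f x v \<bullet> u" for u v
    by (intro tendsto_inner tendsto_const
        continuous_on_tendsto_compose[OF continuous_hess[OF f] ylim]) auto
  have "hess f (y u v n) v \<bullet> u = hess f (y v u n) u \<bullet> v" for n
    using y(2)[of n u v] y(2)[of n v u] t[of n] by (simp add: algebra_simps)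
  then show ?thesis
    using lim[of u v] lim[of v u] LIMSEQ_unique by fastforce
qed

section \<open>Smoothness of inverse maps\<close>

lemma C_k_vec:
  fixes f :: "'i::finite \<Rightarrow> 'a::euclidean_space \<Rightarrow> real"
  assumes "\<And>i. C_k k (f i)" shows "C_k k (\<lambda>x. \<chi> i. f i x)"
  by (rule C_k_componentwise) (use assms in \<open>auto simp: Basis_vec_def inner_axis\<close>)

lemma C_k_det:
  fixes M :: "'a::euclidean_space \<Rightarrow> real^'n^'n"
  assumes "\<And>i j. C_k k (\<lambda>x. M x $ i $ j)"
  shows "C_k k (\<lambda>x. det (M x))"
  unfolding det_def by (intro C_k_sum C_k_mult C_k_const C_k_prod assms)

text \<open>Cramer's rule expresses the derivative of the inverse map by finitely many products,
  sums and quotients of first derivatives of the map at the inverse image, so each order of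
  smoothness of the inverse yields the next.\<close>

lemma smooth_inverse:
  fixes \<phi> :: "real^'n \<Rightarrow> real^'n"
  assumes sm: "smooth \<phi>" and bij: "bij \<phi>"
    and inj: "\<And>x v. frechet_derivative \<phi> (at x) v = 0 \<Longrightarrow> v = 0"
  shows "smooth (inv_into UNIV \<phi>)"
proof -
  let ?\<psi> = "inv_into UNIV \<phi>" and ?D = "\<lambda>x. frechet_derivative \<phi> (at x)"
  define A where "A x = matrix (?D x)" for x
  have lin: "linear (?D x)" for x
    using smooth_has_derivative(1)[OF sm] has_derivative_linear by blast
  have AD: "A x *v v = ?D x v" for x v
    unfolding A_def using matrix_vector_mul(2)[OF lin] by metis
  have "inj (?D x)" for x
    using linear_injective_0[OF lin] inj by blast
  then have det: "det (A x) \<noteq> 0" for x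
    unfolding A_def using det_nz_iff_inj[OF lin] by blast
  define S where "S y v = (\<chi> k. det (\<chi> i j. if j = k then v $ i else A (?\<psi> y) $ i $ j) / det (A (?\<psi> y)))"
    for y v
  have S: "A (?\<psi> y) *v x = v \<longleftrightarrow> x = S y v" for x y v
    unfolding S_def by (rule cramer[OF det])
  have \<phi>\<psi>: "\<phi> (?\<psi> y) = y" for y using bij by (simp add: bij_is_surj surj_f_inv_f)
  \<comment> \<open>Invariance of domain makes the inverse of a continuous bijection continuous.\<close>
  have "continuous_on (\<phi> ` UNIV) ?\<psi>"
    by (rule continuous_on_inverse_open[OF open_UNIV smooth_continuous_on[OF sm]])
      (use bij in \<open>auto simp: bij_is_inj\<close>)
  then have cont: "continuous_on UNIV ?\<psi>" using bij by (simp add: bij_is_surj)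
  have deriv: "(?\<psi> has_derivative S y) (at y)" for y
  proof (rule has_derivative_inverse_basic[OF smooth_has_derivative(1)[OF sm], where T=UNIV])
    show "S y \<circ> ?D (?\<psi> y) = id"
    proof
      fix v show "(S y \<circ> ?D (?\<psi> y)) v = id v" using S[of y v "?D (?\<psi> y) v"] AD by simp
    qed
    have "linear (S y)"
      using S by (intro linearI) (metis matrix_vector_right_distrib, metis matrix_vector_mult_scaleR)
    then show "bounded_linear (S y)" by (simp add: linear_linear)
    show "continuous (at y) ?\<psi>" using cont continuous_on_eq_continuous_at by blast
  qed (auto simp: \<phi>\<psi>)
  have "C_k k ?\<psi>" for k
  proof (induction k)
    case (Suc k)
    have "C_k k (\<lambda>x. ?D x w)" for w
      using smooth_has_derivative(2)[OF sm] by (simp add: smooth_def)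
    then have "C_k k (\<lambda>y. ?D (?\<psi> y) w)" for w
      using C_k_compose Suc by blast
    then have "C_k k (\<lambda>y. ?D (?\<psi> y) w \<bullet> axis i 1)" for w i
      by (intro C_k_inner C_k_const)
    then have entry: "C_k k (\<lambda>y. A (?\<psi> y) $ i $ j)" for i j
      by (simp add: A_def matrix_def inner_axis)
    have "C_k k (\<lambda>y. if j = l then v $ i else A (?\<psi> y) $ i $ j)" for v :: "real^'n" and i j l
      by (cases "j = l") (auto simp: entry C_k_const)
    then have "C_k k (\<lambda>y. S y v)" for v
      unfolding S_def divide_inverse
      by (intro C_k_vec C_k_mult C_k_inverse det C_k_det entry) simp
    then show ?case using deriv by (intro C_k_SucI)
  qed (simp add: cont)
  then show ?thesis by (simp add: smooth_def)
qed

section \<open>Simple functions of index zero are convex\<close>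

definition pos_hess :: "('a::euclidean_space \<Rightarrow> real) \<Rightarrow> bool" where
  "pos_hess g \<longleftrightarrow> (\<forall>x v. v \<noteq> 0 \<longrightarrow> 0 < hess g x v \<bullet> v)"

text \<open>Differentiating the identity between the gradient and its smooth inverse exhibits a left inverse
  of the Hessian.\<close>

lemma simple_hess_injective:
  assumes g: "simple g" and 0: "hess g x v = 0"
  shows "v = 0"
proof -
  let ?\<psi> = "inv_into UNIV (grad g)"
  have sg: "smooth g" and bij: "bij (grad g)" and s\<psi>: "smooth ?\<psi>"
    using g by (auto simp: simple_def diffeomorphism_def)
  have "((\<lambda>x. ?\<psi> (grad g x)) has_derivative
      (\<lambda>v. frechet_derivative ?\<psi> (at (grad g x)) (hess g x v))) (at x)"
    using diff_chain_at[OF has_derivative_hess[OF sg] smooth_has_derivative(1)[OF s\<psi>]]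
    by (simp add: o_def)
  moreover have "(\<lambda>x. ?\<psi> (grad g x)) = (\<lambda>x. x)"
    using bij by (simp add: bij_is_inj)
  ultimately have "(\<lambda>v. frechet_derivative ?\<psi> (at (grad g x)) (hess g x v)) = (\<lambda>v. v)"
    using has_derivative_unique has_derivative_ident by metis
  then have "v = frechet_derivative ?\<psi> (at (grad g x)) 0"
    using 0 by metis
  then show ?thesis
    using smooth_has_derivative(1)[OF s\<psi>] has_derivative_linear linear_0 by metis
qed

text \<open>One direction of negative curvature spans a line on which the Hessian is negative, which would
  already make the index positive.\<close>

lemma hess_nonneg_of_morse_index_0:
  assumes g: "smooth g" and "morse_index_at g x = 0"
  shows "0 \<le> hess g x v \<bullet> v"
proof (rule ccontr)
  interpret linear "hess g x" by (rule linear_hess[OF g])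
  let ?N = "{dim S | S. subspace S \<and> (\<forall>v\<in>S - {0}. hessian g x v v < 0)}"
  assume neg: "\<not> ?thesis"
  then have "v \<noteq> 0" by auto
  have "\<forall>w\<in>span {v} - {0}. hessian g x w w < 0"
  proof
    fix w assume w: "w \<in> span {v} - {0}"
    then obtain c where c: "w = c *\<^sub>R v" by (auto simp: span_singleton)
    with w have "c \<noteq> 0" by auto
    have "hessian g x w w = c\<^sup>2 * (hess g x v \<bullet> v)"
      by (simp add: hessian_eq_hess[OF g] c scale power2_eq_square)
    also have "\<dots> < 0" using neg \<open>c \<noteq> 0\<close> by (simp add: mult_pos_neg)
    finally show "hessian g x w w < 0" .
  qed
  moreover have "dim (span {v}) = 1"
    using \<open>v \<noteq> 0\<close> by (simp add: dim_singleton)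
  ultimately have "1 \<in> ?N" by (intro CollectI exI[of _ "span {v}"]) auto
  moreover have "?N \<subseteq> {..DIM('a)}" using dim_subset_UNIV by auto
  then have "finite ?N" by (rule finite_subset) simp
  ultimately have "1 \<le> Max ?N" by (intro Max_ge)
  then show False using assms(2) by (simp add: morse_index_at_def)
qed

text \<open>The form is nonnegative at \<open>v - t *\<^sub>R A v\<close> for every \<open>t > 0\<close>, while its expansion there starts with the
  negative term \<open>- 2 * t * \<bar>A v\<bar>\<^sup>2\<close> unless \<open>A v = 0\<close>.\<close>

lemma nonneg_form_kernel:
  fixes A :: "'a::real_inner \<Rightarrow> 'a"
  assumes lin: "linear A" and sym: "\<And>u v. A u \<bullet> v = A v \<bullet> u"
    and nonneg: "\<And>v. 0 \<le> A v \<bullet> v" and 0: "A v \<bullet> v = 0"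
  shows "A v = 0"
proof -
  interpret linear A by (rule lin)
  define w where "w = A v"
  define c where "c = A w \<bullet> w"
  define t where "t = (w \<bullet> w) / (c + 1)"
  \<comment> \<open>This \<open>t\<close> is small enough for the linear term to dominate \<open>t\<^sup>2 * c\<close>, with \<open>c + 1\<close> avoiding a division by zero.\<close>
  have c: "c \<ge> 0" using nonneg by (simp add: c_def)
  have "A (v - t *\<^sub>R w) \<bullet> (v - t *\<^sub>R w) = - 2 * t * (w \<bullet> w) + t\<^sup>2 * c"
    using 0 sym[of w v]
    by (simp add: diff scale inner_diff_left inner_diff_right c_def power2_eq_square algebra_simps
        flip: w_def)
  moreover have "t * (c + 1) = w \<bullet> w" using c by (simp add: t_def)
  moreover have "t * (t * c) \<le> t * (t * (c + 1))"
    using c by (intro mult_left_mono) (auto simp: t_def)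
  ultimately have "t * (w \<bullet> w) \<le> 0"
    using nonneg[of "v - t *\<^sub>R w"] by (simp add: power2_eq_square)
  then have "(w \<bullet> w) * (w \<bullet> w) / (c + 1) \<le> 0" by (simp add: t_def)
  then have "(w \<bullet> w) * (w \<bullet> w) \<le> 0" using c by (simp add: divide_le_0_iff)
  then have "w \<bullet> w = 0" by (metis mult_le_0_iff inner_ge_zero order_antisym)
  then show ?thesis by (simp add: w_def)
qed

text \<open>Along a connected set a nondegenerate symmetric form cannot change its signature: the
  points where it is positive definite form an open set by compactness of the unit sphere, and a
  closed one because there positive definite and positive semidefinite agree.\<close>

lemma pos_hess_of_simple:
  fixes g :: "'a::euclidean_space \<Rightarrow> real"
  assumes g: "simple g" and idx: "simple_index g = 0"
  shows "pos_hess g"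
proof -
  have sg: "smooth g" and bij: "bij (grad g)"
    using g by (auto simp: simple_def diffeomorphism_def)
  let ?Q = "\<lambda>x v. hess g x v \<bullet> v"
  define P where "P = {x. \<forall>v. v \<noteq> 0 \<longrightarrow> 0 < ?Q x v}"
  have psd: "P = {x. \<forall>v. 0 \<le> ?Q x v}"
  proof (intro Set.set_eqI iffI)
    fix x assume x: "x \<in> P"
    have "0 \<le> ?Q x v" for v using x by (cases "v = 0") (auto simp: P_def less_imp_le)
    then show "x \<in> {x. \<forall>v. 0 \<le> ?Q x v}" by blast
  next
    fix x assume x: "x \<in> {x. \<forall>v. 0 \<le> ?Q x v}"
    have "?Q x v \<noteq> 0" if "v \<noteq> 0" for v
      using nonneg_form_kernel[OF linear_hess[OF sg] hess_symmetric[OF sg]] x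
        simple_hess_injective[OF g] that by blast
    then show "x \<in> P" using x unfolding P_def by (simp add: order_less_le)
  qed
  have "closed {x. 0 \<le> ?Q x v}" for v
    by (intro closed_Collect_le continuous_intros continuous_hess[OF sg])
  then have "closed P" unfolding psd by (rule closed_Collect_all)
  moreover have "open P"
  proof -
    have Q: "?Q x v = (\<Sum>b\<in>Basis. (v \<bullet> b) * (hess g x b \<bullet> v))" for x v
    proof -
      interpret linear "hess g x" by (rule linear_hess[OF sg])
      have "?Q x v = hess g x (\<Sum>b\<in>Basis. (v \<bullet> b) *\<^sub>R b) \<bullet> v" by (simp add: euclidean_representation)
      then show ?thesis by (simp add: sum scale inner_sum_left)
    qed
    have cont: "continuous_on UNIV (\<lambda>(v, x). ?Q x v)"
      unfolding Q split_beta
      by (intro continuous_intros continuous_on_compose2[OF continuous_hess[OF sg]]) auto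
    have "closed {z. (case z of (v, x) \<Rightarrow> ?Q x v) \<le> 0}"
      by (intro closed_Collect_le cont continuous_on_const)
    from closed_compact_projection[OF compact_sphere[of 0 1] this]
    have "closed {x. \<exists>v\<in>sphere 0 1. ?Q x v \<le> 0}" by (simp add: Bex_def)
    moreover have "{x. \<exists>v\<in>sphere 0 1. ?Q x v \<le> 0} = - P"
    proof (intro Set.set_eqI iffI)
      fix x assume "x \<in> {x. \<exists>v\<in>sphere 0 1. ?Q x v \<le> 0}"
      then obtain v :: 'a where "norm v = 1" "?Q x v \<le> 0" by auto
      then show "x \<in> - P" unfolding P_def by (auto intro!: exI[of _ v])
    next
      fix x assume "x \<in> - P"
      then obtain v where v: "v \<noteq> 0" "?Q x v \<le> 0" unfolding P_def by (auto simp: not_less)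
      interpret linear "hess g x" by (rule linear_hess[OF sg])
      have "?Q x (v /\<^sub>R norm v) = ?Q x v / (norm v)\<^sup>2"
        by (simp add: scale divide_inverse power2_eq_square algebra_simps)
      then have "?Q x (v /\<^sub>R norm v) \<le> 0" using v by (simp add: divide_nonpos_nonneg)
      moreover have "v /\<^sub>R norm v \<in> sphere 0 1" using v by simp
      ultimately show "x \<in> {x. \<exists>v\<in>sphere 0 1. ?Q x v \<le> 0}" by blast
    qed
    ultimately show ?thesis by (simp add: closed_def)
  qed
  moreover have "(THE x. grad g x = 0) \<in> P"
    unfolding psd using hess_nonneg_of_morse_index_0[OF sg] idx by (simp add: simple_index_def)
  ultimately have "P = UNIV" using clopen[of P] by blast
  then show ?thesis by (auto simp: P_def pos_hess_def)
qed

lemma mean_value_grad: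
  assumes "smooth f"
  obtains s where "0 < s" "s < 1" "f y - f x = grad f (x + s *\<^sub>R (y - x)) \<bullet> (y - x)"
proof -
  have "DERIV (\<lambda>s. f (x + s *\<^sub>R (y - x))) s :> grad f (x + s *\<^sub>R (y - x)) \<bullet> (y - x)" for s
    by (rule DERIV_along_line[OF smooth_has_derivative_grad[OF assms]])
  from MVT2[OF zero_less_one this] show thesis using that by auto
qed

lemma grad_strict_monotone:
  assumes g: "smooth g" and pos: "pos_hess g" and "x \<noteq> y"
  shows "0 < (grad g y - grad g x) \<bullet> (y - x)"
proof -
  have "DERIV (\<lambda>s. grad g (x + s *\<^sub>R (y - x)) \<bullet> (y - x)) s :> hess g (x + s *\<^sub>R (y - x)) (y - x) \<bullet> (y - x)" for s
    by (rule DERIV_along_line, intro has_derivative_inner_left has_derivative_hess g)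
  from MVT2[OF zero_less_one this] obtain z where
    "(grad g y - grad g x) \<bullet> (y - x) = hess g (x + z *\<^sub>R (y - x)) (y - x) \<bullet> (y - x)"
    by (auto simp: inner_diff_left)
  then show ?thesis using pos \<open>x \<noteq> y\<close> by (simp add: pos_hess_def)
qed

text \<open>The slope along a segment only increases, by monotonicity of the gradient.\<close>

lemma gradient_inequality:
  assumes g: "smooth g" and pos: "pos_hess g"
  shows "g x + grad g x \<bullet> (y - x) \<le> g y"
proof (cases "x = y")
  case False
  obtain s where s: "0 < s" "s < 1" "g y - g x = grad g (x + s *\<^sub>R (y - x)) \<bullet> (y - x)"
    using mean_value_grad[OF g] by blast
  have "0 < (grad g (x + s *\<^sub>R (y - x)) - grad g x) \<bullet> ((x + s *\<^sub>R (y - x)) - x)"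
    by (rule grad_strict_monotone[OF g pos]) (use False s in auto)
  then have "0 < s * ((grad g (x + s *\<^sub>R (y - x)) - grad g x) \<bullet> (y - x))" by simp
  then show ?thesis using s by (simp add: zero_less_mult_iff inner_diff_left)
qed auto

section \<open>Superlinear growth\<close>

definition superlinear :: "('a::euclidean_space \<Rightarrow> real) \<Rightarrow> bool" where
  "superlinear f \<longleftrightarrow> (\<forall>R. \<exists>C. \<forall>x. R * norm x - C \<le> f x)"

lemma superlinearE:
  assumes "superlinear f" obtains C where "\<And>x. R * norm x - C \<le> f x"
  using assms by (auto simp: superlinear_def)

text \<open>The affine minorants of slope \<open>p\<close>, which exist for every \<open>p\<close> because the
  gradient is onto, have a bounded constant term as long as \<open>p\<close> stays in a ball.\<close>

lemma superlinear_of_simple: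
  assumes g: "simple g" and pos: "pos_hess g"
  shows "superlinear g"
  unfolding superlinear_def
proof
  fix R :: real
  let ?\<psi> = "inv_into UNIV (grad g)"
  have sg: "smooth g" and bij: "bij (grad g)" and s\<psi>: "smooth ?\<psi>"
    using g by (auto simp: simple_def diffeomorphism_def)
  have "continuous_on (cball 0 \<bar>R\<bar>) (\<lambda>p. p \<bullet> ?\<psi> p - g (?\<psi> p))"
    by (intro continuous_intros continuous_on_compose2[OF smooth_continuous_on[OF sg, of UNIV]]
        smooth_continuous_on[OF s\<psi>]) auto
  then have "bounded ((\<lambda>p. p \<bullet> ?\<psi> p - g (?\<psi> p)) ` cball 0 \<bar>R\<bar>)"
    by (simp add: compact_continuous_image compact_imp_bounded)
  then obtain C where "\<forall>p\<in>cball 0 \<bar>R\<bar>. \<bar>p \<bullet> ?\<psi> p - g (?\<psi> p)\<bar> \<le> C"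
    by (auto simp: bounded_iff)
  then have C: "\<And>p. norm p \<le> \<bar>R\<bar> \<Longrightarrow> \<bar>p \<bullet> ?\<psi> p - g (?\<psi> p)\<bar> \<le> C"
    by (simp add: Ball_def)
  have "R * norm x - C \<le> g x" for x
  proof -
    define p where "p = (R / norm x) *\<^sub>R x"
    have p: "norm p \<le> \<bar>R\<bar>" by (simp add: p_def)
    have px: "p \<bullet> x = R * norm x"
      by (cases "x = 0") (auto simp: p_def dot_square_norm power2_eq_square)
    have "grad g (?\<psi> p) = p" using bij by (simp add: bij_is_surj surj_f_inv_f)
    then show ?thesis
      using gradient_inequality[OF sg pos, of "?\<psi> p" x] C[OF p] px by (simp add: inner_diff_right)
  qed
  then show "\<exists>C. \<forall>x. R * norm x - C \<le> g x" by blast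
qed

text \<open>Outside a large ball the values exceed the one at the origin, so a minimum over the ball is global.\<close>

lemma superlinear_attains_min:
  assumes "continuous_on UNIV f" and "superlinear f"
  obtains m where "\<And>x. f m \<le> f x"
proof -
  obtain C where C: "\<And>x. 1 * norm x - C \<le> f x" using assms(2) superlinearE by blast
  define r where "r = max 0 (f 0 + C)"
  have "\<exists>m\<in>cball 0 r. \<forall>x\<in>cball 0 r. f m \<le> f x"
    by (intro continuous_attains_inf continuous_on_subset[OF assms(1)]) (auto simp: r_def)
  then obtain m where m: "\<And>x. norm x \<le> r \<Longrightarrow> f m \<le> f x" by (metis mem_cball_0)
  have "f m \<le> f x" for x
  proof (cases "norm x \<le> r")
    case False
    then have "f 0 \<le> f x" using C[of x] by (simp add: r_def)
    then show ?thesis using m[of 0] by (simp add: r_def)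
  qed (rule m)
  then show thesis using that by blast
qed

lemma grad_eq_0_at_min:
  assumes f: "smooth f" and "\<And>x. f m \<le> f x"
  shows "grad f m = 0"
proof -
  have "(\<lambda>h. grad f m \<bullet> h) = (\<lambda>h. 0)"
    by (rule has_derivative_local_min[OF smooth_has_derivative_grad[OF f]]) (simp add: assms(2))
  then show ?thesis by (metis inner_eq_zero_iff)
qed

text \<open>A function with bounded gradient grows at most linearly, with slope \<open>K\<close>, so a bound of slope
  \<open>R + K\<close> for \<open>g\<close> leaves one of slope \<open>R\<close> for the sum.\<close>

lemma superlinear_add_bounded_grad:
  assumes "superlinear g" and h: "smooth h" and K: "\<And>x. norm (grad h x) \<le> K"
  shows "superlinear (\<lambda>x. g x + h x)"
  unfolding superlinear_def
proof
  fix R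
  obtain C where C: "\<And>x. (R + K) * norm x - C \<le> g x" using assms(1) superlinearE by blast
  have "R * norm x - (C - h 0) \<le> g x + h x" for x
  proof -
    obtain s where "h x - h 0 = grad h (0 + s *\<^sub>R (x - 0)) \<bullet> (x - 0)"
      using mean_value_grad[OF h, of x 0] by metis
    moreover have "\<bar>grad h (0 + s *\<^sub>R (x - 0)) \<bullet> (x - 0)\<bar> \<le> K * norm x"
      using K by (intro order_trans[OF Cauchy_Schwarz_ineq2]) (auto intro: mult_right_mono)
    ultimately show ?thesis using C[of x] by (simp add: algebra_simps)
  qed
  then show "\<exists>C. \<forall>x. R * norm x - C \<le> g x + h x" by blast
qed

text \<open>On \<open>real ^ 'n\<close> these are exactly the simple functions of index zero, but in this form the
  class is visibly stable under the sums that occur in infimal convolutions.\<close>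

definition elliptic :: "('a::euclidean_space \<Rightarrow> real) \<Rightarrow> bool" where
  "elliptic g \<longleftrightarrow> smooth g \<and> pos_hess g \<and> superlinear g"

lemma elliptic_of_simple: "simple g \<Longrightarrow> simple_index g = 0 \<Longrightarrow> elliptic g"
  by (simp add: elliptic_def simple_def pos_hess_of_simple superlinear_of_simple)

text \<open>A point where the gradient equals \<open>p\<close> is a minimum of \<open>g\<close> minus the linear function \<open>p\<close>, which
  exists by superlinear growth. It is unique by strict monotonicity, and invertibility of the Hessian makes
  the inverse smooth.\<close>

lemma simple_of_elliptic:
  fixes g :: "real^'n \<Rightarrow> real"
  assumes "elliptic g" shows "simple g"
proof -
  have g: "smooth g" and pos: "pos_hess g" and sl: "superlinear g"
    using assms by (auto simp: elliptic_def)
  have "bij (grad g)"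
  proof (rule bijI)
    show "inj (grad g)"
      using grad_strict_monotone[OF g pos] by (force intro!: injI)
    have "\<exists>x. p = grad g x" for p
    proof -
      have lin: "smooth (\<lambda>x. - p \<bullet> x)" by (intro smooth_inner smooth_const smooth_ident)
      have sm: "smooth (\<lambda>x. g x + - p \<bullet> x)" by (rule smooth_add[OF g lin])
      have "superlinear (\<lambda>x. g x + - p \<bullet> x)"
        by (rule superlinear_add_bounded_grad[OF sl lin]) (simp only: grad_inner_left, rule order_refl)
      then obtain m where "\<And>x. g m + - p \<bullet> m \<le> g x + - p \<bullet> x"
        using superlinear_attains_min[OF smooth_continuous_on[OF sm]] by blast
      then have "grad (\<lambda>x. g x + - p \<bullet> x) m = 0" by (rule grad_eq_0_at_min[OF sm])
      then have "grad g m + - p = 0" unfolding grad_add[OF g lin] grad_inner_left .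
      then show ?thesis by (auto intro!: exI[of _ m])
    qed
    then show "surj (grad g)" by (simp add: surj_def)
  qed
  moreover have "v = 0" if "hess g x v = 0" for x v
    using pos that unfolding pos_hess_def by (metis inner_zero_left order_less_irrefl)
  ultimately show ?thesis
    using g by (simp add: simple_def diffeomorphism_def smooth_grad smooth_inverse)
qed

lemma elliptic_box:
  assumes "elliptic g1" "elliptic g2"
  shows "elliptic (\<lambda>v. g1 v + g2 (q - v))"
proof -
  have g1: "smooth g1" and g2: "smooth g2"
    using assms by (auto simp: elliptic_def)
  have refl: "smooth (\<lambda>v. g2 (q - v))"
    by (intro smooth_compose[OF g2] smooth_diff smooth_const smooth_ident)
  have grad: "grad (\<lambda>v. g1 v + g2 (q - v)) = (\<lambda>v. grad g1 v - grad g2 (q - v))"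
    by (simp add: grad_add[OF g1 refl] grad_reflect[OF g2])
  have hess: "hess (\<lambda>v. g1 v + g2 (q - v)) x = (\<lambda>v. hess g1 x v + hess g2 (q - x) v)" for x
  proof -
    have d: "((\<lambda>x. q - x) has_derivative (\<lambda>h. - h)) (at x)" by (auto intro!: derivative_eq_intros)
    interpret linear "hess g2 (q - x)" by (rule linear_hess[OF g2])
    have "((\<lambda>v. grad g1 v - grad g2 (q - v)) has_derivative (\<lambda>v. hess g1 x v - hess g2 (q - x) (- v))) (at x)"
      using diff_chain_at[OF d has_derivative_hess[OF g2]]
      by (intro has_derivative_diff has_derivative_hess[OF g1]) (simp add: o_def)
    then have "((\<lambda>v. grad g1 v - grad g2 (q - v)) has_derivative (\<lambda>v. hess g1 x v + hess g2 (q - x) v)) (at x)"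
      by (simp add: neg)
    from frechet_derivative_at[OF this] show ?thesis unfolding grad by simp
  qed
  have "superlinear (\<lambda>v. g1 v + g2 (q - v))"
    unfolding superlinear_def
  proof
    fix R
    obtain C1 C2 where "\<And>x. R * norm x - C1 \<le> g1 x" "\<And>x. 0 * norm x - C2 \<le> g2 x"
      using assms superlinearE unfolding elliptic_def by metis
    then have "\<forall>x. R * norm x - (C1 + C2) \<le> g1 x + g2 (q - x)" by (smt (verit) mult_zero_left)
    then show "\<exists>C. \<forall>x. R * norm x - C \<le> g1 x + g2 (q - x)" by blast
  qed
  then show ?thesis
    using assms refl by (auto simp: elliptic_def pos_hess_def hess inner_add_left add_pos_pos intro: smooth_add)
qed

section \<open>Almost-convex functions are steep\<close>

text \<open>The radial derivative about every centre \<open>m\<close> eventually exceeds every multiple of the distance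
  from \<open>m\<close>. The case of slope zero makes sublevel sets at high levels star-shaped, and positive slopes make the
  gradient proper.\<close>

definition steep :: "('a::euclidean_space \<Rightarrow> real) \<Rightarrow> bool" where
  "steep f \<longleftrightarrow> smooth f \<and> superlinear f \<and>
     (\<forall>m R. 0 \<le> R \<longrightarrow> (\<exists>\<rho>>0. \<forall>x. \<rho> \<le> norm (x - m) \<longrightarrow> R * norm (x - m) \<le> grad f x \<bullet> (x - m)))"

text \<open>By the gradient inequality the radial derivative of the convex part dominates its growth,
  which is superlinear, while the perturbation contributes at most linearly.\<close>

lemma steep_elliptic_plus_bounded:
  assumes ell: "elliptic g" and h: "smooth h" and bd: "bounded (range (grad h))"
  shows "steep (\<lambda>x. g x + h x)"
proof -
  have g: "smooth g" and pos: "pos_hess g" and sl: "superlinear g"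
    using ell by (auto simp: elliptic_def)
  obtain K where K: "\<And>x. norm (grad h x) \<le> K" using bd by (auto simp: bounded_iff)
  have K0: "0 \<le> K" using K[of 0] norm_ge_zero order_trans by blast
  have "\<exists>\<rho>>0. \<forall>x. \<rho> \<le> norm (x - m) \<longrightarrow>
      R * norm (x - m) \<le> grad (\<lambda>x. g x + h x) x \<bullet> (x - m)" if R: "0 \<le> R" for m R
  proof -
    obtain C where C: "\<And>x. (R + K + 1) * norm x - C \<le> g x" using sl superlinearE by blast
    define \<rho> where "\<rho> = max 1 (C + g m + (R + K + 1) * norm m)"
    have "R * norm (x - m) \<le> grad (\<lambda>x. g x + h x) x \<bullet> (x - m)" if x: "\<rho> \<le> norm (x - m)" for x
    proof -
      have "(R + K + 1) * (norm (x - m) - norm m) \<le> (R + K + 1) * norm x"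
        using R K0 norm_triangle_ineq4[of x m] by (intro mult_left_mono) auto
      then have "(R + K + 1) * norm (x - m) - (R + K + 1) * norm m - C \<le> g x"
        using C[of x] by (simp add: algebra_simps)
      moreover have "g x - g m \<le> grad g x \<bullet> (x - m)"
        using gradient_inequality[OF g pos, of x m] by (simp add: inner_diff_right)
      moreover have "\<bar>grad h x \<bullet> (x - m)\<bar> \<le> K * norm (x - m)"
        using K by (intro order_trans[OF Cauchy_Schwarz_ineq2]) (auto intro: mult_right_mono)
      moreover have "C + g m + (R + K + 1) * norm m \<le> norm (x - m)" using x by (simp add: \<rho>_def)
      ultimately show ?thesis
        by (simp add: grad_add[OF g h] inner_add_left algebra_simps)
    qed
    then show ?thesis by (intro exI[of _ \<rho>]) (simp add: \<rho>_def)
  qed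
  then show ?thesis
    using superlinear_add_bounded_grad[OF sl h K] smooth_add[OF g h] by (simp add: steep_def)
qed

lemma proper_map_euclideanI:
  fixes \<phi> :: "'a::euclidean_space \<Rightarrow> 'b::euclidean_space"
  assumes cont: "continuous_on UNIV \<phi>" and bd: "\<And>B. bounded {x. norm (\<phi> x) \<le> B}"
  shows "proper_map euclidean euclidean \<phi>"
proof (rule compact_imp_proper_map)
  show "compactin euclidean {x \<in> topspace euclidean. \<phi> x \<in> K}" if "compactin euclidean K" for K
  proof -
    have K: "compact K" using that by simp
    then obtain B where "\<And>y. y \<in> K \<Longrightarrow> norm y \<le> B"
      using compact_imp_bounded bounded_iff by metis
    then have "bounded {x. \<phi> x \<in> K}" by (intro bounded_subset[OF bd[of B]]) auto
    moreover have "closed {x. \<phi> x \<in> K}"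
      using continuous_closed_vimage[OF compact_imp_closed[OF K], of \<phi>] cont
      by (simp add: vimage_def continuous_on_eq_continuous_at)
    ultimately show ?thesis by (simp add: compact_eq_bounded_closed)
  qed
qed (use cont in \<open>auto simp: Hausdorff_imp_kc_space locally_compact_imp_k_space locally_compact_space_euclidean\<close>)

lemma steep_bounded_grad_sublevel:
  assumes "steep f" shows "bounded {x. norm (grad f x) \<le> B}"
proof -
  obtain \<rho> where \<rho>: "\<rho> > 0" "\<And>x. \<rho> \<le> norm (x - 0) \<Longrightarrow> (\<bar>B\<bar> + 1) * norm (x - 0) \<le> grad f x \<bullet> (x - 0)"
    using assms unfolding steep_def by (metis abs_ge_zero add_nonneg_nonneg zero_le_one)
  have "norm x \<le> \<rho>" if "norm (grad f x) \<le> B" for x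
  proof (rule ccontr)
    assume "\<not> norm x \<le> \<rho>"
    then have "norm x > 0" "(\<bar>B\<bar> + 1) * norm x \<le> grad f x \<bullet> x" using \<rho> by (auto simp: less_imp_le)
    note this(2)
    also have "grad f x \<bullet> x \<le> \<bar>B\<bar> * norm x"
      using that by (intro order_trans[OF norm_cauchy_schwarz] mult_right_mono) auto
    finally show False using \<open>norm x > 0\<close> by simp
  qed
  then show ?thesis by (auto simp: bounded_iff)
qed

lemma steep_proper_grad:
  assumes "steep f"
  shows "proper_map euclidean euclidean (grad f)" "proper_map euclidean euclidean (grad (\<lambda>x. - f x))"
proof -
  have f: "smooth f" using assms by (simp add: steep_def)
  show "proper_map euclidean euclidean (grad f)"
    by (intro proper_map_euclideanI smooth_continuous_on[OF smooth_grad[OF f]] steep_bounded_grad_sublevel assms)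
  have "continuous_on UNIV (\<lambda>x. - grad f x)"
    by (intro continuous_intros smooth_continuous_on[OF smooth_grad[OF f]])
  then show "proper_map euclidean euclidean (grad (\<lambda>x. - f x))"
    unfolding grad_minus[OF f] by (rule proper_map_euclideanI) (simp add: steep_bounded_grad_sublevel[OF assms])
qed

section \<open>Pushing superlevel sets uphill\<close>

definition uphill_homotopy ::
    "('a::euclidean_space \<Rightarrow> real) \<Rightarrow> real \<Rightarrow> real \<Rightarrow> (real \<Rightarrow> 'a \<Rightarrow> 'a) \<Rightarrow> bool" where
  "uphill_homotopy E a b H \<longleftrightarrow>
     continuous_on ({0..1} \<times> UNIV) (\<lambda>(t, x). H t x) \<and> (\<forall>x. H 0 x = x) \<and>
     (\<forall>t\<in>{0..1}. \<forall>x. E x \<le> E (H t x)) \<and> (\<forall>x. a \<le> E x \<longrightarrow> b \<le> E (H 1 x))"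

text \<open>A discrete substitute for the gradient flow. On a compact slab without critical points, one
  gradient step \<open>x \<mapsto> x + \<epsilon> grad E x\<close> of a fixed small size raises \<open>E\<close> by a fixed amount. Damping
  the step by a cutoff that vanishes outside the slab makes it a globally defined continuous map
  that never lowers \<open>E\<close>, and shrinking the step size to zero connects it to the identity. Finitely
  many such steps cross the slab.\<close>

lemma uphill_homotopy_exists:
  fixes E :: "'a::euclidean_space \<Rightarrow> real"
  assumes E: "smooth E" and comp: "compact {x. a \<le> E x \<and> E x \<le> b}"
    and reg: "\<forall>x\<in>{x. a \<le> E x \<and> E x \<le> b}. grad E x \<noteq> 0"
    and ab: "a < a'" "b' < b"
  shows "\<exists>H. uphill_homotopy E a' b' H"
proof -
  define K where "K = {x. a \<le> E x \<and> E x \<le> b}"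
  have contE: "continuous_on S E" for S by (rule smooth_continuous_on[OF E])
  have contg: "continuous_on S (grad E)" for S by (rule smooth_continuous_on[OF smooth_grad[OF E]])
  have K: "compact K" using comp by (simp add: K_def)
  obtain m where m: "m > 0" "\<And>x. x \<in> K \<Longrightarrow> m \<le> norm (grad E x)"
  proof (cases "K = {}")
    case False
    then obtain x0 where "x0 \<in> K" "\<forall>x\<in>K. norm (grad E x0) \<le> norm (grad E x)"
      using continuous_attains_inf[OF K False continuous_on_norm[OF contg]] by blast
    then show thesis using reg that[of "norm (grad E x0)"] by (simp add: K_def)
  qed (use that[of 1] in auto)
  obtain M where M: "M > 0" "\<And>x. x \<in> K \<Longrightarrow> norm (grad E x) \<le> M"
    using compact_imp_bounded[OF compact_continuous_image[OF contg K]] by (auto simp: bounded_pos)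
  define N where "N = {x + y | x y. x \<in> K \<and> y \<in> cball 0 M}"
  have "compact N" unfolding N_def by (rule compact_sums[OF K compact_cball])
  then have "uniformly_continuous_on N (grad E)"
    by (rule compact_uniformly_continuous[OF contg])
  then obtain d where d: "d > 0"
    "\<And>x y. x \<in> N \<Longrightarrow> y \<in> N \<Longrightarrow> dist x y < d \<Longrightarrow> dist (grad E x) (grad E y) < m / 2"
    using m(1) unfolding uniformly_continuous_on_def by (metis half_gt_zero dist_commute)
  \<comment> \<open>Steps of length at most \<open>\<epsilon> * M < d\<close> meet gradients within \<open>m / 2\<close> of the initial one.\<close>
  define \<epsilon> where "\<epsilon> = min 1 (d / (2 * M))"
  have \<epsilon>: "\<epsilon> > 0" "\<epsilon> \<le> 1" "\<epsilon> * M < d"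
  proof -
    have "\<epsilon> * M \<le> d / (2 * M) * M" using M(1) by (intro mult_right_mono) (auto simp: \<epsilon>_def)
    also have "\<dots> < d" using M(1) d(1) by simp
    finally show "\<epsilon> * M < d" .
  qed (use M(1) d(1) in \<open>auto simp: \<epsilon>_def\<close>)
  have rise: "E x + \<sigma> * (m * (m / 2)) \<le> E (x + \<sigma> *\<^sub>R grad E x)"
    if x: "x \<in> K" and \<sigma>: "0 \<le> \<sigma>" "\<sigma> \<le> \<epsilon>" for x \<sigma>
  proof -
    let ?g = "grad E x" and ?y = "x + \<sigma> *\<^sub>R grad E x"
    obtain s where s: "0 < s" "s < 1" "E ?y - E x = grad E (x + s *\<^sub>R (?y - x)) \<bullet> (?y - x)"
      using mean_value_grad[OF E] by blast
    define z where "z = s *\<^sub>R (?y - x)"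
    have "norm z = s * (\<sigma> * norm ?g)" using s \<sigma> by (simp add: z_def)
    also have "\<dots> \<le> 1 * (\<epsilon> * M)" using s \<sigma> M(2)[OF x] \<epsilon>(1) by (intro mult_mono) auto
    finally have z: "norm z \<le> \<epsilon> * M" by simp
    also have "\<dots> \<le> M" using \<epsilon>(2) M(1) by simp
    finally have "x + z \<in> N" "x + 0 \<in> N" unfolding N_def using x M(1) by (fastforce, force)
    then have "norm (grad E (x + z) - ?g) < m / 2"
      using d(2)[of "x + z" x] z \<epsilon>(3) by (simp add: dist_norm)
    then have "\<bar>(grad E (x + z) - ?g) \<bullet> ?g\<bar> \<le> m / 2 * norm ?g"
      by (intro order_trans[OF Cauchy_Schwarz_ineq2] mult_right_mono) auto
    then have "- (m / 2 * norm ?g) \<le> (grad E (x + z) - ?g) \<bullet> ?g" by linarith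
    then have "norm ?g * (norm ?g - m / 2) \<le> grad E (x + z) \<bullet> ?g"
      by (simp add: inner_diff_left algebra_simps dot_square_norm power2_eq_square)
    moreover have "m * (m / 2) \<le> norm ?g * (norm ?g - m / 2)"
      using m(2)[OF x] m(1) by (intro mult_mono) auto
    ultimately have "\<sigma> * (m * (m / 2)) \<le> \<sigma> * (grad E (x + z) \<bullet> ?g)"
      using \<sigma>(1) by (intro mult_left_mono) auto
    then show ?thesis using s(3) by (simp add: z_def)
  qed
  \<comment> \<open>The cutoff is 1 on \<open>[a', b']\<close> and 0 outside \<open>[a, b]\<close>.\<close>
  define cut where "cut s = max 0 (min 1 (min ((s - a) / (a' - a)) ((b - s) / (b - b'))))" for s :: real
  define \<phi> where "\<phi> t x = x + (t * \<epsilon> * cut (E x)) *\<^sub>R grad E x" for t x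
  have cut01: "0 \<le> cut s" "cut s \<le> 1" for s by (auto simp: cut_def)
  have cut1: "cut s = 1" if "a' \<le> s" "s \<le> b'" for s using that ab by (auto simp: cut_def min_def)
  have cut0: "cut s = 0" if "\<not> (a \<le> s \<and> s \<le> b)" for s
  proof -
    have "(s - a) / (a' - a) \<le> 0 \<or> (b - s) / (b - b') \<le> 0"
      using that ab by (auto simp: divide_nonpos_pos)
    then show ?thesis unfolding cut_def by (intro max_absorb1) (auto simp: min_le_iff_disj)
  qed
  have cont_cut: "continuous_on S cut" for S
    unfolding cut_def using ab by (intro continuous_intros) auto
  have cont\<phi>: "continuous_on UNIV (\<lambda>(t, x). \<phi> t x)"
    unfolding \<phi>_def split_beta
    by (intro continuous_intros continuous_on_compose2[OF cont_cut[of UNIV]]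
        continuous_on_compose2[OF contE[of UNIV]] continuous_on_compose2[OF contg[of UNIV]]) auto
  have up: "E x \<le> E (\<phi> t x)" if t: "t \<in> {0..1}" for t x
  proof (cases "x \<in> K")
    case True
    have "t * (\<epsilon> * cut (E x)) \<le> 1 * (\<epsilon> * 1)" using t \<epsilon>(1) cut01 by (intro mult_mono) auto
    then have "E x + t * \<epsilon> * cut (E x) * (m * (m / 2)) \<le> E (\<phi> t x)"
      unfolding \<phi>_def using t \<epsilon>(1) cut01 by (intro rise True) (auto simp: mult.assoc)
    moreover have "0 \<le> t * \<epsilon> * cut (E x) * (m * (m / 2))"
      using t \<epsilon>(1) cut01 m(1) by (intro mult_nonneg_nonneg) auto
    ultimately show ?thesis by linarith
  qed (auto simp: K_def \<phi>_def cut0)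
  define \<delta> where "\<delta> = \<epsilon> * (m * (m / 2))"
  have \<delta>: "\<delta> > 0" using \<epsilon>(1) m(1) by (simp add: \<delta>_def)
  have progress: "E x + \<delta> \<le> E (\<phi> 1 x)" if "a' \<le> E x" "E x \<le> b'" for x
    unfolding \<phi>_def \<delta>_def using rise[of x \<epsilon>] that ab \<epsilon>(1) by (simp add: cut1 K_def)
  define H where "H n t = \<phi> t ^^ n" for n :: nat and t
  have cont: "continuous_on ({0..1} \<times> UNIV) (\<lambda>(t, x). H n t x)" for n
  proof (induction n)
    case 0
    show ?case by (simp add: H_def split_beta continuous_on_snd)
  next
    case (Suc n)
    have "continuous_on ({0..1} \<times> UNIV) (\<lambda>z. (fst z, (\<lambda>(t, x). H n t x) z))"
      by (intro continuous_intros Suc.IH)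
    from continuous_on_compose2[OF cont\<phi> this] show ?case
      by (simp add: H_def split_beta)
  qed
  have mono: "E x \<le> E (H n t x)" if "t \<in> {0..1}" for n t x
    by (induction n) (use up[OF that] order_trans in \<open>auto simp: H_def\<close>)
  have zero: "H n 0 x = x" for n x
    by (induction n) (auto simp: H_def \<phi>_def)
  have climb: "min b' (a' + real n * \<delta>) \<le> E (H n 1 x)" if "a' \<le> E x" for n x
  proof (induction n)
    case (Suc n)
    have *: "a' \<le> E (H n 1 x)" "E (H n 1 x) \<le> E (\<phi> 1 (H n 1 x))"
      using mono[of 1 x n] that up[of 1] by auto
    show ?case
    proof (cases "E (H n 1 x) \<le> b'")
      case True
      then have "E (H n 1 x) + \<delta> \<le> E (H (Suc n) 1 x)"
        using progress[OF *(1)] by (simp add: H_def)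
      then show ?thesis using Suc \<delta> by (simp add: min_def algebra_simps split: if_splits)
    next
      case False
      then show ?thesis using * by (simp add: H_def)
    qed
  qed (use that in \<open>simp add: H_def\<close>)
  \<comment> \<open>The number of steps is uniform because each one gains \<open>\<delta>\<close> until the level \<open>b'\<close> is reached.\<close>
  obtain n :: nat where "b' - a' < real n * \<delta>" using \<delta> reals_Archimedean3 by blast
  then have "b' \<le> E (H n 1 x)" if "a' \<le> E x" for x using climb[OF that, of n] by linarith
  then have "uphill_homotopy E a' b' (H n)"
    unfolding uphill_homotopy_def using cont mono zero by blast
  then show ?thesis by blast
qed

section \<open>Relative homology of pairs in Euclidean space\<close>

lemma homotopic_with_top_of_setI:
  fixes H :: "real \<Rightarrow> 'a::topological_space \<Rightarrow> 'b::topological_space"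
  assumes "continuous_on ({0..1} \<times> X) (\<lambda>(t, x). H t x)"
    and "\<And>t x. t \<in> {0..1} \<Longrightarrow> x \<in> X \<Longrightarrow> H t x \<in> Y"
    and "\<And>t. t \<in> {0..1} \<Longrightarrow> P (H t)"
  shows "homotopic_with P (top_of_set X) (top_of_set Y) (H 0) (H 1)"
  unfolding homotopic_with_def
  using assms by (intro exI[of _ "\<lambda>(t, x). H t x"]) (auto simp: Pi_iff)

text \<open>A homotopy of the larger pair that starts at the identity, ends in the smaller pair, and
  keeps both pairs invariant makes the inclusion an isomorphism in homology. All comparisons of
  sublevel sets below are instances.\<close>

lemma pair_deformation_iso:
  fixes H :: "real \<Rightarrow> 'a::topological_space \<Rightarrow> 'a"
  assumes sub: "X \<subseteq> Y" "S \<subseteq> T"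
    and cont: "continuous_on ({0..1} \<times> Y) (\<lambda>(t, x). H t x)" and H0: "\<And>x. H 0 x = x"
    and inv: "\<And>t x. t \<in> {0..1} \<Longrightarrow> x \<in> Y \<Longrightarrow> H t x \<in> Y" "\<And>t x. t \<in> {0..1} \<Longrightarrow> x \<in> X \<Longrightarrow> H t x \<in> X"
      "\<And>t x. t \<in> {0..1} \<Longrightarrow> x \<in> T \<Longrightarrow> H t x \<in> T" "\<And>t x. t \<in> {0..1} \<Longrightarrow> x \<in> S \<Longrightarrow> H t x \<in> S"
    and end1: "\<And>x. x \<in> Y \<Longrightarrow> H 1 x \<in> X" "\<And>x. x \<in> T \<Longrightarrow> H 1 x \<in> S"
  shows "hom_induced p (top_of_set X) S (top_of_set Y) T id
    \<in> iso (relative_homology_group p (top_of_set X) S) (relative_homology_group p (top_of_set Y) T)"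
proof (rule homotopy_equivalence_relative_homology_group_isomorphism[where g="H 1"])
  have id: "H 0 = id" using H0 by auto
  have "continuous_on Y (\<lambda>x. (\<lambda>(t, x). H t x) (1, x))"
    by (rule continuous_on_compose2[OF cont]) (auto intro!: continuous_intros)
  then show "continuous_map (top_of_set Y) (top_of_set X) (H 1)" using end1 by auto
  show "H 1 \<in> T \<rightarrow> S" using end1 by auto
  have "homotopic_with (\<lambda>h. h \<in> S \<rightarrow> S) (top_of_set X) (top_of_set X) (H 0) (H 1)"
    by (rule homotopic_with_top_of_setI) (use sub inv in \<open>auto intro: continuous_on_subset[OF cont]\<close>)
  then show "homotopic_with (\<lambda>h. h \<in> S \<rightarrow> S) (top_of_set X) (top_of_set X) (H 1 \<circ> id) id"
    by (simp add: id homotopic_with_sym)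
  have "homotopic_with (\<lambda>h. h \<in> T \<rightarrow> T) (top_of_set Y) (top_of_set Y) (H 0) (H 1)"
    by (rule homotopic_with_top_of_setI) (use inv cont in auto)
  then show "homotopic_with (\<lambda>h. h \<in> T \<rightarrow> T) (top_of_set Y) (top_of_set Y) (id \<circ> H 1) id"
    by (simp add: id homotopic_with_sym)
qed (use sub in auto)

abbreviation outside_ball :: "'a::euclidean_space \<Rightarrow> real \<Rightarrow> 'a set" where
  "outside_ball m \<rho> \<equiv> {x. \<rho> \<le> norm (x - m)}"

lemma outside_ball_homotopy_equivalent_sphere:
  assumes "\<rho> > 0"
  shows "top_of_set (outside_ball m \<rho>) homotopy_equivalent_space top_of_set (sphere m \<rho>)"
  unfolding homotopy_equivalent_space_def
proof (intro exI conjI)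
  let ?A = "outside_ball m \<rho>"
  define H where "H t x = m + ((1 - t) + t * (\<rho> / norm (x - m))) *\<^sub>R (x - m)" for t x
  have ne: "norm (x - m) \<noteq> 0" if "x \<in> ?A" for x using that assms by auto
  have cont: "continuous_on ({0..1} \<times> ?A) (\<lambda>(t, x). H t x)"
    unfolding H_def split_beta by (intro continuous_intros) (use ne in auto)
  have norm1: "norm (H 1 x - m) = \<rho>" if "x \<in> ?A" for x using ne[OF that] assms by (simp add: H_def)
  have norm_H: "\<rho> \<le> norm (H t x - m)" if "t \<in> {0..1}" "x \<in> ?A" for t x
  proof -
    have "norm (H t x - m) = \<bar>(1 - t) + t * (\<rho> / norm (x - m))\<bar> * norm (x - m)" by (simp add: H_def)
    also have "\<dots> = ((1 - t) + t * (\<rho> / norm (x - m))) * norm (x - m)"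
      using that assms by (subst abs_of_nonneg) auto
    also have "\<dots> = (1 - t) * norm (x - m) + t * \<rho>" using ne[OF that(2)] by (simp add: field_simps)
    also have "\<dots> \<ge> (1 - t) * \<rho> + t * \<rho>" using that by (intro add_mono mult_left_mono) auto
    finally show ?thesis by (simp add: algebra_simps)
  qed
  have "continuous_on ?A (\<lambda>x. (\<lambda>(t, x). H t x) (1, x))"
    by (rule continuous_on_compose2[OF cont]) (auto intro!: continuous_intros)
  then show "continuous_map (top_of_set ?A) (top_of_set (sphere m \<rho>)) (H 1)"
    using norm1 by (auto simp: dist_norm norm_minus_commute)
  show "continuous_map (top_of_set (sphere m \<rho>)) (top_of_set ?A) id"
    by (auto simp: dist_norm norm_minus_commute)
  have "homotopic_with (\<lambda>x. True) (top_of_set ?A) (top_of_set ?A) (H 0) (H 1)"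
    by (rule homotopic_with_top_of_setI[OF cont]) (use norm_H in auto)
  moreover have "H 0 = id" by (auto simp: H_def)
  ultimately show "homotopic_with (\<lambda>x. True) (top_of_set ?A) (top_of_set ?A) (id \<circ> H 1) id"
    by (simp add: homotopic_with_sym)
  have "H 1 x = x" if "x \<in> sphere m \<rho>" for x
    using that assms by (simp add: H_def dist_norm norm_minus_commute)
  then have "continuous_map (top_of_set (sphere m \<rho>)) (top_of_set (sphere m \<rho>)) (H 1)"
    by (auto intro: continuous_on_eq[OF continuous_on_id])
  with \<open>\<And>x. x \<in> sphere m \<rho> \<Longrightarrow> H 1 x = x\<close> show "homotopic_with (\<lambda>x. True) (top_of_set (sphere m \<rho>)) (top_of_set (sphere m \<rho>)) (H 1 \<circ> id) id"
    by (intro homotopic_with_equal) auto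
qed

lemma outside_ball_nonempty: "outside_ball (m::'a::euclidean_space) \<rho> \<noteq> {}"
proof -
  obtain b :: 'a where "b \<in> Basis" using nonempty_Basis by blast
  then have "m + \<bar>\<rho>\<bar> *\<^sub>R b \<in> outside_ball m \<rho>" by simp
  then show ?thesis by blast
qed

text \<open>The ambient space is contractible, so the boundary map identifies the relative homology with the
  reduced homology of the exterior of the ball, one degree lower, and the exterior retracts onto a sphere.\<close>

lemma homology_outside_ball:
  fixes m :: "'a::euclidean_space"
  assumes \<rho>: "\<rho> > 0"
  shows "relative_homology_group (int DIM('a)) euclidean (outside_ball m \<rho>) \<cong> integer_group"
    and "p \<noteq> int DIM('a) \<Longrightarrow> trivial_group (relative_homology_group p euclidean (outside_ball m \<rho>))"
proof -
  let ?A = "outside_ball m \<rho>" and ?n = "DIM('a) - 1"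
  obtain f :: "(nat \<Rightarrow> real) \<Rightarrow> 'a" and g where
    "homeomorphic_maps (nsphere ?n) (top_of_set (sphere 0 1 \<inter> span Basis)) f g"
    by (rule homeomorphic_maps_nsphere_euclidean_sphere[of Basis "DIM('a)"])
      (auto simp: independent_Basis orthogonal_Basis)
  then have "nsphere ?n homeomorphic_space top_of_set (sphere 0 1 :: 'a set)"
    unfolding homeomorphic_space_def span_Basis Int_UNIV_right by blast
  moreover have "top_of_set (sphere m \<rho>) homeomorphic_space top_of_set (sphere 0 1 :: 'a set)"
    using homeomorphic_spheres[of \<rho> 1 m 0] \<rho> by simp
  ultimately have "top_of_set (sphere m \<rho>) homeomorphic_space nsphere ?n"
    using homeomorphic_space_sym homeomorphic_space_trans by metis
  then have "top_of_set ?A homotopy_equivalent_space nsphere ?n"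
    using outside_ball_homotopy_equivalent_sphere[OF \<rho>] homeomorphic_imp_homotopy_equivalent_space
      homotopy_eqv_trans by metis
  then have red: "reduced_homology_group q (top_of_set ?A) \<cong> reduced_homology_group q (nsphere ?n)" for q
    by (rule homotopy_equivalent_space_imp_isomorphic_reduced_homology_groups)
  have "contractible_space (euclidean :: 'a topology)"
    using contractible_space_top_of_set[of "UNIV :: 'a set"] contractible_UNIV by simp
  then have "relative_homology_group q euclidean ?A \<cong> reduced_homology_group (q - 1) (top_of_set ?A)" for q
    using isomorphic_group_relative_homology_of_contractible[of euclidean ?A q] outside_ball_nonempty[of \<rho> m]
    by auto
  then have iso: "relative_homology_group q euclidean ?A \<cong> reduced_homology_group (q - 1) (nsphere ?n)" for q
    using red iso_trans by blast
  have n: "int DIM('a) - 1 = int ?n" by simp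
  show "relative_homology_group (int DIM('a)) euclidean ?A \<cong> integer_group"
    using iso[of "int DIM('a)"] reduced_homology_group_nsphere(1)[of ?n] unfolding n by (rule iso_trans)
  assume "p \<noteq> int DIM('a)"
  then have "p - 1 \<noteq> int ?n" using n by linarith
  then have "trivial_group (reduced_homology_group (p - 1) (nsphere ?n))"
    by (rule reduced_homology_group_nsphere(2))
  then show "trivial_group (relative_homology_group p euclidean ?A)"
    using isomorphic_group_triviality[OF iso] by simp
qed

section \<open>From integral to rational homology\<close>

text \<open>Every rational chain becomes integral after multiplication by a common denominator, so a
  rational homology class is a rational multiple of an integral one.\<close>

definition rat_of_chain :: "'a chain \<Rightarrow> 'a rat_chain" where
  "rat_of_chain = Poly_Mapping.map rat_of_int"

definition rat_scale :: "rat \<Rightarrow> 'a rat_chain \<Rightarrow> 'a rat_chain" where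
  "rat_scale a = Poly_Mapping.map ((*) a)"

lemma lookup_rat_of_chain [simp]:
  "Poly_Mapping.lookup (rat_of_chain z) \<sigma> = rat_of_int (Poly_Mapping.lookup z \<sigma>)"
  by (simp add: rat_of_chain_def Poly_Mapping.map.rep_eq when_def)

lemma lookup_rat_scale [simp]:
  "Poly_Mapping.lookup (rat_scale a c) \<sigma> = a * Poly_Mapping.lookup c \<sigma>"
  by (simp add: rat_scale_def Poly_Mapping.map.rep_eq when_def)

lemma rat_scale_1 [simp]: "rat_scale 1 c = c"
  and rat_scale_0 [simp]: "rat_scale 0 c = 0"
  and rat_scale_rat_scale [simp]: "rat_scale a (rat_scale b c) = rat_scale (a * b) c"
  and rat_scale_plus_left: "rat_scale (a + b) c = rat_scale a c + rat_scale b c"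
  and rat_scale_minus_left: "rat_scale (a - b) c = rat_scale a c - rat_scale b c"
  and rat_scale_minus: "rat_scale a (c - d) = rat_scale a c - rat_scale a d"
  by (auto intro!: poly_mapping_eqI simp: lookup_add lookup_minus algebra_simps)

lemma rat_of_chain_diff: "rat_of_chain (z - w) = rat_of_chain z - rat_of_chain w"
  and rat_of_chain_frag_cmul: "rat_of_chain (frag_cmul n z) = rat_scale (rat_of_int n) (rat_of_chain z)"
  by (auto intro!: poly_mapping_eqI simp: lookup_add lookup_minus)

lemma keys_rat_of_chain [simp]: "Poly_Mapping.keys (rat_of_chain z) = Poly_Mapping.keys z"
  by (auto simp: in_keys_iff)

lemma keys_rat_scale: "Poly_Mapping.keys (rat_scale a c) \<subseteq> Poly_Mapping.keys c"
  by (auto simp: in_keys_iff)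

lemma common_denominator:
  fixes f :: "'i \<Rightarrow> rat"
  assumes "finite A"
  shows "\<exists>N::int. 0 < N \<and> (\<forall>i\<in>A. rat_of_int N * f i \<in> \<int>)"
  using assms
proof induction
  case (insert i A)
  then obtain N :: int where N: "0 < N" "\<forall>i\<in>A. rat_of_int N * f i \<in> \<int>" by blast
  obtain a b where ab: "f i = Fract a b" "b > 0" by (cases "f i") auto
  have "rat_of_int (N * b) * f j = rat_of_int b * (rat_of_int N * f j)" for j by simp
  moreover have "rat_of_int (N * b) * f i = rat_of_int (N * a)" using ab by (simp add: Fract_of_int_quotient)
  ultimately have "\<forall>j\<in>insert i A. rat_of_int (N * b) * f j \<in> \<int>"
    using N(2) by (metis Ints_mult Ints_of_int insert_iff)
  then show ?case using N(1) ab(2) by (intro exI[of _ "N * b"]) simp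
qed (auto intro: exI[of _ 1])

lemma clear_denominators:
  obtains N :: int and z where "0 < N" "rat_scale (rat_of_int N) c = rat_of_chain z"
proof -
  obtain N :: int where N: "0 < N" "\<forall>\<sigma>\<in>Poly_Mapping.keys c. rat_of_int N * Poly_Mapping.lookup c \<sigma> \<in> \<int>"
    using common_denominator[of "Poly_Mapping.keys c" "Poly_Mapping.lookup c"] by auto
  define z where "z = Poly_Mapping.map floor (rat_scale (rat_of_int N) c)"
  have z: "Poly_Mapping.lookup z \<sigma> = \<lfloor>rat_of_int N * Poly_Mapping.lookup c \<sigma>\<rfloor>" for \<sigma>
    by (simp add: z_def Poly_Mapping.map.rep_eq when_def)
  have "rat_of_int N * Poly_Mapping.lookup c \<sigma> \<in> \<int>" for \<sigma>
    using N(2) by (cases "\<sigma> \<in> Poly_Mapping.keys c") (auto simp: in_keys_iff)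
  then have "rat_scale (rat_of_int N) c = rat_of_chain z"
    by (intro poly_mapping_eqI) (simp add: z of_int_floor_cancel)
  then show thesis using that N(1) by blast
qed

lemma rat_singular_chain_of_chain [simp]: "rat_singular_chain p X (rat_of_chain z) \<longleftrightarrow> singular_chain p X z"
  by (simp add: rat_singular_chain_def singular_chain_def)

lemma rat_singular_chain_0 [simp]: "rat_singular_chain p X 0"
  by (simp add: rat_singular_chain_def)

lemma rat_singular_chain_scale: "rat_singular_chain p X c \<Longrightarrow> rat_singular_chain p X (rat_scale a c)"
  using keys_rat_scale by (fastforce simp: rat_singular_chain_def)

lemma rat_singular_chain_add:
  "rat_singular_chain p X c \<Longrightarrow> rat_singular_chain p X d \<Longrightarrow> rat_singular_chain p X (c + d)"
  using Poly_Mapping.keys_add[of c d] by (auto simp: rat_singular_chain_def)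

lemma rat_singular_chain_mono:
  "rat_singular_chain p (subtopology X T) c \<Longrightarrow> T \<subseteq> S \<Longrightarrow> rat_singular_chain p (subtopology X S) c"
  unfolding rat_singular_chain_def using singular_simplex_mono by blast

text \<open>Summing over any finite set containing the support lets the boundaries of several chains be
  compared term by term.\<close>

lemma lookup_rat_chain_boundary:
  assumes "finite A" "Poly_Mapping.keys c \<subseteq> A" "p \<noteq> 0"
  shows "Poly_Mapping.lookup (rat_chain_boundary p c) \<tau>
    = (\<Sum>\<sigma>\<in>A. \<Sum>k\<le>p. (if singular_face p k \<sigma> = \<tau> then (-1) ^ k * Poly_Mapping.lookup c \<sigma> else 0))"
proof -
  have "Poly_Mapping.lookup (rat_chain_boundary p c) \<tau>
      = (\<Sum>\<sigma>\<in>Poly_Mapping.keys c. \<Sum>k\<le>p.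
          (if singular_face p k \<sigma> = \<tau> then (-1) ^ k * Poly_Mapping.lookup c \<sigma> else 0))"
    using assms(3) by (simp add: rat_chain_boundary_def lookup_sum lookup_single when_def)
  also have "\<dots> = (\<Sum>\<sigma>\<in>A. \<Sum>k\<le>p. (if singular_face p k \<sigma> = \<tau> then (-1) ^ k * Poly_Mapping.lookup c \<sigma> else 0))"
    using assms by (intro sum.mono_neutral_left) (auto simp: in_keys_iff intro!: sum.neutral)
  finally show ?thesis .
qed

lemma rat_chain_boundary_add:
  "rat_chain_boundary p (c + d) = rat_chain_boundary p c + rat_chain_boundary p d"
proof (cases "p = 0")
  case False
  let ?A = "Poly_Mapping.keys c \<union> Poly_Mapping.keys d"
  have "finite ?A" "Poly_Mapping.keys (c + d) \<subseteq> ?A" using Poly_Mapping.keys_add[of c d] by auto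
  then show ?thesis
    by (intro poly_mapping_eqI)
      (simp add: lookup_add lookup_rat_chain_boundary[of ?A] False
        flip: sum.distrib, auto intro!: sum.cong simp: lookup_add algebra_simps)
qed (simp add: rat_chain_boundary_def)

lemma rat_chain_boundary_scale: "rat_chain_boundary p (rat_scale a c) = rat_scale a (rat_chain_boundary p c)"
proof (cases "p = 0")
  case False
  then show ?thesis
    using keys_rat_scale[of a c]
    by (intro poly_mapping_eqI)
      (simp add: lookup_rat_chain_boundary[of "Poly_Mapping.keys c"] sum_distrib_left,
        auto intro!: sum.cong)
qed (simp add: rat_chain_boundary_def poly_mapping_eqI)

lemma rat_chain_boundary_of_chain:
  "rat_chain_boundary p (rat_of_chain z) = rat_of_chain (chain_boundary p z)"
proof (cases "p = 0")
  case False
  show ?thesis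
  proof (rule poly_mapping_eqI)
    fix \<tau>
    have "Poly_Mapping.lookup (chain_boundary p z) \<tau> = (\<Sum>\<sigma>\<in>Poly_Mapping.keys z. \<Sum>k\<le>p.
        (if singular_face p k \<sigma> = \<tau> then (-1) ^ k * Poly_Mapping.lookup z \<sigma> else 0))"
      using False by (simp add: chain_boundary_def frag_extend_def lookup_sum sum_distrib_left)
        (auto intro!: sum.cong)
    then show "Poly_Mapping.lookup (rat_chain_boundary p (rat_of_chain z)) \<tau>
        = Poly_Mapping.lookup (rat_of_chain (chain_boundary p z)) \<tau>"
      using False by (simp add: lookup_rat_chain_boundary[of "Poly_Mapping.keys z"])
        (auto intro!: sum.cong simp: if_distrib)
  qed
qed (simp add: rat_chain_boundary_def chain_boundary_def poly_mapping_eqI)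

lemma rat_relcycles_of_chain: "rat_of_chain z \<in> rat_relcycles p X S \<longleftrightarrow> singular_relcycle p X S z"
  by (simp add: rat_relcycles_def singular_relcycle rat_chain_boundary_of_chain)

lemma rat_relcycles_scale: "c \<in> rat_relcycles p X S \<Longrightarrow> rat_scale a c \<in> rat_relcycles p X S"
  by (simp add: rat_relcycles_def rat_chain_boundary_scale rat_singular_chain_scale)

lemma rat_relcycles_add:
  "c \<in> rat_relcycles p X S \<Longrightarrow> d \<in> rat_relcycles p X S \<Longrightarrow> c + d \<in> rat_relcycles p X S"
  by (simp add: rat_relcycles_def rat_chain_boundary_add rat_singular_chain_add)

lemma rat_relboundaries_scale: "c \<in> rat_relboundaries p X S \<Longrightarrow> rat_scale a c \<in> rat_relboundaries p X S"
  unfolding rat_relboundaries_def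
  by (clarsimp simp flip: rat_scale_minus rat_chain_boundary_scale)
    (metis rat_chain_boundary_scale rat_scale_minus rat_singular_chain_scale)

lemma rat_relboundaries_add:
  assumes "c \<in> rat_relboundaries p X S" "c' \<in> rat_relboundaries p X S"
  shows "c + c' \<in> rat_relboundaries p X S"
proof -
  obtain d d' where *: "rat_singular_chain (Suc p) X d" "rat_singular_chain (Suc p) X d'"
    "rat_singular_chain p (subtopology X S) (c - rat_chain_boundary (Suc p) d)"
    "rat_singular_chain p (subtopology X S) (c' - rat_chain_boundary (Suc p) d')"
    using assms by (auto simp: rat_relboundaries_def)
  have "c + c' - rat_chain_boundary (Suc p) (d + d')
      = (c - rat_chain_boundary (Suc p) d) + (c' - rat_chain_boundary (Suc p) d')"
    by (simp add: rat_chain_boundary_add)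
  then show ?thesis
    using * rat_singular_chain_add unfolding rat_relboundaries_def by (metis (mono_tags, lifting) mem_Collect_eq)
qed

lemma rat_relboundaries_of_chainI:
  assumes "singular_relboundary p X S z" shows "rat_of_chain z \<in> rat_relboundaries p X S"
proof -
  obtain d where "singular_chain (Suc p) X d" "singular_chain p (subtopology X S) (chain_boundary (Suc p) d - z)"
    using assms by (auto simp: singular_relboundary_def mod_subset_def)
  then have "rat_singular_chain (Suc p) X (rat_of_chain d)"
    "rat_singular_chain p (subtopology X S) (rat_of_chain z - rat_chain_boundary (Suc p) (rat_of_chain d))"
    using singular_chain_minus[of p _ "chain_boundary (Suc p) d - z"]
    by (auto simp: rat_chain_boundary_of_chain simp flip: rat_of_chain_diff)
  then show ?thesis unfolding rat_relboundaries_def by blast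
qed

lemma rat_relboundaries_of_chainD:
  assumes "rat_of_chain z \<in> rat_relboundaries p X S"
  obtains N :: int where "0 < N" "singular_relboundary p X S (frag_cmul N z)"
proof -
  obtain d where d: "rat_singular_chain (Suc p) X d"
    "rat_singular_chain p (subtopology X S) (rat_of_chain z - rat_chain_boundary (Suc p) d)"
    using assms by (auto simp: rat_relboundaries_def)
  obtain N :: int and w where N: "0 < N" "rat_scale (rat_of_int N) d = rat_of_chain w"
    using clear_denominators by blast
  have "singular_chain (Suc p) X w"
    using rat_singular_chain_scale[OF d(1), of "rat_of_int N"] N(2) by simp
  moreover have "rat_scale (rat_of_int N) (rat_of_chain z - rat_chain_boundary (Suc p) d)
      = rat_of_chain (frag_cmul N z - chain_boundary (Suc p) w)"
    by (simp add: rat_scale_minus rat_of_chain_diff rat_of_chain_frag_cmul N(2)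
        flip: rat_chain_boundary_scale rat_chain_boundary_of_chain)
  then have "singular_chain p (subtopology X S) (frag_cmul N z - chain_boundary (Suc p) w)"
    using rat_singular_chain_scale[OF d(2), of "rat_of_int N"] by simp
  then have "singular_chain p (subtopology X S) (chain_boundary (Suc p) w - frag_cmul N z)"
    using singular_chain_minus minus_diff_eq by metis
  ultimately show thesis
    using that[OF N(1)] by (auto simp: singular_relboundary_def mod_subset_def)
qed

lemma rat_scale_inverse: "N \<noteq> 0 \<Longrightarrow> c = rat_scale (1 / rat_of_int N) (rat_scale (rat_of_int N) c)"
  by simp

text \<open>The boundary of a boundary vanishes for integral chains, and clearing denominators reduces the
  rational case to that one.\<close>

lemma rat_relboundaries_subset_relcycles: "rat_relboundaries p X S \<subseteq> rat_relcycles p X S"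
proof
  fix c assume c: "c \<in> rat_relboundaries p X S"
  obtain N :: int and z where N: "0 < N" "rat_scale (rat_of_int N) c = rat_of_chain z"
    using clear_denominators by blast
  then have "rat_of_chain z \<in> rat_relboundaries p X S" using rat_relboundaries_scale[OF c] by metis
  then obtain M :: int where M: "0 < M" "singular_relboundary p X S (frag_cmul M z)"
    using rat_relboundaries_of_chainD by blast
  have "rat_of_chain (frag_cmul M z) \<in> rat_relcycles p X S"
    using singular_relboundary_imp_relcycle[OF M(2)] by (simp add: rat_relcycles_of_chain)
  moreover have "c = rat_scale (1 / rat_of_int (M * N)) (rat_of_chain (frag_cmul M z))"
    using N M by (simp add: rat_of_chain_frag_cmul flip: N(2))
  ultimately show "c \<in> rat_relcycles p X S" using rat_relcycles_scale by metis
qed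

lemma comm_group_rat_relcycle_group: "comm_group (rat_relcycle_group p X S)"
proof (rule comm_groupI)
  fix c assume "c \<in> carrier (rat_relcycle_group p X S)"
  then show "\<exists>d\<in>carrier (rat_relcycle_group p X S). d \<otimes>\<^bsub>rat_relcycle_group p X S\<^esub> c = \<one>\<^bsub>rat_relcycle_group p X S\<^esub>"
    using rat_relcycles_scale[of c p X S "-1"] rat_scale_plus_left[of "-1" 1 c]
    by (auto simp: rat_relcycle_group_def)
next
  show "\<one>\<^bsub>rat_relcycle_group p X S\<^esub> \<in> carrier (rat_relcycle_group p X S)"
    by (auto simp: rat_relcycle_group_def rat_relcycles_def rat_chain_boundary_def)
qed (auto simp: rat_relcycle_group_def rat_relcycles_add add_ac)

lemma mult_rat_relcycle_group: "(\<otimes>\<^bsub>rat_relcycle_group p X S\<^esub>) = (+)"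
  by (simp add: rat_relcycle_group_def)

lemma rat_relboundaries_0: "0 \<in> rat_relboundaries p X S"
  unfolding rat_relboundaries_def by (auto intro!: exI[of _ 0] simp: rat_chain_boundary_def)

lemma rat_relboundaries_diff:
  assumes "c \<in> rat_relboundaries p X S" "d \<in> rat_relboundaries p X S"
  shows "c - d \<in> rat_relboundaries p X S"
proof -
  have "c - d = c + rat_scale (-1) d" by (rule poly_mapping_eqI) (simp add: lookup_add lookup_minus)
  then show ?thesis using assms rat_relboundaries_add rat_relboundaries_scale by metis
qed

lemma normal_rat_relboundaries: "rat_relboundaries p X S \<lhd> rat_relcycle_group p X S"
proof -
  interpret comm_group "rat_relcycle_group p X S" by (rule comm_group_rat_relcycle_group)
  have "subgroup (rat_relboundaries p X S) (rat_relcycle_group p X S)"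
  proof (rule subgroupI)
    fix c assume c: "c \<in> rat_relboundaries p X S"
    then have "c \<in> carrier (rat_relcycle_group p X S)"
      using rat_relboundaries_subset_relcycles by (auto simp: rat_relcycle_group_def)
    moreover have "- c = 0 - c" by simp
    then have "- c \<in> rat_relboundaries p X S"
      using c rat_relboundaries_0 rat_relboundaries_diff by metis
    moreover from this have "- c \<in> carrier (rat_relcycle_group p X S)"
      using rat_relboundaries_subset_relcycles by (auto simp: rat_relcycle_group_def)
    ultimately show "m_inv (rat_relcycle_group p X S) c \<in> rat_relboundaries p X S"
      using inv_equality[of "- c" c] by (simp add: rat_relcycle_group_def)
  qed (use rat_relboundaries_subset_relcycles rat_relboundaries_0[of p X S] in
      \<open>auto simp: rat_relcycle_group_def rat_relboundaries_add\<close>)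
  then show ?thesis by (simp add: normal_iff_subgroup)
qed

abbreviation rat_class :: "nat \<Rightarrow> 'a topology \<Rightarrow> 'a set \<Rightarrow> 'a rat_chain \<Rightarrow> 'a rat_chain set" where
  "rat_class p X S c \<equiv> rat_relboundaries p X S #>\<^bsub>rat_relcycle_group p X S\<^esub> c"

lemma mem_rat_class: "d \<in> rat_class p X S c \<longleftrightarrow> d - c \<in> rat_relboundaries p X S"
  by (auto simp: r_coset_def rat_relcycle_group_def intro: bexI[of _ "d - c"])

lemma rat_class_eq_iff: "rat_class p X S c = rat_class p X S d \<longleftrightarrow> c - d \<in> rat_relboundaries p X S"
proof
  assume "rat_class p X S c = rat_class p X S d"
  moreover have "c \<in> rat_class p X S c" by (simp add: mem_rat_class rat_relboundaries_0)
  ultimately show "c - d \<in> rat_relboundaries p X S" by (simp add: mem_rat_class)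
next
  assume *: "c - d \<in> rat_relboundaries p X S"
  have "e - d = (e - c) + (c - d)" "e - c = (e - d) - (c - d)" for e by auto
  then show "rat_class p X S c = rat_class p X S d"
    using * rat_relboundaries_add rat_relboundaries_diff by (metis (no_types, lifting) mem_rat_class subsetI subset_antisym)
qed

lemma carrier_rat_homology_group:
  "carrier (rat_homology_group p X S) = rat_class p X S ` rat_relcycles p X S"
  by (auto simp: rat_homology_group_def FactGroup_def RCOSETS_def rat_relcycle_group_def)

lemma group_rat_homology_group: "group (rat_homology_group p X S)"
  unfolding rat_homology_group_def by (rule normal.factorgroup_is_group[OF normal_rat_relboundaries])

lemma mult_rat_class:
  assumes "c \<in> rat_relcycles p X S" "d \<in> rat_relcycles p X S"
  shows "rat_class p X S c \<otimes>\<^bsub>rat_homology_group p X S\<^esub> rat_class p X S d = rat_class p X S (c + d)"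
  using normal.rcos_sum[OF normal_rat_relboundaries, of c p X S d] assms
  by (simp add: rat_homology_group_def FactGroup_def rat_relcycle_group_def)

lemma rat_relcyclesE:
  assumes "c \<in> rat_relcycles p X S"
  obtains N :: int and z where "0 < N" "singular_relcycle p X S z" "rat_scale (rat_of_int N) c = rat_of_chain z"
  using clear_denominators[of c] rat_relcycles_scale[OF assms] rat_relcycles_of_chain by metis

lemma trivial_rat_homology_group:
  assumes "trivial_group (relative_homology_group (int p) X S)"
  shows "trivial_group (rat_homology_group p X S)"
proof -
  have bd: "singular_relboundary p X S z" if "singular_relcycle p X S z" for z
  proof -
    have "homologous_rel_set p X S z \<in> carrier (relative_homology_group (int p) X S)"
      using that by (auto simp: carrier_relative_homology_group)
    then have "homologous_rel_set p X S z = singular_relboundary_set p X S"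
      using assms by (simp add: trivial_group_def)
    then show ?thesis by (simp add: homologous_rel_set_eq_relboundary)
  qed
  have "rat_class p X S c = rat_class p X S 0" if c: "c \<in> rat_relcycles p X S" for c
  proof -
    obtain N :: int and z where z: "0 < N" "singular_relcycle p X S z" "rat_scale (rat_of_int N) c = rat_of_chain z"
      using rat_relcyclesE[OF c] by blast
    then have "rat_scale (rat_of_int N) c \<in> rat_relboundaries p X S"
      using rat_relboundaries_of_chainI[OF bd] by simp
    then have "c \<in> rat_relboundaries p X S"
      using rat_scale_inverse[of N c] rat_relboundaries_scale z(1) by (metis less_irrefl)
    then show ?thesis by (simp add: rat_class_eq_iff)
  qed
  then have "carrier (rat_homology_group p X S) \<subseteq> {rat_class p X S 0}"
    by (auto simp: carrier_rat_homology_group)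
  moreover have "\<one>\<^bsub>rat_homology_group p X S\<^esub> \<in> carrier (rat_homology_group p X S)"
    by (intro monoid.one_closed group.is_monoid group_rat_homology_group)
  ultimately show ?thesis
    using group_rat_homology_group[of p X S] unfolding trivial_group_def by blast
qed

text \<open>Pulled back to relative cycles, an isomorphism with the integers is an additive functional whose
  kernel consists of the relative boundaries. The cycle \<open>z\<close> is one of value 1.\<close>

lemma infinite_cyclic_homologyE:
  assumes iso: "relative_homology_group (int p) X S \<cong> integer_group"
  obtains z where "singular_relcycle p X S z"
    "\<And>w. singular_relcycle p X S w \<Longrightarrow> \<exists>n. singular_relboundary p X S (w - frag_cmul n z)"
    "\<And>n. singular_relboundary p X S (frag_cmul n z) \<Longrightarrow> n = 0"
proof -
  let ?H = "relative_homology_group (int p) X S" and ?cl = "homologous_rel_set p X S"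
  obtain h where h: "h \<in> hom ?H integer_group" and bij: "bij_betw h (carrier ?H) UNIV"
    using iso by (auto simp: is_iso_def iso_def)
  define \<psi> where "\<psi> w = h (?cl w)" for w
  have cl: "?cl w \<in> carrier ?H" if "singular_relcycle p X S w" for w
    using that by (auto simp: carrier_relative_homology_group)
  have add: "\<psi> (w + w') = \<psi> w + \<psi> w'" if w: "singular_relcycle p X S w" "singular_relcycle p X S w'" for w w'
  proof -
    have "?cl (w + w') = ?cl w \<otimes>\<^bsub>?H\<^esub> ?cl w'"
      using normal.rcos_sum[OF normal_subgroup_singular_relboundary_relcycle, of w p X S w'] w
      by (simp add: nontrivial_relative_homology_group FactGroup_def right_coset_singular_relboundary)
    then show ?thesis using hom_mult[OF h cl cl, OF w] by (simp add: \<psi>_def integer_group_def)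
  qed
  have one: "h \<one>\<^bsub>?H\<^esub> = 0"
    using hom_one[OF h group_relative_homology_group group_integer_group]
    unfolding integer_group_def by simp
  have ker: "singular_relboundary p X S w \<longleftrightarrow> \<psi> w = 0" if w: "singular_relcycle p X S w" for w
  proof -
    have "\<psi> w = 0 \<longleftrightarrow> ?cl w = \<one>\<^bsub>?H\<^esub>"
      using one bij_betw_imp_inj_on[OF bij] cl[OF w] group.is_monoid[OF group_relative_homology_group]
        monoid.one_closed unfolding \<psi>_def inj_on_def by metis
    then show ?thesis by (simp add: homologous_rel_set_eq_relboundary)
  qed
  have "1 \<in> h ` carrier ?H" using bij by (simp add: bij_betw_def)
  then obtain z where z: "singular_relcycle p X S z" "\<psi> z = 1"
    by (auto simp: carrier_relative_homology_group \<psi>_def)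
  have minus: "\<psi> (- w) = - \<psi> w" if "singular_relcycle p X S w" for w
    using add[of w "- w"] that ker[of 0] by (simp add: singular_relcycle_minus)
  have nat: "\<psi> (frag_cmul (int n) z) = int n" for n
  proof (induction n)
    case (Suc n)
    have "frag_cmul (int (Suc n)) z = z + frag_cmul (int n) z" by (simp add: frag_cmul_distrib)
    then show ?case using Suc add[OF z(1) singular_relcycle_cmul[OF z(1)]] z(2) by simp
  qed (use ker[of 0] in simp)
  have cmul: "\<psi> (frag_cmul n z) = n" for n
  proof (cases n)
    case (neg m)
    have "frag_cmul n z = - frag_cmul (int (Suc m)) z" by (simp add: neg)
    then show ?thesis using minus[OF singular_relcycle_cmul[OF z(1)]] nat neg by metis
  qed (simp add: nat)
  show thesis
  proof (rule that[OF z(1)])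
    fix w assume w: "singular_relcycle p X S w"
    let ?u = "frag_cmul (\<psi> w) z"
    have u: "singular_relcycle p X S ?u" by (rule singular_relcycle_cmul[OF z(1)])
    have "\<psi> (w - ?u) + \<psi> ?u = \<psi> w"
      using add[OF singular_relcycle_diff[OF w u] u] by simp
    then have "\<psi> (w - ?u) = 0" by (simp only: cmul)
    then show "\<exists>n. singular_relboundary p X S (w - frag_cmul n z)"
      using ker[OF singular_relcycle_diff[OF w u]] by blast
  next
    fix n assume "singular_relboundary p X S (frag_cmul n z)"
    then show "n = 0" using ker[OF singular_relcycle_cmul[OF z(1)]] cmul by simp
  qed
qed

text \<open>The rational multiples of an integral generator exhaust the group, and no nonzero multiple is a boundary since
  after clearing denominators it is an integral multiple of the generator.\<close>

lemma rat_homology_group_iso_rat_group: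
  assumes "relative_homology_group (int p) X S \<cong> integer_group"
  shows "rat_homology_group p X S \<cong> rat_group"
proof -
  obtain z where z: "singular_relcycle p X S z"
    "\<And>w. singular_relcycle p X S w \<Longrightarrow> \<exists>n. singular_relboundary p X S (w - frag_cmul n z)"
    "\<And>n. singular_relboundary p X S (frag_cmul n z) \<Longrightarrow> n = 0"
    using infinite_cyclic_homologyE[OF assms] by blast
  have zc: "rat_scale a (rat_of_chain z) \<in> rat_relcycles p X S" for a
    by (simp add: rat_relcycles_scale rat_relcycles_of_chain z(1))
  define \<Phi> where "\<Phi> a = rat_class p X S (rat_scale a (rat_of_chain z))" for a
  have "\<Phi> \<in> hom rat_group (rat_homology_group p X S)"
    by (rule homI)
      (auto simp: \<Phi>_def rat_group_def carrier_rat_homology_group zc mult_rat_class rat_scale_plus_left)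
  moreover have "inj \<Phi>"
  proof (rule injI)
    fix a b assume "\<Phi> a = \<Phi> b"
    then have *: "rat_scale (a - b) (rat_of_chain z) \<in> rat_relboundaries p X S"
      by (simp add: \<Phi>_def rat_class_eq_iff rat_scale_minus_left)
    obtain n d where nd: "a - b = Fract n d" "d > 0" by (cases "a - b") auto
    have "rat_scale (rat_of_int d) (rat_scale (a - b) (rat_of_chain z)) = rat_of_chain (frag_cmul n z)"
      using nd by (simp add: rat_of_chain_frag_cmul Fract_of_int_quotient)
    then obtain N :: int where "0 < N" "singular_relboundary p X S (frag_cmul N (frag_cmul n z))"
      using rat_relboundaries_scale[OF *] rat_relboundaries_of_chainD by metis
    then have "n = 0" using z(3)[of "N * n"] by simp
    then show "a = b" using nd by (simp add: Fract_of_int_quotient)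
  qed
  moreover have "carrier (rat_homology_group p X S) \<subseteq> range \<Phi>"
  proof
    fix x assume "x \<in> carrier (rat_homology_group p X S)"
    then obtain c where c: "c \<in> rat_relcycles p X S" "x = rat_class p X S c"
      by (auto simp: carrier_rat_homology_group)
    obtain N :: int and w where w: "0 < N" "singular_relcycle p X S w" "rat_scale (rat_of_int N) c = rat_of_chain w"
      using rat_relcyclesE[OF c(1)] by blast
    obtain n where "singular_relboundary p X S (w - frag_cmul n z)" using z(2)[OF w(2)] by blast
    then have "rat_scale (1 / rat_of_int N) (rat_of_chain (w - frag_cmul n z)) \<in> rat_relboundaries p X S"
      by (intro rat_relboundaries_scale rat_relboundaries_of_chainI)
    moreover have "rat_scale (1 / rat_of_int N) (rat_of_chain (w - frag_cmul n z))
        = c - rat_scale (rat_of_int n / rat_of_int N) (rat_of_chain z)"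
      using w(1) by (simp add: rat_of_chain_diff rat_scale_minus rat_of_chain_frag_cmul flip: w(3))
    ultimately have "x = \<Phi> (rat_of_int n / rat_of_int N)"
      by (simp add: c(2) \<Phi>_def rat_class_eq_iff)
    then show "x \<in> range \<Phi>" by blast
  qed
  ultimately have "\<Phi> \<in> iso rat_group (rat_homology_group p X S)"
    by (auto simp: iso_def bij_betw_def hom_def rat_group_def)
  then have "rat_group \<cong> rat_homology_group p X S" by (rule is_isoI)
  moreover have "group rat_group" unfolding rat_group_def by (rule groupI) (auto intro: exI[of _ "- x" for x])
  ultimately show ?thesis by (simp add: group.iso_sym)
qed

lemma rat_group_nontrivial:
  assumes "G \<cong> rat_group" shows "\<nexists>u. carrier G = {u}"
proof
  assume "\<exists>u. carrier G = {u}"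
  moreover obtain h where "bij_betw h (carrier G) (UNIV :: rat set)"
    using assms by (auto simp: is_iso_def iso_def rat_group_def)
  ultimately show False
    using infinite_UNIV_char_0[where 'a=rat] bij_betw_finite by (metis finite.emptyI finite_insert)
qed

lemma rat_hom_inclusion_class:
  assumes "U \<subseteq> V"
  shows "rat_hom_inclusion p (top_of_set V) S (rat_class p (top_of_set U) S c) = rat_class p (top_of_set V) S c"
proof -
  have sub: "rat_relboundaries p (top_of_set U) S \<subseteq> rat_relboundaries p (top_of_set V) S"
    unfolding rat_relboundaries_def subtopology_subtopology
    using assms rat_singular_chain_mono by (smt (verit, best) Collect_mono Int_mono order_refl)
  show ?thesis
  proof (rule Set.set_eqI)
    fix e
    have "e \<in> rat_hom_inclusion p (top_of_set V) S (rat_class p (top_of_set U) S c) \<longleftrightarrow>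
        (\<exists>b\<in>rat_relboundaries p (top_of_set V) S. \<exists>k. k - c \<in> rat_relboundaries p (top_of_set U) S \<and> e = b + k)"
      by (simp add: rat_hom_inclusion_def set_mult_def mult_rat_relcycle_group Bex_def mem_rat_class)
    also have "\<dots> \<longleftrightarrow> e - c \<in> rat_relboundaries p (top_of_set V) S"
    proof
      assume "\<exists>b\<in>rat_relboundaries p (top_of_set V) S. \<exists>k. k - c \<in> rat_relboundaries p (top_of_set U) S \<and> e = b + k"
      then obtain b k where bk: "b \<in> rat_relboundaries p (top_of_set V) S" "k - c \<in> rat_relboundaries p (top_of_set U) S" "e = b + k"
        by blast
      show "e - c \<in> rat_relboundaries p (top_of_set V) S"
        using rat_relboundaries_add[OF bk(1) subsetD[OF sub bk(2)]] by (simp add: bk(3) add_diff_eq)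
    next
      assume "e - c \<in> rat_relboundaries p (top_of_set V) S"
      then show "\<exists>b\<in>rat_relboundaries p (top_of_set V) S. \<exists>k. k - c \<in> rat_relboundaries p (top_of_set U) S \<and> e = b + k"
        using rat_relboundaries_0 by (intro bexI[of _ "e - c"] exI[of _ c]) auto
    qed
    finally show "e \<in> rat_hom_inclusion p (top_of_set V) S (rat_class p (top_of_set U) S c) \<longleftrightarrow>
        e \<in> rat_class p (top_of_set V) S c" by (simp add: mem_rat_class)
  qed
qed

lemma singular_relcycle_top_of_set_mono:
  assumes "U \<subseteq> V" "singular_relcycle p (top_of_set U) S z" shows "singular_relcycle p (top_of_set V) S z"
proof -
  have "U \<inter> S \<subseteq> V \<inter> S" using assms(1) by blast
  then show ?thesis
    using assms unfolding singular_relcycle subtopology_subtopology by (metis singular_chain_mono)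
qed

lemma hom_induced_inclusion_class:
  assumes "U \<subseteq> V" "singular_relcycle p (top_of_set U) S z"
  shows "hom_induced (int p) (top_of_set U) S (top_of_set V) S id (homologous_rel_set p (top_of_set U) S z)
    = homologous_rel_set p (top_of_set V) S z"
proof -
  have "chain_map p id z = z"
    using assms(2) by (intro chain_map_id_gen[of p "top_of_set U"]) (auto simp: singular_relcycle)
  moreover have "continuous_map (top_of_set U) (top_of_set V) id" "id \<in> S \<rightarrow> S" using assms(1) by auto
  ultimately show ?thesis
    using hom_induced_chain_map[of "top_of_set U" "top_of_set V" id S S p z] assms(2) by simp
qed

text \<open>A rational class of the larger pair is a fraction of an integral one, which comes from the smaller
  pair.\<close>

lemma rat_hom_inclusion_surj:
  assumes UV: "U \<subseteq> V"
    and surj: "carrier (relative_homology_group (int p) (top_of_set V) S)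
      \<subseteq> hom_induced (int p) (top_of_set U) S (top_of_set V) S id
          ` carrier (relative_homology_group (int p) (top_of_set U) S)"
  shows "rat_hom_inclusion p (top_of_set V) S ` carrier (rat_homology_group p (top_of_set U) S)
    = carrier (rat_homology_group p (top_of_set V) S)"
proof (rule equalityI; rule subsetI)
  let ?X = "top_of_set U" and ?Y = "top_of_set V"
  have mono: "c \<in> rat_relcycles p ?Y S" if c: "c \<in> rat_relcycles p ?X S" for c
  proof -
    obtain N :: int and z where z: "0 < N" "singular_relcycle p ?X S z" "rat_scale (rat_of_int N) c = rat_of_chain z"
      using rat_relcyclesE[OF c] by blast
    then have "rat_scale (rat_of_int N) c \<in> rat_relcycles p ?Y S"
      using singular_relcycle_top_of_set_mono[OF UV] by (simp add: rat_relcycles_of_chain)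
    then show ?thesis using rat_scale_inverse[of N c] rat_relcycles_scale z(1) by (metis less_irrefl)
  qed
  {
    fix x assume "x \<in> rat_hom_inclusion p ?Y S ` carrier (rat_homology_group p ?X S)"
    then show "x \<in> carrier (rat_homology_group p ?Y S)"
      using mono by (auto simp: carrier_rat_homology_group rat_hom_inclusion_class[OF UV])
  next
    fix x assume "x \<in> carrier (rat_homology_group p ?Y S)"
    then obtain c where c: "c \<in> rat_relcycles p ?Y S" "x = rat_class p ?Y S c"
      by (auto simp: carrier_rat_homology_group)
    obtain N :: int and w where w: "0 < N" "singular_relcycle p ?Y S w" "rat_scale (rat_of_int N) c = rat_of_chain w"
      using rat_relcyclesE[OF c(1)] by blast
    have "homologous_rel_set p ?Y S w \<in> carrier (relative_homology_group (int p) ?Y S)"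
      using w(2) by (auto simp: carrier_relative_homology_group)
    then have "homologous_rel_set p ?Y S w \<in> hom_induced (int p) ?X S ?Y S id
        ` homologous_rel_set p ?X S ` singular_relcycle_set p ?X S"
      using surj unfolding carrier_relative_homology_group[of p ?X S] by blast
    then obtain z where z: "singular_relcycle p ?X S z"
      "homologous_rel_set p ?Y S w = hom_induced (int p) ?X S ?Y S id (homologous_rel_set p ?X S z)"
      by blast
    then have "homologous_rel_set p ?Y S w = homologous_rel_set p ?Y S z"
      by (simp add: hom_induced_inclusion_class[OF UV])
    then have "singular_relboundary p ?Y S (w - z)"
      unfolding homologous_rel_set_eq by (simp add: homologous_rel_def)
    then have "rat_scale (1 / rat_of_int N) (rat_of_chain (w - z)) \<in> rat_relboundaries p ?Y S"
      by (intro rat_relboundaries_scale rat_relboundaries_of_chainI)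
    moreover have "rat_scale (1 / rat_of_int N) (rat_of_chain (w - z)) = c - rat_scale (1 / rat_of_int N) (rat_of_chain z)"
      using w(1) by (simp add: rat_of_chain_diff rat_scale_minus flip: w(3))
    ultimately have "x = rat_hom_inclusion p ?Y S (rat_class p ?X S (rat_scale (1 / rat_of_int N) (rat_of_chain z)))"
      by (simp add: c(2) rat_hom_inclusion_class[OF UV] rat_class_eq_iff)
    moreover have "rat_scale (1 / rat_of_int N) (rat_of_chain z) \<in> rat_relcycles p ?X S"
      using z(1) by (simp add: rat_relcycles_scale rat_relcycles_of_chain)
    ultimately show "x \<in> rat_hom_inclusion p ?Y S ` carrier (rat_homology_group p ?X S)"
      by (auto simp: carrier_rat_homology_group)
  }
qed

text \<open>If all integral relative cycles of the smaller pair bound in the larger one, so do the rational ones,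
  and the image consists of the zero class only.\<close>

lemma rat_hom_inclusion_not_surj:
  assumes UV: "U \<subseteq> V" and rat: "rat_homology_group p (top_of_set V) S \<cong> rat_group"
    and zero: "\<And>x. x \<in> carrier (relative_homology_group (int p) (top_of_set U) S) \<Longrightarrow>
      hom_induced (int p) (top_of_set U) S (top_of_set V) S id x
        = \<one>\<^bsub>relative_homology_group (int p) (top_of_set V) S\<^esub>"
  shows "rat_hom_inclusion p (top_of_set V) S ` carrier (rat_homology_group p (top_of_set U) S)
    \<noteq> carrier (rat_homology_group p (top_of_set V) S)"
proof
  let ?X = "top_of_set U" and ?Y = "top_of_set V"
  assume eq: "rat_hom_inclusion p ?Y S ` carrier (rat_homology_group p ?X S) = carrier (rat_homology_group p ?Y S)"
  have bd: "singular_relboundary p ?Y S z" if "singular_relcycle p ?X S z" for z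
    using zero[of "homologous_rel_set p ?X S z"] that
    by (auto simp: carrier_relative_homology_group hom_induced_inclusion_class[OF UV] homologous_rel_set_eq_relboundary)
  have "rat_class p ?Y S c = rat_class p ?Y S 0" if c: "c \<in> rat_relcycles p ?X S" for c
  proof -
    obtain N :: int and z where z: "0 < N" "singular_relcycle p ?X S z" "rat_scale (rat_of_int N) c = rat_of_chain z"
      using rat_relcyclesE[OF c] by blast
    then have "rat_scale (rat_of_int N) c \<in> rat_relboundaries p ?Y S"
      using rat_relboundaries_of_chainI[OF bd] by simp
    then have "c \<in> rat_relboundaries p ?Y S"
      using rat_scale_inverse[of N c] rat_relboundaries_scale z(1) by (metis less_irrefl)
    then show ?thesis by (simp add: rat_class_eq_iff)
  qed
  then have "carrier (rat_homology_group p ?Y S) \<subseteq> {rat_class p ?Y S 0}"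
    by (auto simp: eq[symmetric] carrier_rat_homology_group[of p ?X S] rat_hom_inclusion_class[OF UV])
  moreover have "carrier (rat_homology_group p ?Y S) \<noteq> {}"
    using group_rat_homology_group[of p ?Y S] by (simp add: group.is_monoid monoid.carrier_not_empty)
  ultimately show False using rat_group_nontrivial[OF rat] by blast
qed

section \<open>Min-max values\<close>

text \<open>Under these hypotheses the levels at which the induced map is onto form exactly the interval
  \<open>{s..c}\<close>.\<close>

lemma is_minmaxI:
  fixes f :: "'a::euclidean_space \<Rightarrow> real"
  assumes f: "smooth f" "proper_map euclidean euclidean (grad f)" and \<iota>: "\<iota> \<le> DIM('a)"
    and level: "\<And>c. minmax_level f c \<Longrightarrow> - c \<le> s \<and> s \<le> c"
    and cyclic: "\<And>c. minmax_level f c \<Longrightarrow>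
      relative_homology_group (int \<iota>) (top_of_set (sublevel f c)) (sublevel f (- c)) \<cong> integer_group"
    and triv: "\<And>c p. minmax_level f c \<Longrightarrow> p \<noteq> int \<iota> \<Longrightarrow>
      trivial_group (relative_homology_group p (top_of_set (sublevel f c)) (sublevel f (- c)))"
    and surj: "\<And>c t. minmax_level f c \<Longrightarrow> s \<le> t \<Longrightarrow> t \<le> c \<Longrightarrow>
      carrier (relative_homology_group (int \<iota>) (top_of_set (sublevel f c)) (sublevel f (- c)))
      \<subseteq> hom_induced (int \<iota>) (top_of_set (sublevel f t)) (sublevel f (- c))
            (top_of_set (sublevel f c)) (sublevel f (- c)) id
          ` carrier (relative_homology_group (int \<iota>) (top_of_set (sublevel f t)) (sublevel f (- c)))"
    and zero: "\<And>c t x. minmax_level f c \<Longrightarrow> - c \<le> t \<Longrightarrow> t < s \<Longrightarrow>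
      x \<in> carrier (relative_homology_group (int \<iota>) (top_of_set (sublevel f t)) (sublevel f (- c))) \<Longrightarrow>
      hom_induced (int \<iota>) (top_of_set (sublevel f t)) (sublevel f (- c))
            (top_of_set (sublevel f c)) (sublevel f (- c)) id x
        = \<one>\<^bsub>relative_homology_group (int \<iota>) (top_of_set (sublevel f c)) (sublevel f (- c))\<^esub>"
  shows "is_minmax f s"
proof -
  have "sublevel_homology f c c \<iota> \<cong> rat_group \<and>
      (\<forall>p. p \<noteq> \<iota> \<longrightarrow> trivial_group (sublevel_homology f c c p)) \<and>
      s = Inf {t. - c \<le> t \<and> t \<le> c \<and>
        rat_hom_inclusion \<iota> (top_of_set (sublevel f c)) (sublevel f (-c)) ` carrier (sublevel_homology f c t \<iota>)
          = carrier (sublevel_homology f c c \<iota>)}" (is "?A \<and> ?B \<and> s = Inf ?T")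
    if c: "minmax_level f c" for c
  proof (intro conjI)
    show A: ?A unfolding sublevel_homology_def by (rule rat_homology_group_iso_rat_group[OF cyclic[OF c]])
    show ?B unfolding sublevel_homology_def by (intro allI impI trivial_rat_homology_group triv[OF c]) simp
    have sub: "sublevel f t \<subseteq> sublevel f c" if "t \<le> c" for t using that by (auto simp: sublevel_def)
    have "?T = {s..c}"
    proof (rule Set.set_eqI)
      fix t
      have "t \<in> ?T" if "s \<le> t" "t \<le> c"
        using that level[OF c] rat_hom_inclusion_surj[OF sub surj[OF c that]]
        by (auto simp: sublevel_homology_def)
      moreover have "t \<notin> ?T" if "- c \<le> t" "t < s"
        using that level[OF c]
          rat_hom_inclusion_not_surj[OF sub A[unfolded sublevel_homology_def] zero[OF c that]]
        by (auto simp: sublevel_homology_def)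
      ultimately show "t \<in> ?T \<longleftrightarrow> t \<in> {s..c}" using level[OF c] by fastforce
    qed
    then show "s = Inf ?T" using level[OF c] by simp
  qed
  then show ?thesis unfolding is_minmax_def using f \<iota> by (intro conjI bexI[of _ \<iota>]) auto
qed

text \<open>Critical points form a fibre of a proper map, hence a compact set on which the function is
  bounded.\<close>

lemma minmax_level_exists:
  assumes f: "smooth f" and pm: "proper_map euclidean euclidean (grad f)"
  shows "\<exists>c. minmax_level f c"
proof -
  have "compact {x. grad f x = 0}"
    using pm unfolding proper_map_def by auto
  then have "bounded (f ` {x. grad f x = 0})"
    by (intro compact_imp_bounded compact_continuous_image smooth_continuous_on[OF f])
  then obtain B where B: "\<And>x. grad f x = 0 \<Longrightarrow> \<bar>f x\<bar> \<le> B" by (auto simp: bounded_iff)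
  have "f x \<in> {- (\<bar>B\<bar> + 1)<..<\<bar>B\<bar> + 1}" if "grad f x = 0" for x using B[OF that] by auto
  then have "minmax_level f (\<bar>B\<bar> + 2)" unfolding minmax_level_def by (intro exI[of _ "\<bar>B\<bar> + 1"]) auto
  then show ?thesis by blast
qed

text \<open>Two min-max values could only differ if they came from different degrees, but the homology of the
  sublevel pair is nonzero in one degree only.\<close>

lemma minmax_eq:
  assumes s: "is_minmax f s" shows "minmax f = s"
  unfolding minmax_def
proof (rule the_equality)
  show "is_minmax f s" by (rule s)
next
  fix s' assume s': "is_minmax f s'"
  obtain c where c: "minmax_level f c"
    using s minmax_level_exists unfolding is_minmax_def by blast
  let ?T = "\<lambda>\<iota>. {t. - c \<le> t \<and> t \<le> c \<and>
        rat_hom_inclusion \<iota> (top_of_set (sublevel f c)) (sublevel f (-c)) ` carrier (sublevel_homology f c t \<iota>)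
          = carrier (sublevel_homology f c c \<iota>)}"
  obtain \<iota> where \<iota>: "sublevel_homology f c c \<iota> \<cong> rat_group" "s = Inf (?T \<iota>)"
    using s c unfolding is_minmax_def by blast
  obtain \<iota>' where \<iota>': "\<And>p. p \<noteq> \<iota>' \<Longrightarrow> trivial_group (sublevel_homology f c c p)" "s' = Inf (?T \<iota>')"
    using s' c unfolding is_minmax_def by blast
  have "\<iota> = \<iota>'"
  proof (rule ccontr)
    assume "\<iota> \<noteq> \<iota>'"
    then show False using \<iota>'(1) rat_group_nontrivial[OF \<iota>(1)] unfolding trivial_group_def by blast
  qed
  then show "s' = s" using \<iota>(2) \<iota>'(2) by simp
qed

lemma hom_induced_inclusion_compose:
  assumes "U \<subseteq> V" "V \<subseteq> W" "A \<subseteq> B" "B \<subseteq> C"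
  shows "hom_induced p (top_of_set V) B (top_of_set W) C id (hom_induced p (top_of_set U) A (top_of_set V) B id x)
    = hom_induced p (top_of_set U) A (top_of_set W) C id x"
  using hom_induced_compose'[of "top_of_set U" "top_of_set V" id A B "top_of_set W" id C p x] assms
  by (auto simp: subset_iff)

lemma hom_induced_one:
  "hom_induced p X A Y B f \<one>\<^bsub>relative_homology_group p X A\<^esub> = \<one>\<^bsub>relative_homology_group p Y B\<^esub>"
  by (rule hom_one[OF hom_induced_hom]) auto

lemma hom_induced_trivial_source:
  assumes "trivial_group (relative_homology_group p X A)" "x \<in> carrier (relative_homology_group p X A)"
  shows "hom_induced p X A Y B f x = \<one>\<^bsub>relative_homology_group p Y B\<^esub>"
  using assms hom_induced_one[of p X A Y B f] by (auto simp: trivial_group_def)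

lemma iso_inj: "h \<in> iso G H \<Longrightarrow> x \<in> carrier G \<Longrightarrow> y \<in> carrier G \<Longrightarrow> h x = h y \<Longrightarrow> x = y"
  by (auto simp: iso_def bij_betw_def inj_on_def)

lemma iso_surjE:
  assumes "h \<in> iso G H" "y \<in> carrier H" obtains x where "x \<in> carrier G" "y = h x"
  using assms by (auto simp: iso_def bij_betw_def)

lemma relative_homology_iso_sym:
  "relative_homology_group p X A \<cong> relative_homology_group q Y B \<Longrightarrow>
   relative_homology_group q Y B \<cong> relative_homology_group p X A"
  by (rule group.iso_sym) auto

lemma relative_homology_trivial_cong:
  assumes "relative_homology_group p X A \<cong> relative_homology_group q Y B"
    and "trivial_group (relative_homology_group p X A)"
  shows "trivial_group (relative_homology_group q Y B)"
  using isomorphic_group_triviality1[OF assms(1) _ assms(2)] by simp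

section \<open>The minimum and the maximum as min-max values\<close>

lemma steepE:
  assumes "steep f"
  obtains \<rho> where "\<rho> > 0" "\<And>x. \<rho> \<le> norm (x - m) \<Longrightarrow> 0 \<le> grad f x \<bullet> (x - m)"
proof -
  obtain \<rho> where "\<rho> > 0" "\<And>x. \<rho> \<le> norm (x - m) \<Longrightarrow> 0 * norm (x - m) \<le> grad f x \<bullet> (x - m)"
    using assms unfolding steep_def by blast
  then show thesis using that by simp
qed

text \<open>Every point of the segment from \<open>y\<close> outwards lies at distance at least \<open>\<rho>\<close> from \<open>m\<close>.\<close>

lemma radially_increasing:
  assumes f: "smooth f" and rad: "\<And>x. \<rho> \<le> norm (x - m) \<Longrightarrow> 0 \<le> grad f x \<bullet> (x - m)"
    and y: "\<rho> \<le> norm (y - m)" and l: "1 \<le> l"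
  shows "f y \<le> f (m + l *\<^sub>R (y - m))"
proof -
  let ?z = "m + l *\<^sub>R (y - m)"
  obtain s where s: "0 < s" "s < 1" "f ?z - f y = grad f (y + s *\<^sub>R (?z - y)) \<bullet> (?z - y)"
    using mean_value_grad[OF f] by blast
  define k where "k = 1 + s * (l - 1)"
  have k: "1 \<le> k" using s l by (simp add: k_def)
  have zy: "?z - y = (l - 1) *\<^sub>R (y - m)" by (simp add: algebra_simps)
  have \<xi>: "y + s *\<^sub>R (?z - y) = m + k *\<^sub>R (y - m)" unfolding zy k_def by (simp add: algebra_simps)
  have "1 * norm (y - m) \<le> k * norm (y - m)" using k by (intro mult_right_mono) auto
  then have "\<rho> \<le> norm (m + k *\<^sub>R (y - m) - m)" using y k by simp
  from rad[OF this] have "0 \<le> k * (grad f (m + k *\<^sub>R (y - m)) \<bullet> (y - m))" by simp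
  then have "0 \<le> grad f (m + k *\<^sub>R (y - m)) \<bullet> (y - m)" using k by (simp add: zero_le_mult_iff)
  then have "0 \<le> grad f (m + k *\<^sub>R (y - m)) \<bullet> ((l - 1) *\<^sub>R (y - m))" using l by simp
  then have "0 \<le> grad f (y + s *\<^sub>R (?z - y)) \<bullet> (?z - y)" by (subst \<xi>, subst zy)
  then show ?thesis using s(3) by simp
qed

lemma superlinear_bounded_sublevel:
  assumes "superlinear f" shows "\<exists>r. \<forall>x. f x \<le> b \<longrightarrow> norm x \<le> r"
proof -
  obtain C where "\<And>x. 1 * norm x - C \<le> f x" using assms superlinearE by blast
  then have "\<forall>x. f x \<le> b \<longrightarrow> norm x \<le> b + C" by (smt (verit))
  then show ?thesis by blast
qed

lemma compact_slab:
  assumes "continuous_on UNIV f" "superlinear f" shows "compact {x. a \<le> f x \<and> f x \<le> b}"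
proof -
  have "closed {x. a \<le> f x \<and> f x \<le> b}"
    using assms(1) by (intro closed_Collect_conj closed_Collect_le continuous_intros)
  moreover obtain r where "\<And>x. f x \<le> b \<Longrightarrow> norm x \<le> r"
    using superlinear_bounded_sublevel[OF assms(2)] by blast
  ultimately show ?thesis by (auto simp: compact_eq_bounded_closed bounded_iff)
qed

text \<open>The bottom sublevel set is empty. A high sublevel set is star-shaped about the minimum
  point \<open>m\<close>, and lower ones above the critical values deform onto each other, so the inclusion of \<open>{m}\<close>
  into each of them is an isomorphism in homology. It factors through every nonempty sublevel set.\<close>

lemma is_minmax_minimum:
  fixes F :: "'a::euclidean_space \<Rightarrow> real"
  assumes st: "steep F" and min: "\<And>x. F m \<le> F x"
  shows "is_minmax F (F m)"
proof -
  have F: "smooth F" and sl: "superlinear F" using st by (auto simp: steep_def)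
  have F': "smooth (\<lambda>x. - F x)" by (rule smooth_minus[OF F])
  have crit: "grad F m = 0" by (rule grad_eq_0_at_min[OF F min])
  have level: "- c < F m" "F m < c" if "minmax_level F c" for c
    using that crit unfolding minmax_level_def by force+
  have empty: "sublevel F (- c) = {}" if "minmax_level F c" for c
  proof -
    have "\<not> F x \<le> - c" for x using level(1)[OF that] min[of x] by linarith
    then show ?thesis by (simp add: sublevel_def)
  qed
  have iso: "hom_induced p (top_of_set {m}) {} (top_of_set (sublevel F c)) {} id
      \<in> iso (relative_homology_group p (top_of_set {m}) {}) (relative_homology_group p (top_of_set (sublevel F c)) {})"
    if lev: "minmax_level F c" for c p
  proof -
    obtain C where C: "0 < C" "C < c" "\<And>x. grad F x = 0 \<Longrightarrow> F x \<in> {- C<..<C}"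
      using lev unfolding minmax_level_def by blast
    obtain \<rho> where \<rho>: "\<rho> > 0" "\<And>x. \<rho> \<le> norm (x - m) \<Longrightarrow> 0 \<le> grad F x \<bullet> (x - m)"
      using steepE[OF st] by blast
    have inc: "F y \<le> F (m + l *\<^sub>R (y - m))" if "\<rho> \<le> norm (y - m)" "1 \<le> l" for y l
      by (rule radially_increasing[OF F _ that]) (rule \<rho>(2))
    have "bounded (F ` cball m \<rho>)"
      by (intro compact_imp_bounded compact_continuous_image smooth_continuous_on[OF F] compact_cball)
    then obtain b where "\<forall>x\<in>cball m \<rho>. \<bar>F x\<bar> \<le> b" by (auto simp: bounded_iff)
    then have b: "F x \<le> b" if "norm (x - m) \<le> \<rho>" for x
      using that by (force simp: dist_norm norm_minus_commute)
    \<comment> \<open>Above \<open>b\<close> only the region where \<open>F\<close> is radially increasing matters.\<close>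
    define c' where "c' = max (c + 1) b"
    have c': "c < c'" "b \<le> c'" by (auto simp: c'_def)
    have star: "m + s *\<^sub>R (x - m) \<in> sublevel F c'" if x: "x \<in> sublevel F c'" and s: "0 \<le> s" "s \<le> 1" for x s
    proof (cases "norm (s *\<^sub>R (x - m)) \<le> \<rho>")
      case True
      then show ?thesis using b[of "m + s *\<^sub>R (x - m)"] c' by (simp add: sublevel_def)
    next
      case False
      then have "s > 0" using s \<rho>(1) by (cases "s = 0") auto
      then have "F (m + s *\<^sub>R (x - m)) \<le> F x"
        using inc[of "m + s *\<^sub>R (x - m)" "1 / s"] False s by simp
      then show ?thesis using x by (simp add: sublevel_def)
    qed
    have i1: "hom_induced p (top_of_set {m}) {} (top_of_set (sublevel F c')) {} id
      \<in> iso (relative_homology_group p (top_of_set {m}) {}) (relative_homology_group p (top_of_set (sublevel F c')) {})"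
    proof (rule pair_deformation_iso[where H="\<lambda>t x. m + (1 - t) *\<^sub>R (x - m)"])
      show "{m} \<subseteq> sublevel F c'" using level(2)[OF lev] c' by (simp add: sublevel_def)
      show "continuous_on ({0..1} \<times> sublevel F c') (\<lambda>(t, x). m + (1 - t) *\<^sub>R (x - m))"
        unfolding split_beta by (intro continuous_intros)
    qed (use star in auto)
    have eq: "{x. - c' - 1 \<le> - F x \<and> - F x \<le> - C} = {x. C \<le> F x \<and> F x \<le> c' + 1}" by auto
    have comp: "compact {x. - c' - 1 \<le> - F x \<and> - F x \<le> - C}"
      unfolding eq by (rule compact_slab[OF smooth_continuous_on[OF F] sl])
    have reg: "\<forall>x\<in>{x. - c' - 1 \<le> - F x \<and> - F x \<le> - C}. grad (\<lambda>x. - F x) x \<noteq> 0"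
      unfolding eq using C(3) by (force simp: grad_minus[OF F])
    have lt: "- c' - 1 < - c'" "- c < - C" using C(2) by auto
    obtain H where "uphill_homotopy (\<lambda>x. - F x) (- c') (- c) H"
      using uphill_homotopy_exists[OF F' comp reg lt] by blast
    then have H: "continuous_on ({0..1} \<times> UNIV) (\<lambda>(t, x). H t x)" "\<And>x. H 0 x = x"
      "\<And>t x. t \<in> {0..1} \<Longrightarrow> F (H t x) \<le> F x" "\<And>x. F x \<le> c' \<Longrightarrow> F (H 1 x) \<le> c"
      unfolding uphill_homotopy_def by auto
    have i2: "hom_induced p (top_of_set (sublevel F c)) {} (top_of_set (sublevel F c')) {} id
      \<in> iso (relative_homology_group p (top_of_set (sublevel F c)) {}) (relative_homology_group p (top_of_set (sublevel F c')) {})"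
    proof (rule pair_deformation_iso[where H=H])
      have "H t x \<in> sublevel F c''" if "t \<in> {0..1}" "x \<in> sublevel F c''" for t x c''
        using H(3)[OF that(1), of x] that(2) by (simp add: sublevel_def)
      then show "\<And>t x. t \<in> {0..1} \<Longrightarrow> x \<in> sublevel F c' \<Longrightarrow> H t x \<in> sublevel F c'"
        "\<And>t x. t \<in> {0..1} \<Longrightarrow> x \<in> sublevel F c \<Longrightarrow> H t x \<in> sublevel F c" by blast+
      show "H 1 x \<in> sublevel F c" if "x \<in> sublevel F c'" for x
        using H(4)[of x] that by (simp add: sublevel_def)
    qed (use H(1,2) c' in \<open>auto simp: sublevel_def intro: continuous_on_subset\<close>)
    let ?j = "hom_induced p (top_of_set {m}) {} (top_of_set (sublevel F c)) {} id"
    have comp: "hom_induced p (top_of_set (sublevel F c)) {} (top_of_set (sublevel F c')) {} id (?j x)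
        = hom_induced p (top_of_set {m}) {} (top_of_set (sublevel F c')) {} id x" for x
      using level(2)[OF lev] c' by (intro hom_induced_inclusion_compose) (auto simp: sublevel_def)
    have "bij_betw ?j (carrier (relative_homology_group p (top_of_set {m}) {}))
        (carrier (relative_homology_group p (top_of_set (sublevel F c)) {}))"
      unfolding bij_betw_def inj_on_def
    proof (intro conjI ballI impI)
      fix x y assume "x \<in> carrier (relative_homology_group p (top_of_set {m}) {})"
        "y \<in> carrier (relative_homology_group p (top_of_set {m}) {})" "?j x = ?j y"
      then show "x = y" using comp iso_inj[OF i1] by metis
    next
      show "?j ` carrier (relative_homology_group p (top_of_set {m}) {})
        = carrier (relative_homology_group p (top_of_set (sublevel F c)) {})"
      proof (rule equalityI; rule subsetI)
        fix y assume y: "y \<in> carrier (relative_homology_group p (top_of_set (sublevel F c)) {})"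
        obtain x where "x \<in> carrier (relative_homology_group p (top_of_set {m}) {})"
          "hom_induced p (top_of_set (sublevel F c)) {} (top_of_set (sublevel F c')) {} id y
           = hom_induced p (top_of_set {m}) {} (top_of_set (sublevel F c')) {} id x"
          using iso_surjE[OF i1] hom_induced_carrier by metis
        then show "y \<in> ?j ` carrier (relative_homology_group p (top_of_set {m}) {})"
          using iso_inj[OF i2 y] comp hom_induced_carrier by (metis image_eqI)
      qed (auto simp: hom_induced_carrier)
    qed
    then show ?thesis by (simp add: iso_def hom_induced_hom)
  qed
  show ?thesis
  proof (rule is_minmaxI[where \<iota>=0])
    show "smooth F" by (rule F)
    show "proper_map euclidean euclidean (grad F)" by (rule steep_proper_grad(1)[OF st])
    fix c assume lev: "minmax_level F c"
    have iso': "relative_homology_group p (top_of_set {m}) {} \<cong> relative_homology_group p (top_of_set (sublevel F c)) {}" for p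
      using iso[OF lev] by (rule is_isoI)
    show "- c \<le> F m \<and> F m \<le> c" using level[OF lev] by simp
    show "relative_homology_group (int 0) (top_of_set (sublevel F c)) (sublevel F (- c)) \<cong> integer_group"
      using iso_trans[OF relative_homology_iso_sym[OF iso'] homology_coefficients[of _ m]]
      by (simp add: empty[OF lev])
    show "trivial_group (relative_homology_group p (top_of_set (sublevel F c)) (sublevel F (- c)))"
      if "p \<noteq> int 0" for p
      using relative_homology_trivial_cong[OF iso' homology_dimension_axiom[of _ m]] that
      by (simp add: empty[OF lev])
    {
      fix t assume t: "F m \<le> t" "t \<le> c"
      show "carrier (relative_homology_group (int 0) (top_of_set (sublevel F c)) (sublevel F (- c)))
        \<subseteq> hom_induced (int 0) (top_of_set (sublevel F t)) (sublevel F (- c))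
            (top_of_set (sublevel F c)) (sublevel F (- c)) id
          ` carrier (relative_homology_group (int 0) (top_of_set (sublevel F t)) (sublevel F (- c)))"
      proof
        fix y assume "y \<in> carrier (relative_homology_group (int 0) (top_of_set (sublevel F c)) (sublevel F (- c)))"
        then obtain x where "y = hom_induced (int 0) (top_of_set {m}) {} (top_of_set (sublevel F c)) {} id x"
          unfolding empty[OF lev] using iso_surjE[OF iso[OF lev]] by metis
        also have "\<dots> = hom_induced (int 0) (top_of_set (sublevel F t)) {} (top_of_set (sublevel F c)) {} id
            (hom_induced (int 0) (top_of_set {m}) {} (top_of_set (sublevel F t)) {} id x)"
          using t by (intro hom_induced_inclusion_compose[symmetric]) (auto simp: sublevel_def)
        finally show "y \<in> hom_induced (int 0) (top_of_set (sublevel F t)) (sublevel F (- c))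
            (top_of_set (sublevel F c)) (sublevel F (- c)) id
          ` carrier (relative_homology_group (int 0) (top_of_set (sublevel F t)) (sublevel F (- c)))"
          unfolding empty[OF lev] using hom_induced_carrier by blast
      qed
    }
    fix t x assume "t < F m"
      and x: "x \<in> carrier (relative_homology_group (int 0) (top_of_set (sublevel F t)) (sublevel F (- c)))"
    then have "\<not> F x \<le> t" for x using min[of x] by linarith
    then have "sublevel F t = {}" by (simp add: sublevel_def)
    then show "hom_induced (int 0) (top_of_set (sublevel F t)) (sublevel F (- c))
            (top_of_set (sublevel F c)) (sublevel F (- c)) id x
        = \<one>\<^bsub>relative_homology_group (int 0) (top_of_set (sublevel F c)) (sublevel F (- c))\<^esub>"
      using x by (intro hom_induced_trivial_source trivial_relative_homology_group_empty) auto
  qed simp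
qed


text \<open>Points are moved away from \<open>m\<close> along rays, by the factor that brings the distance up to \<open>\<sigma>\<close>; using
  \<open>max r\<close> of the distance in the denominator keeps the factor continuous at \<open>m\<close> without changing it on \<open>T\<close>.\<close>

lemma push_out_iso:
  fixes m :: "'a::euclidean_space"
  assumes r: "0 < r" "r \<le> \<sigma>" and T: "outside_ball m \<sigma> \<subseteq> T" "T \<subseteq> outside_ball m r"
    and rad: "\<And>x l. x \<in> T \<Longrightarrow> 1 \<le> l \<Longrightarrow> m + l *\<^sub>R (x - m) \<in> T"
  shows "hom_induced p (top_of_set UNIV) (outside_ball m \<sigma>) (top_of_set UNIV) T id
    \<in> iso (relative_homology_group p (top_of_set UNIV) (outside_ball m \<sigma>))
          (relative_homology_group p (top_of_set UNIV) T)"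
proof -
  define k where "k x = max 1 (\<sigma> / max r (norm (x - m)))" for x
  define H where "H t x = m + ((1 - t) + t * k x) *\<^sub>R (x - m)" for t x
  have contk: "continuous_on UNIV k"
    unfolding k_def using r by (intro continuous_intros) (auto simp: max_def)
  have l: "1 \<le> (1 - t) + t * k x" if "t \<in> {0..1}" for t x
  proof -
    have "t * 1 \<le> t * k x" using that by (intro mult_left_mono) (auto simp: k_def)
    then show ?thesis by simp
  qed
  have T_inv: "H t x \<in> T" if "t \<in> {0..1}" "x \<in> T" for t x
    unfolding H_def by (rule rad[OF that(2) l[OF that(1)]])
  have out: "H t x \<in> outside_ball m \<sigma>" if t: "t \<in> {0..1}" and x: "x \<in> outside_ball m \<sigma>" for t x
  proof -
    have "1 * norm (x - m) \<le> \<bar>(1 - t) + t * k x\<bar> * norm (x - m)"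
      using l[OF t, of x] by (intro mult_right_mono) auto
    then show ?thesis using x by (simp add: H_def)
  qed
  have end1: "H 1 x \<in> outside_ball m \<sigma>" if "x \<in> T" for x
  proof -
    have x: "r \<le> norm (x - m)" using that T by auto
    then have "norm (x - m) > 0" using r by linarith
    moreover have "\<sigma> / norm (x - m) \<le> k x" using x by (simp add: k_def max_def)
    ultimately have "\<sigma> \<le> k x * norm (x - m)" by (simp add: pos_divide_le_eq)
    also have "\<dots> \<le> norm (H 1 x - m)" by (simp add: H_def mult_right_mono)
    finally show ?thesis by simp
  qed
  show ?thesis
  proof (rule pair_deformation_iso[where H=H])
    show "continuous_on ({0..1} \<times> UNIV) (\<lambda>(t, x). H t x)"
      unfolding H_def split_beta
      by (intro continuous_intros continuous_on_compose2[OF contk]) auto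
  qed (use T T_inv out end1 in \<open>auto simp: H_def\<close>)
qed

text \<open>Sublevel sets of \<open>- F\<close> are superlevel sets of \<open>F\<close>. The bottom one deforms onto the exterior of a
  ball around \<open>m\<close>, so the pair carries the top class of the space. A sublevel set below the maximum misses a
  small ball around \<open>m\<close>, so its classes die in the homology relative to the exterior of that ball. Passing to
  the exterior of the small ball is an isomorphism, so they were zero before.\<close>

lemma is_minmax_maximum:
  fixes F :: "'a::euclidean_space \<Rightarrow> real"
  assumes st: "steep F" and min: "\<And>x. F m \<le> F x"
  shows "is_minmax (\<lambda>x. - F x) (- F m)"
proof -
  let ?N = "\<lambda>x. - F x" and ?A = "\<lambda>c. {x. c \<le> F x}"
  have F: "smooth F" and sl: "superlinear F" using st by (auto simp: steep_def)
  have cont: "continuous_on S F" for S by (rule smooth_continuous_on[OF F])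
  have crit: "grad F m = 0" by (rule grad_eq_0_at_min[OF F min])
  have sub: "sublevel ?N t = ?A (- t)" for t by (auto simp: sublevel_def)
  have levelE: "\<exists>C. 0 < C \<and> C < c \<and> (\<forall>x. grad F x = 0 \<longrightarrow> F x \<in> {-C<..<C})" if "minmax_level ?N c" for c
    using that unfolding minmax_level_def grad_minus[OF F] by (force simp: minus_less_iff)
  have level: "- c < F m" "F m < c" if "minmax_level ?N c" for c
    using levelE[OF that] crit by force+
  have UNIV: "?A (- c) = UNIV" if "minmax_level ?N c" for c
    using level(1)[OF that] min by (auto intro: order_trans less_imp_le)
  have push: "hom_induced p (top_of_set UNIV) (outside_ball m \<sigma>) (top_of_set UNIV) (outside_ball m r) id
    \<in> iso (relative_homology_group p (top_of_set UNIV) (outside_ball m \<sigma>))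
          (relative_homology_group p (top_of_set UNIV) (outside_ball m r))"
    if "0 < r" "r \<le> \<sigma>" for p r \<sigma>
  proof (rule push_out_iso[OF that])
    fix x :: 'a and l :: real assume "x \<in> outside_ball m r" "1 \<le> l"
    then have "1 * norm (x - m) \<le> l * norm (x - m)" by (intro mult_right_mono) auto
    then show "m + l *\<^sub>R (x - m) \<in> outside_ball m r" using \<open>x \<in> outside_ball m r\<close> \<open>1 \<le> l\<close> by simp
  qed (use that in auto)
  have key: "\<exists>\<sigma>0. \<forall>\<sigma>\<ge>\<sigma>0. outside_ball m \<sigma> \<subseteq> ?A c \<and>
      hom_induced p (top_of_set UNIV) (outside_ball m \<sigma>) (top_of_set UNIV) (?A c) id
      \<in> iso (relative_homology_group p (top_of_set UNIV) (outside_ball m \<sigma>))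
            (relative_homology_group p (top_of_set UNIV) (?A c))"
    if lev: "minmax_level ?N c" for c p
  proof -
    obtain C where C: "0 < C" "C < c" "\<And>x. grad F x = 0 \<Longrightarrow> F x \<in> {- C<..<C}"
      using levelE[OF lev] by blast
    obtain \<rho> where \<rho>: "\<rho> > 0" "\<And>x. \<rho> \<le> norm (x - m) \<Longrightarrow> 0 \<le> grad F x \<bullet> (x - m)"
      using steepE[OF st] by blast
    have inc: "F y \<le> F (m + l *\<^sub>R (y - m))" if "\<rho> \<le> norm (y - m)" "1 \<le> l" for y l
      by (rule radially_increasing[OF F _ that]) (rule \<rho>(2))
    have "bounded (F ` cball m \<rho>)"
      by (intro compact_imp_bounded compact_continuous_image cont compact_cball)
    then obtain b where "\<forall>x\<in>cball m \<rho>. \<bar>F x\<bar> \<le> b" by (auto simp: bounded_iff)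
    then have b: "F x \<le> b" if "norm (x - m) \<le> \<rho>" for x
      using that by (force simp: dist_norm norm_minus_commute)
    define c' where "c' = max (c + 1) (b + 1)"
    have c': "c < c'" "b < c'" by (auto simp: c'_def)
    have Ac': "?A c' \<subseteq> outside_ball m \<rho>"
    proof
      fix x assume "x \<in> ?A c'"
      then have "\<not> norm (x - m) \<le> \<rho>" using b[of x] c'(2) by auto
      then show "x \<in> outside_ball m \<rho>" by simp
    qed
    obtain R where R: "\<And>x. F x \<le> c' \<Longrightarrow> norm x \<le> R"
      using superlinear_bounded_sublevel[OF sl] by blast
    define \<sigma>0 where "\<sigma>0 = max \<rho> (R + norm m + 1)"
    have big: "outside_ball m \<sigma> \<subseteq> ?A c'" if \<sigma>: "\<sigma>0 \<le> \<sigma>" for \<sigma>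
    proof
      fix x assume x: "x \<in> outside_ball m \<sigma>"
      have "norm (x - m) \<le> norm x + norm m" by (rule norm_triangle_ineq4)
      then have "R < norm x" using x \<sigma> by (auto simp: \<sigma>0_def)
      then show "x \<in> ?A c'" using R[of x] by force
    qed
    have comp: "compact {x. C \<le> F x \<and> F x \<le> c' + 1}" by (rule compact_slab[OF cont sl])
    have reg: "\<forall>x\<in>{x. C \<le> F x \<and> F x \<le> c' + 1}. grad F x \<noteq> 0" using C(3) by force
    have lt: "C < c" "c' < c' + 1" using C(2) by auto
    obtain H where "uphill_homotopy F c c' H"
      using uphill_homotopy_exists[OF F comp reg lt] by blast
    then have H: "continuous_on ({0..1} \<times> UNIV) (\<lambda>(t, x). H t x)" "\<And>x. H 0 x = x"
      "\<And>t x. t \<in> {0..1} \<Longrightarrow> F x \<le> F (H t x)" "\<And>x. c \<le> F x \<Longrightarrow> c' \<le> F (H 1 x)"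
      unfolding uphill_homotopy_def by auto
    have i2: "hom_induced p (top_of_set UNIV) (?A c') (top_of_set UNIV) (?A c) id
      \<in> iso (relative_homology_group p (top_of_set UNIV) (?A c')) (relative_homology_group p (top_of_set UNIV) (?A c))"
    proof (rule pair_deformation_iso[where H=H])
      show "?A c' \<subseteq> ?A c" using c' by auto
      show "H t x \<in> ?A c" if "t \<in> {0..1}" "x \<in> ?A c" for t x
        using H(3)[OF that(1), of x] that(2) by simp
      show "H t x \<in> ?A c'" if "t \<in> {0..1}" "x \<in> ?A c'" for t x
        using H(3)[OF that(1), of x] that(2) by simp
    qed (use H(1,2,4) in auto)
    have "outside_ball m \<sigma> \<subseteq> ?A c \<and>
      hom_induced p (top_of_set UNIV) (outside_ball m \<sigma>) (top_of_set UNIV) (?A c) id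
      \<in> iso (relative_homology_group p (top_of_set UNIV) (outside_ball m \<sigma>))
            (relative_homology_group p (top_of_set UNIV) (?A c))" if \<sigma>: "\<sigma>0 \<le> \<sigma>" for \<sigma>
    proof
      show "outside_ball m \<sigma> \<subseteq> ?A c" using big[OF \<sigma>] c' by force
      have i1: "hom_induced p (top_of_set UNIV) (outside_ball m \<sigma>) (top_of_set UNIV) (?A c') id
        \<in> iso (relative_homology_group p (top_of_set UNIV) (outside_ball m \<sigma>))
              (relative_homology_group p (top_of_set UNIV) (?A c'))"
      proof (rule push_out_iso[OF \<rho>(1) _ big[OF \<sigma>] Ac'])
        show "\<rho> \<le> \<sigma>" using \<sigma> by (simp add: \<sigma>0_def)
        show "m + l *\<^sub>R (x - m) \<in> ?A c'" if "x \<in> ?A c'" "1 \<le> l" for x l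
          using inc[of x l] that Ac' by force
      qed
      have "hom_induced p (top_of_set UNIV) (outside_ball m \<sigma>) (top_of_set UNIV) (?A c) id
        = hom_induced p (top_of_set UNIV) (?A c') (top_of_set UNIV) (?A c) id
          \<circ> hom_induced p (top_of_set UNIV) (outside_ball m \<sigma>) (top_of_set UNIV) (?A c') id"
      proof
        fix x
        show "hom_induced p (top_of_set UNIV) (outside_ball m \<sigma>) (top_of_set UNIV) (?A c) id x
          = (hom_induced p (top_of_set UNIV) (?A c') (top_of_set UNIV) (?A c) id
            \<circ> hom_induced p (top_of_set UNIV) (outside_ball m \<sigma>) (top_of_set UNIV) (?A c') id) x"
          unfolding comp_apply
          using big[OF \<sigma>] c' by (intro hom_induced_inclusion_compose[symmetric]) auto
      qed
      then show "hom_induced p (top_of_set UNIV) (outside_ball m \<sigma>) (top_of_set UNIV) (?A c) id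
        \<in> iso (relative_homology_group p (top_of_set UNIV) (outside_ball m \<sigma>))
              (relative_homology_group p (top_of_set UNIV) (?A c))"
        using iso_set_trans[OF i1 i2] by simp
    qed
    then show ?thesis by blast
  qed
  have cong: "\<exists>\<sigma>>0. relative_homology_group p (top_of_set UNIV) (?A c)
      \<cong> relative_homology_group p euclidean (outside_ball m \<sigma>)" if lev: "minmax_level ?N c" for c p
  proof -
    obtain \<sigma>0 where "\<And>\<sigma>. \<sigma>0 \<le> \<sigma> \<Longrightarrow> hom_induced p (top_of_set UNIV) (outside_ball m \<sigma>) (top_of_set UNIV) (?A c) id
      \<in> iso (relative_homology_group p (top_of_set UNIV) (outside_ball m \<sigma>))
            (relative_homology_group p (top_of_set UNIV) (?A c))"
      using key[OF lev] by blast
    from is_isoI[OF this[of "max \<sigma>0 1"]] show ?thesis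
      by (intro exI[of _ "max \<sigma>0 1"]) (simp add: relative_homology_iso_sym)
  qed
  show ?thesis
  proof (rule is_minmaxI[where \<iota>="DIM('a)"])
    show "smooth ?N" by (rule smooth_minus[OF F])
    show "proper_map euclidean euclidean (grad ?N)" by (rule steep_proper_grad(2)[OF st])
    fix c assume lev: "minmax_level ?N c"
    note simps = sub minus_minus UNIV[OF lev]
    show "- c \<le> - F m \<and> - F m \<le> c" using level[OF lev] by simp
    show "relative_homology_group (int DIM('a)) (top_of_set (sublevel ?N c)) (sublevel ?N (- c)) \<cong> integer_group"
      unfolding simps using cong[OF lev] homology_outside_ball(1) iso_trans by blast
    show "trivial_group (relative_homology_group p (top_of_set (sublevel ?N c)) (sublevel ?N (- c)))"
      if "p \<noteq> int DIM('a)" for p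
      unfolding simps
      using cong[OF lev, of p] homology_outside_ball(2)[OF _ that] relative_homology_iso_sym
        relative_homology_trivial_cong by metis
    {
      fix t assume "- F m \<le> t"
      then have "- t \<le> F x" for x using min[of x] by linarith
      then have t: "?A (- t) = UNIV" by blast
      show "carrier (relative_homology_group (int DIM('a)) (top_of_set (sublevel ?N c)) (sublevel ?N (- c)))
        \<subseteq> hom_induced (int DIM('a)) (top_of_set (sublevel ?N t)) (sublevel ?N (- c))
            (top_of_set (sublevel ?N c)) (sublevel ?N (- c)) id
          ` carrier (relative_homology_group (int DIM('a)) (top_of_set (sublevel ?N t)) (sublevel ?N (- c)))"
        unfolding simps t
      proof
        fix x assume x: "x \<in> carrier (relative_homology_group (int DIM('a)) (top_of_set UNIV) (?A c))"
        show "x \<in> hom_induced (int DIM('a)) (top_of_set UNIV) (?A c) (top_of_set UNIV) (?A c) id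
          ` carrier (relative_homology_group (int DIM('a)) (top_of_set UNIV) (?A c))"
          by (rule image_eqI[where x=x]) (simp_all only: hom_induced_id[OF x] x)
      qed
    }
    fix t x
    let ?p = "int DIM('a)"
    assume t: "- c \<le> t" "t < - F m"
      and x: "x \<in> carrier (relative_homology_group ?p (top_of_set (sublevel ?N t)) (sublevel ?N (- c)))"
    have "open {x. F x < - t}" by (rule open_Collect_less[OF cont continuous_on_const])
    moreover have "m \<in> {x. F x < - t}" using t by simp
    ultimately obtain r where r: "r > 0" "ball m r \<subseteq> {x. F x < - t}" by (meson open_contains_ball)
    have At: "?A (- t) \<subseteq> outside_ball m r"
    proof
      fix z assume "z \<in> ?A (- t)"
      then have "z \<notin> ball m r" using r(2) by auto
      then show "z \<in> outside_ball m r" by (simp add: dist_norm norm_minus_commute)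
    qed
    have Ac: "?A c \<subseteq> ?A (- t)" using t by auto
    obtain \<sigma>0 where \<sigma>0: "\<And>\<sigma>. \<sigma>0 \<le> \<sigma> \<Longrightarrow> outside_ball m \<sigma> \<subseteq> ?A c"
      "\<And>\<sigma>. \<sigma>0 \<le> \<sigma> \<Longrightarrow> hom_induced ?p (top_of_set UNIV) (outside_ball m \<sigma>) (top_of_set UNIV) (?A c) id
      \<in> iso (relative_homology_group ?p (top_of_set UNIV) (outside_ball m \<sigma>))
            (relative_homology_group ?p (top_of_set UNIV) (?A c))"
      using key[OF lev, of ?p] by blast
    define \<sigma> where "\<sigma> = max \<sigma>0 r"
    note out = \<sigma>0[of \<sigma>, OF max.cobounded1[of \<sigma>0 r, folded \<sigma>_def]]
    have i3: "hom_induced ?p (top_of_set UNIV) (outside_ball m \<sigma>) (top_of_set UNIV) (outside_ball m r) id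
    \<in> iso (relative_homology_group ?p (top_of_set UNIV) (outside_ball m \<sigma>))
          (relative_homology_group ?p (top_of_set UNIV) (outside_ball m r))"
      by (rule push[OF r(1)]) (simp add: \<sigma>_def)
    let ?i = "hom_induced ?p (top_of_set (?A (- t))) (?A c) (top_of_set UNIV) (?A c) id"
    let ?k = "hom_induced ?p (top_of_set UNIV) (?A c) (top_of_set UNIV) (outside_ball m r) id"
    have x': "x \<in> carrier (relative_homology_group ?p (top_of_set (?A (- t))) (?A c))"
      using x by (simp only: simps)
    have "?k (?i x) = hom_induced ?p (top_of_set (?A (- t))) (?A c) (top_of_set UNIV) (outside_ball m r) id x"
      using At Ac by (intro hom_induced_inclusion_compose) auto
    also have "\<dots> = hom_induced ?p (top_of_set (outside_ball m r)) (outside_ball m r) (top_of_set UNIV) (outside_ball m r) id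
        (hom_induced ?p (top_of_set (?A (- t))) (?A c) (top_of_set (outside_ball m r)) (outside_ball m r) id x)"
      using At Ac by (intro hom_induced_inclusion_compose[symmetric]) auto
    also have "\<dots> = \<one>\<^bsub>relative_homology_group ?p (top_of_set UNIV) (outside_ball m r)\<^esub>"
      using trivial_relative_homology_group_topspace[of ?p "top_of_set (outside_ball m r)"]
      by (intro hom_induced_trivial_source hom_induced_carrier) simp
    finally have k: "?k (?i x) = \<one>\<^bsub>relative_homology_group ?p (top_of_set UNIV) (outside_ball m r)\<^esub>" .
    obtain y where y: "y \<in> carrier (relative_homology_group ?p (top_of_set UNIV) (outside_ball m \<sigma>))"
      "?i x = hom_induced ?p (top_of_set UNIV) (outside_ball m \<sigma>) (top_of_set UNIV) (?A c) id y"
      using iso_surjE[OF out(2) hom_induced_carrier] by metis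
    have "hom_induced ?p (top_of_set UNIV) (outside_ball m \<sigma>) (top_of_set UNIV) (outside_ball m r) id y = ?k (?i x)"
      unfolding y(2) using out(1) At Ac by (intro hom_induced_inclusion_compose[symmetric]) auto
    also have "\<dots> = hom_induced ?p (top_of_set UNIV) (outside_ball m \<sigma>) (top_of_set UNIV) (outside_ball m r) id
        \<one>\<^bsub>relative_homology_group ?p (top_of_set UNIV) (outside_ball m \<sigma>)\<^esub>"
      unfolding k hom_induced_one ..
    finally have "y = \<one>\<^bsub>relative_homology_group ?p (top_of_set UNIV) (outside_ball m \<sigma>)\<^esub>"
      by (rule iso_inj[OF i3 y(1) monoid.one_closed[OF group.is_monoid[OF group_relative_homology_group]]])
    then have "?i x = \<one>\<^bsub>relative_homology_group ?p (top_of_set UNIV) (?A c)\<^esub>"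
      unfolding y(2) by (simp only: hom_induced_one)
    then show "hom_induced ?p (top_of_set (sublevel ?N t)) (sublevel ?N (- c))
            (top_of_set (sublevel ?N c)) (sublevel ?N (- c)) id x
        = \<one>\<^bsub>relative_homology_group ?p (top_of_set (sublevel ?N c)) (sublevel ?N (- c))\<^esub>"
      by (simp only: simps)
  qed simp
qed

section \<open>The critical value of a hyperbolic quadratic form as a min-max value\<close>

text \<open>In the coordinates \<open>(a, b)\<close> shrinking \<open>a\<close> and stretching \<open>b\<close> both lower \<open>\<Phi>\<close>. Above the critical level
  the first reduces every pair to the space of the \<open>b\<close> modulo the exterior of a ball. Below it \<open>b\<close> never
  vanishes, and both together deform the sublevel set into the bottom one.\<close>

lemma is_minmax_saddle:
  fixes \<Phi> :: "'a::euclidean_space \<times> 'a \<Rightarrow> real" and \<theta> \<theta>' :: "'a \<times> 'a \<Rightarrow> 'a \<times> 'a"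
  assumes \<Phi>: "smooth \<Phi>" "proper_map euclidean euclidean (grad \<Phi>)"
    and cont: "continuous_on UNIV \<theta>" "continuous_on UNIV \<theta>'"
    and inv: "\<And>z. \<theta> (\<theta>' z) = z" "\<And>y. \<theta>' (\<theta> y) = y"
    and quad: "\<And>a b. \<Phi> (\<theta> (a, b)) = s + (norm a)\<^sup>2 - (norm b)\<^sup>2"
    and crit: "\<exists>z. grad \<Phi> z = 0 \<and> \<Phi> z = s"
  shows "is_minmax \<Phi> s"
proof (rule is_minmaxI[where \<iota>="DIM('a)", OF \<Phi>])
  show "DIM('a) \<le> DIM('a \<times> 'a)" by simp
  fix c assume "minmax_level \<Phi> c"
  then have c: "- c < s" "s < c" using crit unfolding minmax_level_def by force+
  then show "- c \<le> s \<and> s \<le> c" by simp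
  define S where "S = sublevel \<Phi> (- c)"
  define \<rho> where "\<rho> = sqrt (s + c)"
  define A where "A z = fst (\<theta>' z)" for z
  define B where "B z = snd (\<theta>' z)" for z
  have \<rho>: "\<rho> > 0" "\<rho>\<^sup>2 = s + c" using c by (auto simp: \<rho>_def)
  have \<theta>AB: "\<theta> (A z, B z) = z" for z by (simp add: A_def B_def inv)
  have A\<theta>: "A (\<theta> (a, b)) = a" and B\<theta>: "B (\<theta> (a, b)) = b" for a b by (simp_all add: A_def B_def inv)
  have \<Phi>AB: "\<Phi> z = s + (norm (A z))\<^sup>2 - (norm (B z))\<^sup>2" for z using quad[of "A z" "B z"] by (simp add: \<theta>AB)
  have contA: "continuous_on X A" and contB: "continuous_on X B" for X
    unfolding A_def B_def by (intro continuous_intros continuous_on_subset[OF cont(2)]; simp)+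
  have sub: "z \<in> sublevel \<Phi> t \<longleftrightarrow> (norm (A z))\<^sup>2 - (norm (B z))\<^sup>2 \<le> t - s" for z t
    by (auto simp: sublevel_def \<Phi>AB)
  have S: "z \<in> S \<longleftrightarrow> (norm (A z))\<^sup>2 + \<rho>\<^sup>2 \<le> (norm (B z))\<^sup>2" for z
    unfolding S_def sub using \<rho>(2) by auto
  have mono: "z' \<in> sublevel \<Phi> t" if "z \<in> sublevel \<Phi> t" "norm (A z') \<le> norm (A z)" "norm (B z) \<le> norm (B z')" for z z' t
  proof -
    have "(norm (A z'))\<^sup>2 \<le> (norm (A z))\<^sup>2" "(norm (B z))\<^sup>2 \<le> (norm (B z'))\<^sup>2"
      using that(2,3) by (auto intro: power_mono)
    then show ?thesis using that(1) unfolding sub by linarith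
  qed
  have cont0: "continuous_map (top_of_set UNIV) (top_of_set (sublevel \<Phi> t)) (\<lambda>b. \<theta> (0, b))"
    if "s \<le> t" for t
  proof -
    have "\<theta> (0, b) \<in> sublevel \<Phi> t" for b
    proof -
      have "(norm (0::'a))\<^sup>2 - (norm b)\<^sup>2 \<le> 0" by simp
      also have "0 \<le> t - s" using that by simp
      finally show ?thesis unfolding sub A\<theta> B\<theta> .
    qed
    moreover have "continuous_on UNIV (\<lambda>b. \<theta> (0, b))"
      by (intro continuous_on_compose2[OF cont(1)] continuous_intros) auto
    ultimately show ?thesis by (simp only: continuous_map_subtopology_eu) auto
  qed
  have S0: "(\<lambda>b. \<theta> (0, b)) \<in> outside_ball 0 \<rho> \<rightarrow> S"
    using \<rho>(1) by (auto simp: S A\<theta> B\<theta> intro!: power_mono)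
  \<comment> \<open>Collapsing the positive directions identifies every pair above the critical level with the
    negative directions.\<close>
  have core: "hom_induced p (top_of_set UNIV) (outside_ball 0 \<rho>) (top_of_set (sublevel \<Phi> t)) S (\<lambda>b. \<theta> (0, b))
      \<in> iso (relative_homology_group p (top_of_set UNIV) (outside_ball (0::'a) \<rho>))
            (relative_homology_group p (top_of_set (sublevel \<Phi> t)) S)" if t: "s \<le> t" for p t
  proof (rule homotopy_equivalence_relative_homology_group_isomorphism[where g=B])
    show "continuous_map (top_of_set UNIV) (top_of_set (sublevel \<Phi> t)) (\<lambda>b. \<theta> (0, b))"
      by (rule cont0[OF t])
    show "(\<lambda>b. \<theta> (0, b)) \<in> outside_ball 0 \<rho> \<rightarrow> S" by (rule S0)
    show "continuous_map (top_of_set (sublevel \<Phi> t)) (top_of_set UNIV) B"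
      by (simp add: contB)
    show "B \<in> S \<rightarrow> outside_ball 0 \<rho>"
    proof
      fix z assume "z \<in> S"
      then have "\<rho>\<^sup>2 \<le> (norm (B z))\<^sup>2" unfolding S using zero_le_power2[of "norm (A z)"] by linarith
      then show "B z \<in> outside_ball 0 \<rho>" using power2_le_imp_le[of \<rho> "norm (B z)"] by simp
    qed
    have "B \<circ> (\<lambda>b. \<theta> (0, b)) = id" by (auto simp: B\<theta>)
    then show "homotopic_with (\<lambda>h. h \<in> outside_ball 0 \<rho> \<rightarrow> outside_ball 0 \<rho>) (top_of_set UNIV) (top_of_set UNIV)
        (B \<circ> (\<lambda>b. \<theta> (0, b))) id" by simp
    define H where "H \<tau> z = \<theta> ((1 - \<tau>) *\<^sub>R A z, B z)" for \<tau> z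
    have H: "H \<tau> z \<in> sublevel \<Phi> t'" if "\<tau> \<in> {0..1}" "z \<in> sublevel \<Phi> t'" for \<tau> z t'
      by (rule mono[OF that(2)]) (use that(1) in \<open>auto simp: H_def A\<theta> B\<theta> intro: mult_left_le_one_le\<close>)
    have "homotopic_with (\<lambda>k. k \<in> S \<rightarrow> S) (top_of_set (sublevel \<Phi> t)) (top_of_set (sublevel \<Phi> t)) (H 0) (H 1)"
    proof (rule homotopic_with_top_of_setI)
      show "continuous_on ({0..1} \<times> sublevel \<Phi> t) (\<lambda>(t, x). H t x)"
        unfolding H_def case_prod_unfold
        by (intro continuous_intros continuous_on_compose2[OF cont(1)] continuous_on_compose2[OF contA[of UNIV]]
            continuous_on_compose2[OF contB[of UNIV]]) auto
    qed (use H in \<open>auto simp: S_def\<close>)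
    moreover have "H 0 = id" "H 1 = (\<lambda>b. \<theta> (0, b)) \<circ> B" by (auto simp: H_def \<theta>AB)
    ultimately show "homotopic_with (\<lambda>k. k \<in> S \<rightarrow> S) (top_of_set (sublevel \<Phi> t)) (top_of_set (sublevel \<Phi> t))
        ((\<lambda>b. \<theta> (0, b)) \<circ> B) id" by (simp add: homotopic_with_sym)
  qed
  have cong: "relative_homology_group p (top_of_set (sublevel \<Phi> c)) (sublevel \<Phi> (- c))
      \<cong> relative_homology_group p euclidean (outside_ball (0::'a) \<rho>)" for p
    using relative_homology_iso_sym[OF is_isoI[OF core[of c p]]] c by (simp add: S_def)
  show "relative_homology_group (int DIM('a)) (top_of_set (sublevel \<Phi> c)) (sublevel \<Phi> (- c)) \<cong> integer_group"
    using iso_trans[OF cong homology_outside_ball(1)[OF \<rho>(1)]] .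
  show "trivial_group (relative_homology_group p (top_of_set (sublevel \<Phi> c)) (sublevel \<Phi> (- c)))"
    if "p \<noteq> int DIM('a)" for p
    by (rule relative_homology_trivial_cong[OF relative_homology_iso_sym[OF cong]
          homology_outside_ball(2)[OF \<rho>(1) that]])
  {
    fix t assume t: "s \<le> t" "t \<le> c"
    let ?p = "int DIM('a)"
    have sub_tc: "sublevel \<Phi> t \<subseteq> sublevel \<Phi> c" using t by (auto simp: sublevel_def)
    show "carrier (relative_homology_group ?p (top_of_set (sublevel \<Phi> c)) (sublevel \<Phi> (- c)))
      \<subseteq> hom_induced ?p (top_of_set (sublevel \<Phi> t)) (sublevel \<Phi> (- c))
            (top_of_set (sublevel \<Phi> c)) (sublevel \<Phi> (- c)) id
          ` carrier (relative_homology_group ?p (top_of_set (sublevel \<Phi> t)) (sublevel \<Phi> (- c)))"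
      unfolding S_def[symmetric]
    proof
      fix y assume "y \<in> carrier (relative_homology_group ?p (top_of_set (sublevel \<Phi> c)) S)"
      then obtain x where "y = hom_induced ?p (top_of_set UNIV) (outside_ball 0 \<rho>)
          (top_of_set (sublevel \<Phi> c)) S (\<lambda>b. \<theta> (0, b)) x"
        using iso_surjE[OF core[of c ?p]] c by (metis less_imp_le)
      also have "\<dots> = hom_induced ?p (top_of_set (sublevel \<Phi> t)) S (top_of_set (sublevel \<Phi> c)) S id
          (hom_induced ?p (top_of_set UNIV) (outside_ball 0 \<rho>) (top_of_set (sublevel \<Phi> t)) S (\<lambda>b. \<theta> (0, b)) x)"
      proof (subst hom_induced_compose')
        show "continuous_map (top_of_set UNIV) (top_of_set (sublevel \<Phi> t)) (\<lambda>b. \<theta> (0, b))"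
          by (rule cont0[OF t(1)])
        show "(\<lambda>b. \<theta> (0, b)) \<in> outside_ball 0 \<rho> \<rightarrow> S" by (rule S0)
      qed (use sub_tc in auto)
      finally show "y \<in> hom_induced ?p (top_of_set (sublevel \<Phi> t)) S (top_of_set (sublevel \<Phi> c)) S id
          ` carrier (relative_homology_group ?p (top_of_set (sublevel \<Phi> t)) S)"
        using hom_induced_carrier by blast
    qed
  }
  fix t x
  let ?p = "int DIM('a)"
  assume t: "- c \<le> t" "t < s"
    and x: "x \<in> carrier (relative_homology_group ?p (top_of_set (sublevel \<Phi> t)) (sublevel \<Phi> (- c)))"
  \<comment> \<open>Below the critical level the negative component cannot vanish, and stretching it deforms the
    sublevel set into the bottom one.\<close>
  define k where "k z = max 1 (\<rho> / norm (B z))" for z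
  have B0: "norm (B z) > 0" if "z \<in> sublevel \<Phi> t" for z
  proof (rule ccontr)
    assume "\<not> norm (B z) > 0"
    then have "(norm (A z))\<^sup>2 \<le> t - s" using that by (simp add: sub)
    then show False using t(2) zero_le_power2[of "norm (A z)"] by linarith
  qed
  define H where "H \<tau> z = \<theta> ((1 - \<tau>) *\<^sub>R A z, ((1 - \<tau>) + \<tau> * k z) *\<^sub>R B z)" for \<tau> z
  have Sub: "S \<subseteq> sublevel \<Phi> t" using t(1) by (auto simp: S_def sublevel_def)
  have contk: "continuous_on (sublevel \<Phi> t) k"
    unfolding k_def using B0 by (intro continuous_intros contB) force
  have H: "H \<tau> z \<in> sublevel \<Phi> t'" if \<tau>: "\<tau> \<in> {0..1}" and z: "z \<in> sublevel \<Phi> t'" for \<tau> z t'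
  proof (rule mono[OF z])
    show "norm (A (H \<tau> z)) \<le> norm (A z)"
      using \<tau> by (auto simp: H_def A\<theta> intro: mult_left_le_one_le)
    have "\<tau> * 1 \<le> \<tau> * k z" using \<tau> by (intro mult_left_mono) (auto simp: k_def)
    then have "1 * norm (B z) \<le> \<bar>(1 - \<tau>) + \<tau> * k z\<bar> * norm (B z)" by (intro mult_right_mono) auto
    then show "norm (B z) \<le> norm (B (H \<tau> z))" by (simp add: H_def B\<theta>)
  qed
  have HS: "H \<tau> z \<in> S" if "\<tau> \<in> {0..1}" "z \<in> S" for \<tau> z
    using H[OF that(1)] that(2) unfolding S_def .
  have end1: "H 1 z \<in> S" if "z \<in> sublevel \<Phi> t" for z
  proof -
    have "\<rho> / norm (B z) \<le> k z" by (simp add: k_def)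
    then have "\<rho> \<le> k z * norm (B z)" using B0[OF that] by (simp add: pos_divide_le_eq)
    also have "\<dots> \<le> norm (B (H 1 z))" by (simp add: H_def B\<theta> mult_right_mono)
    finally have "\<rho>\<^sup>2 \<le> (norm (B (H 1 z)))\<^sup>2" using \<rho>(1) by (intro power_mono) auto
    then show ?thesis by (simp add: S) (simp add: H_def A\<theta>)
  qed
  have "hom_induced ?p (top_of_set S) S (top_of_set (sublevel \<Phi> t)) S id
    \<in> iso (relative_homology_group ?p (top_of_set S) S) (relative_homology_group ?p (top_of_set (sublevel \<Phi> t)) S)"
  proof (rule pair_deformation_iso[where H=H])
    show "continuous_on ({0..1} \<times> sublevel \<Phi> t) (\<lambda>(t, x). H t x)"
      unfolding H_def case_prod_unfold
      by (intro continuous_intros continuous_on_compose2[OF cont(1)] continuous_on_compose2[OF contA[of UNIV]]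
          continuous_on_compose2[OF contB[of UNIV]] continuous_on_compose2[OF contk]) auto
    show "H 0 z = z" for z by (simp add: H_def \<theta>AB)
  qed (use Sub end1 H HS in auto)
  then have "relative_homology_group ?p (top_of_set S) S \<cong> relative_homology_group ?p (top_of_set (sublevel \<Phi> t)) S"
    by (rule is_isoI)
  moreover have "trivial_group (relative_homology_group ?p (top_of_set S) S)"
    using trivial_relative_homology_group_topspace[of ?p "top_of_set S"] by simp
  ultimately have "trivial_group (relative_homology_group ?p (top_of_set (sublevel \<Phi> t)) S)"
    by (rule relative_homology_trivial_cong)
  then show "hom_induced ?p (top_of_set (sublevel \<Phi> t)) (sublevel \<Phi> (- c))
            (top_of_set (sublevel \<Phi> c)) (sublevel \<Phi> (- c)) id x
        = \<one>\<^bsub>relative_homology_group ?p (top_of_set (sublevel \<Phi> c)) (sublevel \<Phi> (- c))\<^esub>"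
    using x unfolding S_def by (rule hom_induced_trivial_source)
qed

section \<open>The generating function of the double transform\<close>

text \<open>The remainder of the first-order expansion is of order \<open>o(norm u)\<close>, so the quotient tends to zero at
  the origin, where division by zero gives it the value zero.\<close>

lemma continuous_first_order_remainder:
  fixes f :: "'a::euclidean_space \<Rightarrow> real"
  assumes f: "smooth f"
  shows "continuous_on UNIV (\<lambda>u. ((f (q - u) - f q + grad f q \<bullet> u) / (norm u)\<^sup>2) *\<^sub>R u)"
    (is "continuous_on UNIV ?r")
proof (rule continuous_at_imp_continuous_on, rule ballI)
  fix u :: 'a
  show "isCont ?r u"
  proof (cases "u = 0")
    case False
    have "continuous_on (- {0}) ?r"
      by (intro continuous_intros continuous_on_compose2[OF smooth_continuous_on[OF f, of UNIV]]) auto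
    then show ?thesis using False continuous_on_eq_continuous_at[of "- {0}" ?r] by (simp add: open_Compl)
  next
    case True
    have "((\<lambda>u. f (q - u)) has_derivative (\<lambda>h. grad (\<lambda>u. f (q - u)) 0 \<bullet> h)) (at 0)"
      by (intro smooth_has_derivative_grad smooth_compose[OF f] smooth_diff smooth_const smooth_ident)
    then have "((\<lambda>u. f (q - u)) has_derivative (\<lambda>h. - (grad f q \<bullet> h))) (at 0)"
      by (simp add: grad_reflect[OF f])
    then have "((\<lambda>u. norm (f (q - u) - f q + grad f q \<bullet> u) / norm u) \<longlongrightarrow> 0) (at 0)"
      by (simp add: has_derivative_at)
    moreover have "(\<lambda>u. norm (?r u)) = (\<lambda>u. norm (f (q - u) - f q + grad f q \<bullet> u) / norm u)"
    proof
      fix u show "norm (?r u) = norm (f (q - u) - f q + grad f q \<bullet> u) / norm u"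
        by (cases "u = 0") (auto simp: power2_eq_square)
    qed
    ultimately have "((\<lambda>u. norm (?r u)) \<longlongrightarrow> 0) (at 0)" by (simp only:)
    then have "(?r \<longlongrightarrow> 0) (at 0)" by (rule tendsto_norm_zero_cancel)
    then show ?thesis using True by (simp add: isCont_def)
  qed
qed

lemma grad_Pair_eqI:
  assumes "(f has_derivative (\<lambda>h. a \<bullet> fst h + b \<bullet> snd h)) (at x)"
  shows "grad f x = (a, b)"
  by (rule grad_eqI) (use assms in \<open>simp add: inner_prod_def\<close>)

lemma smooth_saddle:
  assumes f: "smooth f" shows "smooth (\<lambda>(v, w). q \<bullet> v - (v \<bullet> w - f w))"
  unfolding case_prod_unfold
  by (intro smooth_diff smooth_inner smooth_const smooth_compose[OF f] smooth_fst smooth_snd)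

lemma grad_saddle:
  assumes f: "smooth f"
  shows "grad (\<lambda>(v, w). q \<bullet> v - (v \<bullet> w - f w)) = (\<lambda>(v, w). (q - w, grad f w - v))"
proof
  fix z :: "'a \<times> 'a"
  have fw: "((\<lambda>z. f (snd z)) has_derivative (\<lambda>h. grad f (snd z) \<bullet> snd h)) (at z)"
    using diff_chain_at[OF has_derivative_snd[OF has_derivative_ident] smooth_has_derivative_grad[OF f]]
    by (simp add: o_def)
  have "((\<lambda>z. q \<bullet> fst z - (fst z \<bullet> snd z - f (snd z))) has_derivative
      (\<lambda>h. q \<bullet> fst h - ((fst z \<bullet> snd h + fst h \<bullet> snd z) - grad f (snd z) \<bullet> snd h))) (at z)"
    by (intro has_derivative_diff has_derivative_inner has_derivative_inner_right fw
        has_derivative_fst has_derivative_snd has_derivative_ident)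
  then have "grad (\<lambda>z. q \<bullet> fst z - (fst z \<bullet> snd z - f (snd z))) z = (q - snd z, grad f (snd z) - fst z)"
    by (intro grad_Pair_eqI) (simp add: inner_diff_left inner_commute algebra_simps)
  then show "grad (\<lambda>(v, w). q \<bullet> v - (v \<bullet> w - f w)) z = (case z of (v, w) \<Rightarrow> (q - w, grad f w - v))"
    by (simp add: case_prod_unfold)
qed

lemma diffeomorphismI:
  assumes "smooth \<phi>" "smooth \<psi>" "\<And>x. \<psi> (\<phi> x) = x" "\<And>y. \<phi> (\<psi> y) = y"
  shows "diffeomorphism \<phi>"
proof -
  have "inv_into UNIV \<phi> = \<psi>" by (rule inv_unique_comp) (auto simp: assms)
  moreover have "bij \<phi>" by (rule o_bij[of \<psi>]) (auto simp: assms)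
  ultimately show ?thesis using assms by (simp add: diffeomorphism_def)
qed

lemma simple_saddle:
  assumes f: "smooth f" shows "simple (\<lambda>(v, w). q \<bullet> v - (v \<bullet> w - f w))"
  unfolding simple_def grad_saddle[OF f]
proof
  show "diffeomorphism (\<lambda>(v, w). (q - w, grad f w - v))"
    by (rule diffeomorphismI[where \<psi>="\<lambda>y. (grad f (q - fst y) - snd y, q - fst y)"])
      (auto simp: case_prod_unfold intro!: smooth_Pair smooth_diff smooth_const smooth_fst smooth_snd
        smooth_compose[OF smooth_grad[OF f]])
qed (rule smooth_saddle[OF f])

lemma simple_proper_grad:
  assumes "simple g" shows "proper_map euclidean euclidean (grad g)"
proof -
  let ?\<psi> = "inv_into UNIV (grad g)"
  have bij: "bij (grad g)" and "smooth (grad g)" "smooth ?\<psi>"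
    using assms by (auto simp: simple_def diffeomorphism_def)
  then have "homeomorphic_maps euclidean euclidean (grad g) ?\<psi>"
    by (auto simp: homeomorphic_maps_def smooth_continuous_on bij_is_inj bij_is_surj surj_f_inv_f)
  then show ?thesis
    using homeomorphic_imp_proper_map homeomorphic_maps_map by blast
qed

text \<open>Writing \<open>w = q - u\<close> and \<open>f (q - u) = f q + u \<bullet> m u\<close> with \<open>m\<close> continuous, the function
  \<open>q \<bullet> v - v \<bullet> w + f w\<close> becomes \<open>f q + u \<bullet> (v + m u)\<close>, a hyperbolic quadratic form in the coordinates
  \<open>u\<close> and \<open>v + m u\<close>.\<close>

lemma is_minmax_double_transform:
  fixes f :: "'a::euclidean_space \<Rightarrow> real"
  assumes f: "smooth f"
  shows "is_minmax (\<lambda>(v, w). q \<bullet> v - (v \<bullet> w - f w)) (f q)"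
proof -
  let ?\<Phi> = "\<lambda>(v, w). q \<bullet> v - (v \<bullet> w - f w)"
  \<comment> \<open>The radial difference quotient alone would be discontinuous at 0; subtracting the linear part
    first cures this.\<close>
  define m where "m u = ((f (q - u) - f q + grad f q \<bullet> u) / (norm u)\<^sup>2) *\<^sub>R u - grad f q" for u
  have contm: "continuous_on UNIV m"
    unfolding m_def by (intro continuous_intros continuous_first_order_remainder[OF f])
  have m: "u \<bullet> m u = f (q - u) - f q" for u
    by (cases "u = 0") (auto simp: m_def inner_diff_right dot_square_norm inner_commute)
  define \<theta> where "\<theta> y = (fst y - snd y - m (fst y + snd y), q - (fst y + snd y))" for y
  define \<theta>' where "\<theta>' z = ((1/2) *\<^sub>R ((q - snd z) + (fst z + m (q - snd z))),
      (1/2) *\<^sub>R ((q - snd z) - (fst z + m (q - snd z))))" for z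
  show ?thesis
  proof (rule is_minmax_saddle)
    show "smooth ?\<Phi>" by (rule smooth_saddle[OF f])
    show "proper_map euclidean euclidean (grad ?\<Phi>)" by (rule simple_proper_grad[OF simple_saddle[OF f]])
    show "continuous_on UNIV \<theta>" unfolding \<theta>_def
      by (intro continuous_intros continuous_on_compose2[OF contm]) auto
    show "continuous_on UNIV \<theta>'" unfolding \<theta>'_def
      by (intro continuous_intros continuous_on_compose2[OF contm]) auto
    have sum: "fst (\<theta>' z) + snd (\<theta>' z) = q - snd z" "fst (\<theta>' z) - snd (\<theta>' z) = fst z + m (q - snd z)" for z
      by (simp_all add: \<theta>'_def flip: scaleR_add_right scaleR_diff_right) (simp add: algebra_simps flip: scaleR_2)+
    show "\<theta> (\<theta>' z) = z" for z unfolding \<theta>_def sum by simp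
    have half: "(1/2) *\<^sub>R ((a + b) + (a - b)) = a" "(1/2) *\<^sub>R ((a + b) - (a - b)) = b" for a b :: 'a
      by (simp_all flip: scaleR_2)
    show "\<theta>' (\<theta> y) = y" for y
    proof -
      have *: "q - snd (\<theta> y) = fst y + snd y" "fst (\<theta> y) + m (fst y + snd y) = fst y - snd y"
        by (simp_all add: \<theta>_def)
      show ?thesis unfolding \<theta>'_def * half by simp
    qed
    show "?\<Phi> (\<theta> (a, b)) = f q + (norm a)\<^sup>2 - (norm b)\<^sup>2" for a b
    proof -
      let ?u = "a + b"
      have "?\<Phi> (\<theta> (a, b)) = (a - b - m ?u) \<bullet> ?u + f (q - ?u)"
        using inner_diff_right[of "a - b - m ?u" q ?u] inner_commute[of q "a - b - m ?u"]
        by (simp add: \<theta>_def del: inner_diff_left inner_diff_right)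
      also have "\<dots> = (a - b) \<bullet> ?u + f q" 
        using m[of ?u] inner_diff_left[of "a - b" "m ?u" ?u] inner_commute[of "m ?u" ?u] by linarith
      also have "(a - b) \<bullet> ?u = (norm a)\<^sup>2 - (norm b)\<^sup>2"
        by (simp add: power2_norm_eq_inner algebra_simps inner_commute)
      finally show ?thesis by simp
    qed
    show "\<exists>z. grad ?\<Phi> z = 0 \<and> ?\<Phi> z = f q"
      by (intro exI[of _ "(grad f q, q)"]) (simp add: grad_saddle[OF f] zero_prod_def, simp add: inner_commute)
  qed
qed

section \<open>Selectors\<close>

lemma almost_convexE:
  assumes "almost_convex f"
  obtains g h K where "f = (\<lambda>x. g x + h x)" "simple g" "elliptic g" "smooth h" "\<And>x. norm (grad h x) \<le> K"
proof -
  obtain g h where *: "f = (\<lambda>x. g x + h x)" "simple g" "smooth h" "bounded (range (grad h))" "simple_index g = 0"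
    using assms unfolding almost_convex_def almost_simple_of_index_def by blast
  moreover obtain K where "\<And>x. norm (grad h x) \<le> K" using *(4) by (auto simp: bounded_iff)
  ultimately show thesis using that elliptic_of_simple by blast
qed

lemma has_selectorI:
  assumes "almost_simple_gf F" "\<And>q. is_minmax (F q) (s q)"
  shows "has_selector F" "selector F q = s q"
  using assms minmax_eq by (auto simp: has_selector_def has_minmax_def selector_def)

lemma almost_simple_gfI:
  assumes "F = (\<lambda>q w. G q w + H q w)" "smooth (\<lambda>(q, w). G q w)" "smooth (\<lambda>(q, w). H q w)"
    "\<And>q. simple (G q)" "\<And>q w. norm (grad (H q) w) \<le> K"
  shows "almost_simple_gf F"
  unfolding almost_simple_gf_def
  by (intro exI[of _ G] exI[of _ H] exI[of _ "\<lambda>_. K"]) (use assms in \<open>auto simp: bounded_iff\<close>)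

proposition selector_transform:
  fixes f :: "real ^ 'n \<Rightarrow> real"
  assumes "almost_convex f"
  shows "has_selector (gf_T0 f)" "ereal (selector (gf_T0 f) q) = fenchel f q"
proof -
  obtain g h K where f: "f = (\<lambda>x. g x + h x)" and g: "simple g" "elliptic g"
    and h: "smooth h" "\<And>x. norm (grad h x) \<le> K"
    using almost_convexE[OF assms] by blast
  have sg: "smooth g" using g by (simp add: simple_def)
  have asgf: "almost_simple_gf (gf_T0 f)"
  proof (rule almost_simple_gfI)
    show "gf_T0 f = (\<lambda>q w. (q \<bullet> w - g w) + (- h w))" by (auto simp: gf_T0_def f fun_eq_iff)
    show "smooth (\<lambda>(q, w). q \<bullet> w - g w)"
      unfolding case_prod_unfold by (intro smooth_diff smooth_inner smooth_fst smooth_snd smooth_compose[OF sg])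
    show "smooth (\<lambda>(q :: real ^ 'n, w). - h w)"
      unfolding case_prod_unfold by (intro smooth_minus smooth_compose[OF h(1)] smooth_snd)
    show "norm (grad (\<lambda>w. - h w) w) \<le> K" for w by (simp add: grad_minus[OF h(1)] h(2))
    fix q :: "real ^ 'n"
    have bij: "bij (grad g)" and "smooth (inv_into UNIV (grad g))"
      using g by (auto simp: simple_def diffeomorphism_def)
    have lin: "smooth (\<lambda>w. q \<bullet> w)" by (intro smooth_inner smooth_const smooth_ident)
    have grad: "grad (\<lambda>w. q \<bullet> w - g w) = (\<lambda>w. q - grad g w)"
      using grad_add[OF lin smooth_minus[OF sg]] by (simp add: grad_inner_left grad_minus[OF sg])
    have "diffeomorphism (\<lambda>w. q - grad g w)"
      by (rule diffeomorphismI[where \<psi>="\<lambda>y. inv_into UNIV (grad g) (q - y)"])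
        (use bij in \<open>auto intro!: smooth_diff smooth_const smooth_ident smooth_grad sg
          smooth_compose[OF \<open>smooth (inv_into UNIV (grad g))\<close>] simp: bij_is_inj bij_is_surj surj_f_inv_f\<close>)
    then show "simple (\<lambda>w. q \<bullet> w - g w)"
      unfolding simple_def grad by (intro conjI smooth_diff lin sg)
  qed
  have "\<exists>s. is_minmax (gf_T0 f q) s \<and> ereal s = fenchel f q" for q
  proof -
    let ?F = "\<lambda>v. g v + (h v + - q \<bullet> v)"
    have lin: "smooth (\<lambda>v. - q \<bullet> v)" by (intro smooth_inner smooth_const smooth_ident)
    have "norm (grad (\<lambda>v. h v + - q \<bullet> v) v) \<le> K + norm q" for v
      unfolding grad_add[OF h(1) lin] grad_inner_left
      using norm_triangle_ineq4[of "grad h v" q] h(2)[of v] by simp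
    then have "bounded (range (grad (\<lambda>v. h v + - q \<bullet> v)))" by (auto simp: bounded_iff)
    then have st: "steep ?F" by (rule steep_elliptic_plus_bounded[OF g(2) smooth_add[OF h(1) lin]])
    then have "continuous_on UNIV ?F" "superlinear ?F" by (auto simp: steep_def smooth_continuous_on)
    then obtain m where m: "\<And>v. ?F m \<le> ?F v" using superlinear_attains_min by blast
    have eq: "gf_T0 f q = (\<lambda>v. - ?F v)" by (auto simp: gf_T0_def f fun_eq_iff)
    have "fenchel f q = (SUP v. ereal (- ?F v))"
      unfolding fenchel_def f by (simp add: algebra_simps)
    also have "\<dots> = ereal (- ?F m)"
    proof (rule SUP_eqI)
      show "ereal (- ?F v) \<le> ereal (- ?F m)" for v using m[of v] by (simp only: ereal_less_eq neg_le_iff_le)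
    qed auto
    finally show ?thesis using is_minmax_maximum[OF st m] unfolding eq by auto
  qed
  then obtain s where s: "\<And>q. is_minmax (gf_T0 f q) (s q)" "\<And>q. ereal (s q) = fenchel f q" by metis
  show "has_selector (gf_T0 f)" "ereal (selector (gf_T0 f) q) = fenchel f q"
    using has_selectorI[OF asgf s(1)] s(2) by auto
qed

proposition selector_double_transform:
  fixes f :: "real ^ 'n \<Rightarrow> real"
  assumes "almost_convex f"
  shows "has_selector (gf_T (gf_T0 f))" "selector (gf_T (gf_T0 f)) q = f q"
proof -
  obtain g h K where f: "f = (\<lambda>x. g x + h x)" and g: "simple g" "elliptic g"
    and h: "smooth h" "\<And>x. norm (grad h x) \<le> K"
    using almost_convexE[OF assms] by blast
  have sg: "smooth g" using g by (simp add: simple_def)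
  have sf: "smooth f" unfolding f by (rule smooth_add[OF sg h(1)])
  have asgf: "almost_simple_gf (gf_T (gf_T0 f))"
  proof (rule almost_simple_gfI)
    show "gf_T (gf_T0 f) = (\<lambda>q z. (case z of (v, w) \<Rightarrow> q \<bullet> v - (v \<bullet> w - g w)) + h (snd z))"
      by (auto simp: gf_T_def gf_T0_def f fun_eq_iff)
    show "smooth (\<lambda>(q, z). case z of (v, w) \<Rightarrow> q \<bullet> v - (v \<bullet> w - g w))"
      unfolding case_prod_unfold
      by (intro smooth_diff smooth_inner smooth_fst smooth_snd smooth_compose[OF sg]
          smooth_compose[OF smooth_fst] smooth_compose[OF smooth_snd])
    show "smooth (\<lambda>(q :: real ^ 'n, z :: (real ^ 'n) \<times> (real ^ 'n)). h (snd z))"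
      unfolding case_prod_unfold by (intro smooth_compose[OF h(1)] smooth_compose[OF smooth_snd] smooth_snd)
    show "simple (\<lambda>z. case z of (v, w) \<Rightarrow> q \<bullet> v - (v \<bullet> w - g w))" for q
      by (rule simple_saddle[OF sg])
    fix z :: "(real^'n) \<times> (real^'n)"
    have "((\<lambda>z. h (snd z)) has_derivative (\<lambda>u. 0 \<bullet> fst u + grad h (snd z) \<bullet> snd u)) (at z)"
      using diff_chain_at[OF has_derivative_snd[OF has_derivative_ident] smooth_has_derivative_grad[OF h(1)]]
      by (simp add: o_def)
    then have "grad (\<lambda>z. h (snd z)) z = (0, grad h (snd z))" by (rule grad_Pair_eqI)
    then show "norm (grad (\<lambda>z. h (snd z)) z) \<le> K" by (simp add: norm_Pair h(2))
  qed
  have "is_minmax (gf_T (gf_T0 f) q) (f q)" for q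
    using is_minmax_double_transform[OF sf, of q] by (simp add: gf_T_def gf_T0_def)
  from has_selectorI[OF asgf this]
  show "has_selector (gf_T (gf_T0 f))" "selector (gf_T (gf_T0 f)) q = f q" by auto
qed

proposition selector_box:
  fixes f1 f2 :: "real ^ 'n \<Rightarrow> real"
  assumes "almost_convex f1" "almost_convex f2"
  shows "has_selector (gf_box f1 f2)" "ereal (selector (gf_box f1 f2) q) = inf_convolution f1 f2 q"
proof -
  obtain g1 h1 K1 where f1: "f1 = (\<lambda>x. g1 x + h1 x)" and g1: "simple g1" "elliptic g1"
    and h1: "smooth h1" "\<And>x. norm (grad h1 x) \<le> K1"
    using almost_convexE[OF assms(1)] by blast
  obtain g2 h2 K2 where f2: "f2 = (\<lambda>x. g2 x + h2 x)" and g2: "simple g2" "elliptic g2"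
    and h2: "smooth h2" "\<And>x. norm (grad h2 x) \<le> K2"
    using almost_convexE[OF assms(2)] by blast
  have sg: "smooth g1" "smooth g2" using g1 g2 by (auto simp: elliptic_def)
  have refl: "smooth (\<lambda>v. h2 (q - v))" for q
    by (intro smooth_compose[OF h2(1)] smooth_diff smooth_const smooth_ident)
  have H: "smooth (\<lambda>v. h1 v + h2 (q - v))" for q by (rule smooth_add[OF h1(1) refl])
  have K: "norm (grad (\<lambda>v. h1 v + h2 (q - v)) v) \<le> K1 + K2" for q v
    unfolding grad_add[OF h1(1) refl] grad_reflect[OF h2(1)]
    using norm_triangle_ineq4[of "grad h1 v" "grad h2 (q - v)"] h1(2)[of v] h2(2)[of "q - v"] by simp
  have asgf: "almost_simple_gf (gf_box f1 f2)"
  proof (rule almost_simple_gfI)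
    show "gf_box f1 f2 = (\<lambda>q v. (g1 v + g2 (q - v)) + (h1 v + h2 (q - v)))"
      by (auto simp: gf_box_def f1 f2 fun_eq_iff)
    show "smooth (\<lambda>(q, v). g1 v + g2 (q - v))" "smooth (\<lambda>(q, v). h1 v + h2 (q - v))"
      unfolding case_prod_unfold
      by (intro smooth_add smooth_diff smooth_fst smooth_snd smooth_compose[OF sg(1)] smooth_compose[OF sg(2)]
          smooth_compose[OF h1(1)] smooth_compose[OF h2(1)])+
    show "simple (\<lambda>v. g1 v + g2 (q - v))" for q by (rule simple_of_elliptic[OF elliptic_box[OF g1(2) g2(2)]])
  qed (rule K)
  have "\<exists>s. is_minmax (gf_box f1 f2 q) s \<and> ereal s = inf_convolution f1 f2 q" for q
  proof -
    let ?F = "\<lambda>v. (g1 v + g2 (q - v)) + (h1 v + h2 (q - v))"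
    have "bounded (range (grad (\<lambda>v. h1 v + h2 (q - v))))" using K by (auto simp: bounded_iff)
    then have st: "steep ?F" by (rule steep_elliptic_plus_bounded[OF elliptic_box[OF g1(2) g2(2)] H])
    then have "continuous_on UNIV ?F" "superlinear ?F" by (auto simp: steep_def smooth_continuous_on)
    then obtain m where m: "\<And>v. ?F m \<le> ?F v" using superlinear_attains_min by blast
    have eq: "gf_box f1 f2 q = ?F" by (auto simp: gf_box_def f1 f2 fun_eq_iff)
    have "inf_convolution f1 f2 q = (INF v. ereal (?F v))"
      unfolding inf_convolution_def f1 f2 by (simp add: algebra_simps)
    also have "\<dots> = ereal (?F m)" by (rule INF_eqI) (use m in auto)
    finally show ?thesis using is_minmax_minimum[OF st m] unfolding eq by auto
  qed
  then obtain s where s: "\<And>q. is_minmax (gf_box f1 f2 q) (s q)" "\<And>q. ereal (s q) = inf_convolution f1 f2 q" by metis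
  show "has_selector (gf_box f1 f2)" "ereal (selector (gf_box f1 f2) q) = inf_convolution f1 f2 q"
    using has_selectorI[OF asgf s(1)] s(2) by auto
qed

theorem corollary3p35:
  shows "(\<forall>f :: real ^ 'n \<Rightarrow> real. almost_convex f \<longrightarrow>
            has_selector (gf_T0 f) \<and>
            (\<lambda>q. ereal (selector (gf_T0 f) q)) = fenchel f \<and>
            has_selector (gf_T (gf_T0 f)) \<and>
            selector (gf_T (gf_T0 f)) = f)
       \<and> (\<forall>(f1 :: real ^ 'n \<Rightarrow> real) f2. almost_convex f1 \<longrightarrow> almost_convex f2 \<longrightarrow>
            has_selector (gf_box f1 f2) \<and>
            (\<lambda>q. ereal (selector (gf_box f1 f2) q)) = inf_convolution f1 f2)"
  by (auto simp: selector_transform selector_double_transform selector_box)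

end
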